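(* Let $\Gamma$ be a countable group. Consider the following two conditions: (1) Every Noetherian $\Gamma$-action $(X,\alpha)$ with $X\neq\{0\}$ has a non-zero $\alpha$-periodic point. (2) The group $H^1_v(\alpha)$ is trivial for every Noetherian $\Gamma$-action $(X,\alpha)$ on a zero-dimensional group $X$. If $\Gamma$ satisfies both (1) and (2), then every Noetherian action of $\Gamma$ on a compact abelian group (not necessarily zero-dimensional) admits a dense set of periodic points. Conversely, if every Noetherian $\Gamma$-action admits a dense set of periodic points, then both (1) and (2) are satisfied.
   Context: An algebraic $\Gamma$-action $(X,\alpha)$ of a countable (discrete) group $\Gamma$ is an action $\alpha$ of $\Gamma$ on a compact metrizable abelian group $X$ (written additively) by continuous automorphisms. The dual action makes the Pontryagin dual $\widehat{X}$ a module over the integral group ring $\mathbb{Z}[\Gamma]$. The action (or $\Gamma$-action) is Noetherian if $\widehat{X}$ is a Noetherian $\mathbb{Z}[\Gamma]$-module; equivalently, every decreasing sequence of closed $\Gamma$-invariant subgroups of $X$ stabilizes. A point $x\in X$ is periodic ($\alpha$-periodic) if its $\Gamma$-orbit is finite. A compact abelian group $X$ is zero-dimensional if the connected component of $0_X$ is trivial. Virtual first cohomology. A virtual 1-cocycle of $\alpha$ is a map $c:\Lambda\to X$, where $\Lambda\subset\Gamma$ is a finite index subgroup, such that $c(\gamma\gamma')=c(\gamma)+\alpha(\gamma)(c(\gamma'))$ for all $\gamma,\gamma'\in\Lambda$. Two virtual 1-cocycles $c_1:\Lambda_1\to X$ and $c_2:\Lambda_2\to X$ are equivalent if there is a finite index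 subgroup $\Lambda\subset\Lambda_1\cap\Lambda_2$ with $c_1(\gamma)=c_2(\gamma)$ for all $\gamma\in\Lambda$. For $x\in X$ let $c_x:\Gamma\to X$, $c_x(\gamma)=\alpha(\gamma)(x)-x$. A virtual 1-cocycle is a virtual coboundary if it is equivalent to $c_x$ for some $x\in X$. Equivalence classes of virtual 1-cocycles form an abelian group under pointwise addition (on a common finite index subgroup), the classes of virtual coboundaries form a subgroup, and the quotient group is denoted $H^1_v(\alpha)$, the virtual first cohomology group of $\alpha$. *)

theory Defs
  imports "HOL-Analysis.Analysis" "HOL-Algebra.Group_Action" "HOL-Algebra.FiniteProduct" "HOL-Algebra.Elementary_Groups"
begin

text \<open>
  Abelian groups are written multiplicatively, as usual for \<^const>\<open>comm_group\<close>: the sum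
  \<open>x + y\<close>, the difference \<open>x - y\<close> and the zero element of \<open>X\<close> are \<open>x \<otimes>\<^bsub>X\<^esub> y\<close>,
  \<open>x \<otimes>\<^bsub>X\<^esub> inv\<^bsub>X\<^esub> y\<close> and \<open>\<one>\<^bsub>X\<^esub>\<close>.
\<close>

definition compact_metrizable_abelian_group ::
    "('x, 'n) monoid_scheme \<Rightarrow> 'x topology \<Rightarrow> bool" where
  "compact_metrizable_abelian_group X T \<longleftrightarrow>
     comm_group X \<and> topspace T = carrier X \<and>
     continuous_map (prod_topology T T) T (\<lambda>(x, y). x \<otimes>\<^bsub>X\<^esub> y) \<and>
     continuous_map T T (\<lambda>x. inv\<^bsub>X\<^esub> x) \<and>
     compact_space T \<and> metrizable_space T"

definition algebraic_action ::
    "('g, 'm) monoid_scheme \<Rightarrow> ('x, 'n) monoid_scheme \<Rightarrow> 'x topology \<Rightarrow> ('g \<Rightarrow> 'x \<Rightarrow> 'x) \<Rightarrow> bool"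
  where
  "algebraic_action G X T \<alpha> \<longleftrightarrow>
     compact_metrizable_abelian_group X T \<and>
     group_hom G (AutoGroup X) \<alpha> \<and>
     (\<forall>g\<in>carrier G. continuous_map T T (\<alpha> g))"

definition periodic_point :: "('g, 'm) monoid_scheme \<Rightarrow> ('g \<Rightarrow> 'x \<Rightarrow> 'x) \<Rightarrow> 'x \<Rightarrow> bool" where
  "periodic_point G \<alpha> x \<longleftrightarrow> finite (orbit G \<alpha> x)"

definition zero_dimensional :: "('x, 'n) monoid_scheme \<Rightarrow> 'x topology \<Rightarrow> bool" where
  "zero_dimensional X T \<longleftrightarrow> connected_component_of_set T \<one>\<^bsub>X\<^esub> = {\<one>\<^bsub>X\<^esub>}"

definition circle_group :: "complex monoid" where
  "circle_group = \<lparr>carrier = sphere 0 1, mult = (*), one = 1\<rparr>"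

text \<open>Characters are made extensional, so that each of them is a single HOL function.\<close>

definition pontryagin_dual ::
    "('x, 'n) monoid_scheme \<Rightarrow> 'x topology \<Rightarrow> ('x \<Rightarrow> complex) monoid" where
  "pontryagin_dual X T =
     \<lparr>carrier = {\<phi> \<in> hom X circle_group.
                  \<phi> \<in> extensional (carrier X) \<and>
                  continuous_map T (top_of_set (sphere 0 1)) \<phi>},
      mult = (\<lambda>\<phi> \<psi>. \<lambda>x\<in>carrier X. \<phi> x * \<psi> x),
      one = (\<lambda>x\<in>carrier X. 1)\<rparr>"

definition dual_action ::
    "('g, 'm) monoid_scheme \<Rightarrow> ('x, 'n) monoid_scheme \<Rightarrow> ('g \<Rightarrow> 'x \<Rightarrow> 'x) \<Rightarrow>
     'g \<Rightarrow> ('x \<Rightarrow> complex) \<Rightarrow> 'x \<Rightarrow> complex" where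
  "dual_action G X \<alpha> g \<phi> = (\<lambda>x\<in>carrier X. \<phi> (\<alpha> (inv\<^bsub>G\<^esub> g) x))"

text \<open>
  The elements of the integral group ring, as finitely supported functions; \<open>f\<close> stands for the
  formal sum of the terms \<open>f(g) g\<close>.  The convolution product is not needed to say what a
  submodule is.
\<close>

definition group_ring_elems :: "('g, 'm) monoid_scheme \<Rightarrow> ('g \<Rightarrow> int) set" where
  "group_ring_elems G = {f. finite {g. f g \<noteq> 0} \<and> {g. f g \<noteq> 0} \<subseteq> carrier G}"

definition dual_smult ::
    "('g, 'm) monoid_scheme \<Rightarrow> ('x, 'n) monoid_scheme \<Rightarrow> 'x topology \<Rightarrow> ('g \<Rightarrow> 'x \<Rightarrow> 'x) \<Rightarrow>
     ('g \<Rightarrow> int) \<Rightarrow> ('x \<Rightarrow> complex) \<Rightarrow> 'x \<Rightarrow> complex" where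
  "dual_smult G X T \<alpha> f \<phi> =
     finprod (pontryagin_dual X T)
       (\<lambda>g. dual_action G X \<alpha> g \<phi> [^]\<^bsub>pontryagin_dual X T\<^esub> f g) {g. f g \<noteq> 0}"

definition dual_submodule ::
    "('g, 'm) monoid_scheme \<Rightarrow> ('x, 'n) monoid_scheme \<Rightarrow> 'x topology \<Rightarrow> ('g \<Rightarrow> 'x \<Rightarrow> 'x) \<Rightarrow>
     ('x \<Rightarrow> complex) set \<Rightarrow> bool" where
  "dual_submodule G X T \<alpha> N \<longleftrightarrow>
     subgroup N (pontryagin_dual X T) \<and>
     (\<forall>f\<in>group_ring_elems G. \<forall>\<phi>\<in>N. dual_smult G X T \<alpha> f \<phi> \<in> N)"

definition dual_span ::
    "('g, 'm) monoid_scheme \<Rightarrow> ('x, 'n) monoid_scheme \<Rightarrow> 'x topology \<Rightarrow> ('g \<Rightarrow> 'x \<Rightarrow> 'x) \<Rightarrow>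
     ('x \<Rightarrow> complex) set \<Rightarrow> ('x \<Rightarrow> complex) set" where
  "dual_span G X T \<alpha> S = \<Inter>{N. dual_submodule G X T \<alpha> N \<and> S \<subseteq> N}"

definition noetherian_dual ::
    "('g, 'm) monoid_scheme \<Rightarrow> ('x, 'n) monoid_scheme \<Rightarrow> 'x topology \<Rightarrow> ('g \<Rightarrow> 'x \<Rightarrow> 'x) \<Rightarrow> bool"
  where
  "noetherian_dual G X T \<alpha> \<longleftrightarrow>
     (\<forall>N. dual_submodule G X T \<alpha> N \<longrightarrow>
        (\<exists>S. finite S \<and> S \<subseteq> N \<and> N = dual_span G X T \<alpha> S))"

definition noetherian_action ::
    "('g, 'm) monoid_scheme \<Rightarrow> ('x, 'n) monoid_scheme \<Rightarrow> 'x topology \<Rightarrow> ('g \<Rightarrow> 'x \<Rightarrow> 'x) \<Rightarrow> bool"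
  where
  "noetherian_action G X T \<alpha> \<longleftrightarrow> algebraic_action G X T \<alpha> \<and> noetherian_dual G X T \<alpha>"

definition finite_index_subgroup :: "'g set \<Rightarrow> ('g, 'm) monoid_scheme \<Rightarrow> bool" where
  "finite_index_subgroup L G \<longleftrightarrow> subgroup L G \<and> finite (rcosets\<^bsub>G\<^esub> L)"

text \<open>
  A virtual cocycle is a pair of a finite index subgroup \<open>L\<close> and a map from \<open>L\<close> to \<open>X\<close>; by
  extensionality the second component carries no information outside \<open>L\<close>.
\<close>

definition virtual_cocycles ::
    "('g, 'm) monoid_scheme \<Rightarrow> ('x, 'n) monoid_scheme \<Rightarrow> ('g \<Rightarrow> 'x \<Rightarrow> 'x) \<Rightarrow>
     ('g set \<times> ('g \<Rightarrow> 'x)) set" where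
  "virtual_cocycles G X \<alpha> =
     {(L, c). finite_index_subgroup L G \<and> c \<in> L \<rightarrow>\<^sub>E carrier X \<and>
        (\<forall>g\<in>L. \<forall>h\<in>L. c (g \<otimes>\<^bsub>G\<^esub> h) = c g \<otimes>\<^bsub>X\<^esub> \<alpha> g (c h))}"

definition virtual_equiv ::
    "('g, 'm) monoid_scheme \<Rightarrow> ('x, 'n) monoid_scheme \<Rightarrow> ('g \<Rightarrow> 'x \<Rightarrow> 'x) \<Rightarrow>
     (('g set \<times> ('g \<Rightarrow> 'x)) \<times> ('g set \<times> ('g \<Rightarrow> 'x))) set" where
  "virtual_equiv G X \<alpha> =
     {((L1, c1), (L2, c2)).
        (L1, c1) \<in> virtual_cocycles G X \<alpha> \<and> (L2, c2) \<in> virtual_cocycles G X \<alpha> \<and>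
        (\<exists>L. finite_index_subgroup L G \<and> L \<subseteq> L1 \<inter> L2 \<and> (\<forall>g\<in>L. c1 g = c2 g))}"

definition cocycle_mult ::
    "('x, 'n) monoid_scheme \<Rightarrow> 'g set \<times> ('g \<Rightarrow> 'x) \<Rightarrow> 'g set \<times> ('g \<Rightarrow> 'x) \<Rightarrow>
     'g set \<times> ('g \<Rightarrow> 'x)" where
  "cocycle_mult X = (\<lambda>(L1, c1) (L2, c2). (L1 \<inter> L2, \<lambda>g\<in>L1 \<inter> L2. c1 g \<otimes>\<^bsub>X\<^esub> c2 g))"

definition coboundary ::
    "('g, 'm) monoid_scheme \<Rightarrow> ('x, 'n) monoid_scheme \<Rightarrow> ('g \<Rightarrow> 'x \<Rightarrow> 'x) \<Rightarrow> 'x \<Rightarrow>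
     'g set \<times> ('g \<Rightarrow> 'x)" where
  "coboundary G X \<alpha> x = (carrier G, \<lambda>g\<in>carrier G. \<alpha> g x \<otimes>\<^bsub>X\<^esub> inv\<^bsub>X\<^esub> x)"

definition virtual_cocycle_classes ::
    "('g, 'm) monoid_scheme \<Rightarrow> ('x, 'n) monoid_scheme \<Rightarrow> ('g \<Rightarrow> 'x \<Rightarrow> 'x) \<Rightarrow>
     ('g set \<times> ('g \<Rightarrow> 'x)) set monoid" where
  "virtual_cocycle_classes G X \<alpha> =
     \<lparr>carrier = virtual_cocycles G X \<alpha> // virtual_equiv G X \<alpha>,
      mult = (\<lambda>A B. \<Union>a\<in>A. \<Union>b\<in>B. virtual_equiv G X \<alpha> `` {cocycle_mult X a b}),
      one = virtual_equiv G X \<alpha> `` {(carrier G, \<lambda>g\<in>carrier G. \<one>\<^bsub>X\<^esub>)}\<rparr>"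

definition virtual_coboundaries ::
    "('g, 'm) monoid_scheme \<Rightarrow> ('x, 'n) monoid_scheme \<Rightarrow> ('g \<Rightarrow> 'x \<Rightarrow> 'x) \<Rightarrow>
     ('g set \<times> ('g \<Rightarrow> 'x)) set" where
  "virtual_coboundaries G X \<alpha> =
     {a \<in> virtual_cocycles G X \<alpha>. \<exists>x\<in>carrier X. (a, coboundary G X \<alpha> x) \<in> virtual_equiv G X \<alpha>}"

definition virtual_H1 ::
    "('g, 'm) monoid_scheme \<Rightarrow> ('x, 'n) monoid_scheme \<Rightarrow> ('g \<Rightarrow> 'x \<Rightarrow> 'x) \<Rightarrow>
     ('g set \<times> ('g \<Rightarrow> 'x)) set set monoid" where
  "virtual_H1 G X \<alpha> =
     virtual_cocycle_classes G X \<alpha> Mod (virtual_coboundaries G X \<alpha> // virtual_equiv G X \<alpha>)"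

text \<open>
  HOL cannot quantify over types inside a formula, so each condition ranges over the actions on
  groups whose carrier is a subset of a given type.  A compact metrizable space has at most
  continuum many points, so the instance at \<^typ>\<open>real\<close> already covers all algebraic actions up to
  isomorphism.
\<close>

definition nonzero_periodic_points :: "'x itself \<Rightarrow> ('g, 'm) monoid_scheme \<Rightarrow> bool" where
  "nonzero_periodic_points TYPE('x) G \<longleftrightarrow>
     (\<forall>(X :: 'x monoid) T \<alpha>. noetherian_action G X T \<alpha> \<and> carrier X \<noteq> {\<one>\<^bsub>X\<^esub>} \<longrightarrow>
        (\<exists>x\<in>carrier X. x \<noteq> \<one>\<^bsub>X\<^esub> \<and> periodic_point G \<alpha> x))"

definition trivial_virtual_H1 :: "'x itself \<Rightarrow> ('g, 'm) monoid_scheme \<Rightarrow> bool" where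
  "trivial_virtual_H1 TYPE('x) G \<longleftrightarrow>
     (\<forall>(X :: 'x monoid) T \<alpha>. noetherian_action G X T \<alpha> \<and> zero_dimensional X T \<longrightarrow>
        trivial_group (virtual_H1 G X \<alpha>))"

definition dense_periodic_points :: "'x itself \<Rightarrow> ('g, 'm) monoid_scheme \<Rightarrow> bool" where
  "dense_periodic_points TYPE('x) G \<longleftrightarrow>
     (\<forall>(X :: 'x monoid) T \<alpha>. noetherian_action G X T \<alpha> \<longrightarrow>
        T closure_of {x \<in> carrier X. periodic_point G \<alpha> x} = topspace T)"

end

theory Submission
  imports Defs "HOL-Complex_Analysis.Great_Picard" "HOL-Algebra.Product_Groups"
begin

text \<open>
  Duality rests on two facts about a compact abelian group: characters separate a closed subgroup
  from the points outside it, and characters of closed subgroups extend.  Both come from one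
  maximisation.  In the cone generated by the functions \<open>f * f\<^sup>*\<close>, with \<open>f\<close> transforming under the
  subgroup by a given character, the normalised \<open>h\<close> that first maximise \<open>(g * h)(1)\<close> and then the
  mean of \<open>\<bar>h\<bar>\<^sup>2\<close> behave like extreme points, and are therefore characters.  So closed invariant
  subgroups of a Noetherian \<open>X\<close> satisfy the descending chain condition, and they, their quotients
  and finite extensions are again Noetherian.

  Assume (1) and (2), and let \<open>Y\<close> be the closure of the periodic torsion points.  If \<open>Y \<noteq> X\<close>, then
  by (1) the quotient \<open>X/Y\<close> has a nontrivial periodic point, hence one of finite order \<open>n\<close>: the
  points fixed by a finite index subgroup form a group with finitely generated dual, which would be
  divisible, and so trivial, if there were no torsion.  By the chain condition \<open>mY\<close> is divisible
  for some \<open>m > 0\<close>, so that the point lifts to some \<open>y\<close> with \<open>mny = 0\<close>.  On the stabiliser of its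
  image, \<open>g \<mapsto> gy - y\<close> is a cocycle in the group of \<open>mn\<close>-torsion points of \<open>Y\<close>, which is zero-dimensional.
  By (2) it is virtually the coboundary of some \<open>v \<in> Y\<close>, and \<open>y - v\<close> is a periodic torsion point
  outside \<open>Y\<close>, a contradiction.

  Conversely, density trivially implies (1).  A zero-dimensional Noetherian \<open>X\<close> has finite exponent
  \<open>n\<close>, and a cocycle \<open>c\<close> on \<open>L\<close> turns \<open>X \<times> (\<int>/n)\<^sup>I\<close>, where \<open>I\<close> is the set of cosets of \<open>L\<close>, into a
  Noetherian action in which the stabiliser of \<open>(x, e)\<close>, with \<open>e\<close> the indicator of the coset \<open>L\<close>,
  consists of \<open>g\<close> with \<open>gx + c(g) = x\<close>.  Hence a periodic point in the open set \<open>X \<times> {e}\<close> exhibits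
  \<open>c\<close> as a virtual coboundary.
\<close>

section \<open>Invariant means\<close>

text \<open>The normalised cone is not compact for uniform convergence, so a maximiser has to be
  earned. If \<open>h\<close> nearly maximises against the kernel \<open>g\<close>, then
  \<open>top * h - g * h\<close> satisfies two-point positivity inequalities and is small at the
  unit, hence uniformly small. So \<open>h\<close> is nearly a convolution with the one function
  \<open>g\<close>, and such convolutions are equicontinuous. A maximiser of the linear functional
  need not be extreme; the mean square is strictly convex, and a point maximising it among the
  maximisers cannot be split properly. The integral behind all this is a mean, obtained from finite
  averages of translates.

  Condition (2) covers only zero-dimensional groups, which is why torsion runs through the first
  implication: lifting a torsion point to a torsion point confines its cocycle to a group of bounded
  exponent. Both conditions are available on sets of reals. Quotients and torsion subgroups are
  therefore transported there, by recording the values of countably many characters; this is where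
  countability of the acting group enters.\<close>

definition avg :: "'a list \<Rightarrow> ('a \<Rightarrow> complex) \<Rightarrow> complex" where
  "avg ts f = (\<Sum>t\<leftarrow>ts. f t) / of_nat (length ts)"

lemma avg_add: "avg ts (\<lambda>t. f t + g t) = avg ts f + avg ts g"
  by (simp add: avg_def sum_list_addf add_divide_distrib)

lemma avg_diff: "avg ts (\<lambda>t. f t - g t) = avg ts f - avg ts g"
  by (simp add: avg_def sum_list_subtractf diff_divide_distrib)

lemma avg_cmult: "avg ts (\<lambda>t. c * f t) = c * avg ts f"
  by (simp add: avg_def sum_list_const_mult)

lemma avg_const: "ts \<noteq> [] \<Longrightarrow> avg ts (\<lambda>t. c) = c"
  by (simp add: avg_def sum_list_triv)

lemma avg_cong: "(\<And>t. t \<in> set ts \<Longrightarrow> f t = g t) \<Longrightarrow> avg ts f = avg ts g"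
  unfolding avg_def by (metis map_cong)

lemma avg_map: "avg (map h ts) f = avg ts (\<lambda>t. f (h t))"
  by (simp add: avg_def comp_def)

lemma norm_avg_le:
  assumes "\<And>t. t \<in> set ts \<Longrightarrow> norm (f t) \<le> e" "ts \<noteq> []"
  shows "norm (avg ts f) \<le> e"
proof -
  have "norm (\<Sum>t\<leftarrow>ts. f t) \<le> real (length ts) * e"
    using assms(1)
  proof (induction ts)
    case (Cons a ts)
    then have "norm (f a) \<le> e" "norm (\<Sum>t\<leftarrow>ts. f t) \<le> real (length ts) * e"
      by auto
    then show ?case
      by (simp add: algebra_simps norm_triangle_le)
  qed simp
  then show ?thesis
    using \<open>ts \<noteq> []\<close> by (simp add: avg_def norm_divide field_simps)
qed

lemma norm_avg_diff_le:
  assumes "\<And>t. t \<in> set ts \<Longrightarrow> norm (f t - g t) \<le> e" "ts \<noteq> []"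
  shows "norm (avg ts f - avg ts g) \<le> e"
  using norm_avg_le [OF assms] by (simp add: avg_diff)

lemma norm_avg_minus_const_le:
  assumes "\<And>t. t \<in> set ts \<Longrightarrow> norm (f t - c) \<le> e" "ts \<noteq> []"
  shows "norm (avg ts f - c) \<le> e"
  using norm_avg_diff_le [of ts f "\<lambda>_. c" e] assms by (simp add: avg_const)

lemma sum_list_swap:
  fixes F :: "'a \<Rightarrow> 'b \<Rightarrow> 'c::comm_monoid_add"
  shows "(\<Sum>t\<leftarrow>ts. \<Sum>u\<leftarrow>us. F t u) = (\<Sum>u\<leftarrow>us. \<Sum>t\<leftarrow>ts. F t u)"
  by (induction ts) (simp_all add: sum_list_addf)

lemma sum_list_divide:
  fixes f :: "'a \<Rightarrow> complex"
  shows "(\<Sum>t\<leftarrow>ts. f t / c) = (\<Sum>t\<leftarrow>ts. f t) / c"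
  by (induction ts) (simp_all add: add_divide_distrib)

lemma avg_swap: "avg ts (\<lambda>t. avg us (F t)) = avg us (\<lambda>u. avg ts (\<lambda>t. F t u))"
  by (simp add: avg_def sum_list_divide sum_list_swap [of F us ts] mult.commute)

text \<open>Averages run over lists and not over finite sets, so that coinciding products keep their
  multiplicity and an average over products is exactly an iterated one.\<close>

lemma avg_product:
  "avg (map (\<lambda>(t, u). h t u) (List.product ts us)) f = avg ts (\<lambda>t. avg us (\<lambda>u. f (h t u)))"
proof -
  have "(\<Sum>p\<leftarrow>List.product ts us. f (case p of (t, u) \<Rightarrow> h t u)) = (\<Sum>t\<leftarrow>ts. \<Sum>u\<leftarrow>us. f (h t u))"
    by (induction ts) (simp_all add: comp_def)
  then show ?thesis
    by (simp add: avg_def comp_def sum_list_divide mult.commute)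
qed

section \<open>Compact metrizable abelian groups: uniform continuity and finite nets\<close>

locale compact_abelian_group =
  fixes X :: "('x, 'n) monoid_scheme" (structure) and T :: "'x topology"
  assumes compact_metrizable_abelian_group: "compact_metrizable_abelian_group X T"

sublocale compact_abelian_group \<subseteq> comm_group X
  using compact_metrizable_abelian_group unfolding compact_metrizable_abelian_group_def by auto

context compact_abelian_group
begin

lemma topspace_eq [simp]: "topspace T = carrier X"
  and cont_mult: "continuous_map (prod_topology T T) T (\<lambda>(x, y). x \<otimes> y)"
  and cont_inv: "continuous_map T T (\<lambda>x. inv x)"
  and compact: "compact_space T"
  and metrizable: "metrizable_space T"
  using compact_metrizable_abelian_group unfolding compact_metrizable_abelian_group_def by auto

lemma mult_inv_cancel: "d \<in> carrier X \<Longrightarrow> z \<in> carrier X \<Longrightarrow> d \<otimes> (inv d \<otimes> z) = z"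
  by (simp add: m_assoc [symmetric])

lemma Hausdorff: "Hausdorff_space T"
  using metrizable metrizable_imp_Hausdorff_space by blast

lemma continuous_map_mult2:
  assumes "continuous_map S T f" "continuous_map S T g"
  shows "continuous_map S T (\<lambda>x. f x \<otimes> g x)"
proof -
  have "continuous_map S (prod_topology T T) (\<lambda>x. (f x, g x))"
    using assms by (simp add: continuous_map_pairwise o_def)
  then show ?thesis
    using continuous_map_compose [OF _ cont_mult] by (force simp: o_def)
qed

lemma continuous_map_inv2:
  "continuous_map S T f \<Longrightarrow> continuous_map S T (\<lambda>x. inv (f x))"
  using continuous_map_compose [OF _ cont_inv] by (force simp: o_def)

lemma continuous_map_const_in: "a \<in> carrier X \<Longrightarrow> continuous_map S T (\<lambda>x. a)"
  by simp

abbreviation cont :: "('x \<Rightarrow> complex) \<Rightarrow> bool" where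
  "cont f \<equiv> continuous_map T euclidean f"

lemma cont_translate: "cont f \<Longrightarrow> a \<in> carrier X \<Longrightarrow> cont (\<lambda>x. f (a \<otimes> x))"
  using continuous_map_compose [of T T "\<lambda>x. a \<otimes> x" euclidean f]
  by (simp add: o_def continuous_map_mult2)

lemma cont_translate': "cont f \<Longrightarrow> a \<in> carrier X \<Longrightarrow> cont (\<lambda>x. f (x \<otimes> a))"
  using continuous_map_compose [of T T "\<lambda>x. x \<otimes> a" euclidean f]
  by (simp add: o_def continuous_map_mult2)

lemma cont_inverse: "cont f \<Longrightarrow> cont (\<lambda>x. f (inv x))"
  using continuous_map_compose [of T T "\<lambda>x. inv x" euclidean f]
  by (simp add: o_def continuous_map_inv2)

lemma cont_complex_mult: "cont f \<Longrightarrow> cont g \<Longrightarrow> cont (\<lambda>x. f x * g x)"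
  by (simp add: continuous_map_atin tendsto_mult)

lemma cont_cnj: "cont f \<Longrightarrow> cont (\<lambda>x. cnj (f x))"
  by (simp add: continuous_map_atin tendsto_cnj)

lemmas cont_intros = continuous_map_canonical_const continuous_map_add continuous_map_diff
  continuous_map_minus cont_complex_mult cont_cnj cont_translate cont_translate' cont_inverse

lemma cont_bounded:
  assumes "cont f"
  obtains B where "B > 0" "\<And>x. x \<in> carrier X \<Longrightarrow> norm (f x) \<le> B"
proof -
  have "compact (f ` carrier X)"
    using image_compactin [OF _ assms] compact unfolding compact_space_def
    by (metis compactin_euclidean_iff topspace_eq)
  then have "bounded (f ` carrier X)"
    by (rule compact_imp_bounded)
  then show ?thesis
    using that unfolding bounded_pos by blast
qed

text \<open>By the tube lemma: the set \<open>?W\<close> of pairs with a small difference is open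
  and contains the compact slice of all \<open>(x, \<one>)\<close>, hence a whole tube around
  it.\<close>

lemma cont_uniform:
  assumes "cont f" "e > 0"
  obtains U where "openin T U" "\<one> \<in> U"
    "\<And>x u. x \<in> carrier X \<Longrightarrow> u \<in> U \<Longrightarrow> norm (f (x \<otimes> u) - f x) < e"
proof -
  have "continuous_map (prod_topology T T) euclidean (\<lambda>p. f (fst p \<otimes> snd p) - f (fst p))"
  proof (intro continuous_map_diff)
    show "continuous_map (prod_topology T T) euclidean (\<lambda>p. f (fst p \<otimes> snd p))"
      using continuous_map_compose [OF cont_mult assms(1)] by (simp add: o_def case_prod_unfold)
    show "continuous_map (prod_topology T T) euclidean (\<lambda>p. f (fst p))"
      using continuous_map_compose [OF continuous_map_fst assms(1)] by (simp add: o_def)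
  qed
  from openin_continuous_map_preimage [OF this, of "ball 0 e"]
  have W: "openin (prod_topology T T)
      {p \<in> topspace (prod_topology T T). f (fst p \<otimes> snd p) - f (fst p) \<in> ball 0 e}"
    (is "openin _ ?W") by simp
  have "\<exists>U V. openin T U \<and> openin T V \<and> carrier X \<subseteq> U \<and> \<one> \<in> V \<and> U \<times> V \<subseteq> ?W"
  proof (rule tube_lemma_left [OF W])
    show "compactin T (carrier X)"
      using compact by (simp add: compact_space_def)
    show "carrier X \<times> {\<one>} \<subseteq> ?W" using assms by auto
  qed auto
  then obtain U V where UV: "openin T V" "carrier X \<subseteq> U" "\<one> \<in> V" "U \<times> V \<subseteq> ?W"
    by auto
  have "norm (f (x \<otimes> u) - f x) < e" if "x \<in> carrier X" "u \<in> V" for x u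
  proof -
    have "(x, u) \<in> ?W" using UV that by blast
    then show ?thesis by simp
  qed
  with UV show ?thesis using that by blast
qed

lemma openin_translate:
  assumes "openin T U" "a \<in> carrier X"
  shows "openin T {x \<in> carrier X. a \<otimes> x \<in> U}"
  using openin_continuous_map_preimage [OF continuous_map_mult2 [OF continuous_map_const_in [OF assms(2)]
     continuous_map_id [unfolded id_def]] assms(1)] by simp

lemma contI_uniform:
  assumes "\<And>e. e > 0 \<Longrightarrow> \<exists>U. openin T U \<and> \<one> \<in> U \<and> (\<forall>x\<in>carrier X. \<forall>u\<in>U. norm (f (x \<otimes> u) - f x) < e)"
  shows "cont f"
proof -
  have "\<exists>U. openin T U \<and> x \<in> U \<and> (\<forall>y\<in>U. f y \<in> ball (f x) e)" if "x \<in> carrier X" "e > 0" for x e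
  proof -
    obtain U where U: "openin T U" "\<one> \<in> U" "\<forall>x\<in>carrier X. \<forall>u\<in>U. norm (f (x \<otimes> u) - f x) < e"
      using assms \<open>e > 0\<close> by blast
    let ?V = "{y \<in> carrier X. inv x \<otimes> y \<in> U}"
    have "openin T ?V"
      using openin_translate [OF U(1), of "inv x"] that by simp
    moreover have "x \<in> ?V"
      using that U by simp
    moreover have "f y \<in> ball (f x) e" if "y \<in> ?V" for y
    proof -
      have "norm (f (x \<otimes> (inv x \<otimes> y)) - f x) < e"
        using U(3) \<open>x \<in> carrier X\<close> that by blast
      then show ?thesis
        using that \<open>x \<in> carrier X\<close> by (simp add: m_assoc [symmetric] dist_norm norm_minus_commute)
    qed
    ultimately show ?thesis by blast
  qed
  then show ?thesis
    using Met_TC.continuous_map_to_metric [of T f] by (simp add: Met_TC.mball_def ball_def)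
qed

lemma finite_translates_cover:
  assumes "openin T U" "\<one> \<in> U"
  obtains D where "finite D" "D \<subseteq> carrier X" "\<And>z. z \<in> carrier X \<Longrightarrow> \<exists>d\<in>D. inv d \<otimes> z \<in> U"
proof -
  let ?V = "\<lambda>d. {z \<in> carrier X. inv d \<otimes> z \<in> U}"
  have "\<And>d. d \<in> carrier X \<Longrightarrow> openin T (?V d)" "carrier X \<subseteq> \<Union> (?V ` carrier X)"
    using assms openin_translate by auto
  then obtain \<F> where \<F>: "finite \<F>" "\<F> \<subseteq> ?V ` carrier X" "carrier X \<subseteq> \<Union> \<F>"
    using compact unfolding compact_space_def compactin_def
    by (metis (no_types, lifting) imageE topspace_eq)
  obtain D where "D \<subseteq> carrier X" "finite D" "\<F> = ?V ` D"
    using finite_subset_image [OF \<F>(1,2)] by blast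
  with \<F> have "finite D" "D \<subseteq> carrier X" "carrier X \<subseteq> \<Union> (?V ` D)"
    by simp_all
  then show ?thesis
    by (intro that [of D]) auto
qed

text \<open>The translates of one continuous function form a totally bounded family, because
  finitely many translates of the neighbourhood from \<open>cont_uniform\<close> cover the group.
  Estimates over all translates are thereby reduced to finitely many.\<close>

lemma cont_net:
  assumes "cont f" "e > 0"
  obtains D where "finite D" "D \<subseteq> carrier X"
    "\<And>z. z \<in> carrier X \<Longrightarrow> \<exists>d\<in>D. \<forall>x\<in>carrier X. norm (f (x \<otimes> z) - f (x \<otimes> d)) < e"
proof -
  obtain U where U: "openin T U" "\<one> \<in> U"
    "\<And>x u. x \<in> carrier X \<Longrightarrow> u \<in> U \<Longrightarrow> norm (f (x \<otimes> u) - f x) < e"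
    using cont_uniform assms by metis
  obtain D where D: "finite D" "D \<subseteq> carrier X" "\<And>z. z \<in> carrier X \<Longrightarrow> \<exists>d\<in>D. inv d \<otimes> z \<in> U"
    using finite_translates_cover U by metis
  have "\<exists>d\<in>D. \<forall>x\<in>carrier X. norm (f (x \<otimes> z) - f (x \<otimes> d)) < e" if z: "z \<in> carrier X" for z
  proof -
    obtain d where d: "d \<in> D" "inv d \<otimes> z \<in> U" using D z by blast
    then have "norm (f (x \<otimes> d \<otimes> (inv d \<otimes> z)) - f (x \<otimes> d)) < e" if "x \<in> carrier X" for x
      using U(3) [of "x \<otimes> d"] D that by blast
    moreover have "x \<otimes> d \<otimes> (inv d \<otimes> z) = x \<otimes> z" if "x \<in> carrier X" for x
      using that z d D by (simp add: m_assoc subset_iff mult_inv_cancel)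
    ultimately have "\<forall>x\<in>carrier X. norm (f (x \<otimes> z) - f (x \<otimes> d)) < e"
      by simp
    then show ?thesis
      using d by blast
  qed
  then show ?thesis using that D by blast
qed

section \<open>Von Neumann's mean of a continuous function: uniqueness and existence\<close>

definition is_mean :: "('x \<Rightarrow> complex) \<Rightarrow> complex \<Rightarrow> bool" where
  "is_mean f c \<longleftrightarrow> (\<forall>e>0. \<exists>ts. ts \<noteq> [] \<and> set ts \<subseteq> carrier X \<and>
     (\<forall>x\<in>carrier X. norm (avg ts (\<lambda>t. f (x \<otimes> t)) - c) \<le> e))"

lemma is_meanE:
  assumes "is_mean f c" "e > 0"
  obtains ts where "ts \<noteq> []" "set ts \<subseteq> carrier X"
    "\<And>x. x \<in> carrier X \<Longrightarrow> norm (avg ts (\<lambda>t. f (x \<otimes> t)) - c) \<le> e"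
  using assms unfolding is_mean_def by metis

text \<open>Any two averages commute, which is why the value of the mean does not depend on the
  averages chosen to compute it.\<close>

lemma avg_means_close:
  assumes "ts \<noteq> []" "set ts \<subseteq> carrier X" "us \<noteq> []" "set us \<subseteq> carrier X"
    and "\<And>x. x \<in> carrier X \<Longrightarrow> norm (avg ts (\<lambda>t. f (x \<otimes> t)) - c) \<le> d"
    and "\<And>x. x \<in> carrier X \<Longrightarrow> norm (avg us (\<lambda>t. f (x \<otimes> t)) - c') \<le> e"
  shows "norm (c - c') \<le> d + e"
proof -
  let ?F = "avg ts (\<lambda>t. avg us (\<lambda>u. f (t \<otimes> u)))"
  have "norm (?F - c') \<le> e"
    by (rule norm_avg_minus_const_le) (use assms(1,2,4,6) in auto)
  moreover have "?F = avg us (\<lambda>u. avg ts (\<lambda>t. f (t \<otimes> u)))"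
    by (rule avg_swap)
  moreover have "\<dots> = avg us (\<lambda>u. avg ts (\<lambda>t. f (u \<otimes> t)))"
    using assms(2,4) by (intro avg_cong) (simp add: m_comm subset_iff)
  moreover have "norm (avg us (\<lambda>u. avg ts (\<lambda>t. f (u \<otimes> t))) - c) \<le> d"
    by (rule norm_avg_minus_const_le) (use assms(2,3,4,5) in auto)
  ultimately have "norm (?F - c') \<le> e" "norm (?F - c) \<le> d"
    by simp_all
  then show ?thesis
    using norm_triangle_ineq4 [of "?F - c'" "?F - c"] by simp
qed

lemma is_mean_unique:
  assumes "is_mean f c" "is_mean f c'"
  shows "c = c'"
proof (rule ccontr)
  assume "c \<noteq> c'"
  then have e: "norm (c - c') / 3 > 0" by simp
  obtain ts where ts: "ts \<noteq> []" "set ts \<subseteq> carrier X"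
      "\<And>x. x \<in> carrier X \<Longrightarrow> norm (avg ts (\<lambda>t. f (x \<otimes> t)) - c) \<le> norm (c - c') / 3"
    using is_meanE [OF assms(1) e] by metis
  obtain us where us: "us \<noteq> []" "set us \<subseteq> carrier X"
      "\<And>x. x \<in> carrier X \<Longrightarrow> norm (avg us (\<lambda>t. f (x \<otimes> t)) - c') \<le> norm (c - c') / 3"
    using is_meanE [OF assms(2) e] by metis
  have "norm (c - c') \<le> norm (c - c') / 3 + norm (c - c') / 3"
    using avg_means_close [OF ts(1,2) us(1,2) ts(3) us(3)] .
  then show False using e by simp
qed

text \<open>Translating by \<open>d\<close> shifts the powers of \<open>d\<close> by one, so the
  difference telescopes to two boundary terms, each at most \<open>B\<close> in norm.\<close>

lemma avg_power_translate:
  assumes "d \<in> carrier X" "x \<in> carrier X" "\<And>x. x \<in> carrier X \<Longrightarrow> norm (f x) \<le> B" "n > 0"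
  shows "norm (avg (map (\<lambda>j. d [^] (j::nat)) [0..<n]) (\<lambda>t. f (x \<otimes> d \<otimes> t))
    - avg (map (\<lambda>j. d [^] (j::nat)) [0..<n]) (\<lambda>t. f (x \<otimes> t))) \<le> 2 * B / n"
proof -
  have eq: "x \<otimes> d \<otimes> d [^] j = x \<otimes> d [^] (Suc j)" for j :: nat
    using assms(1,2) by (simp add: m_assoc m_comm [of d])
  have "avg (map (\<lambda>j. d [^] j) [0..<n]) (\<lambda>t. f (x \<otimes> d \<otimes> t))
    - avg (map (\<lambda>j. d [^] (j::nat)) [0..<n]) (\<lambda>t. f (x \<otimes> t))
    = ((\<Sum>j<n. f (x \<otimes> d [^] Suc j)) - (\<Sum>j<n. f (x \<otimes> d [^] j))) / n"
    unfolding avg_map eq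
    by (simp add: avg_def interv_sum_list_conv_sum_set_nat atLeast0LessThan diff_divide_distrib
         del: nat_pow_Suc)
  also have "(\<Sum>j<n. f (x \<otimes> d [^] Suc j)) - (\<Sum>j<n. f (x \<otimes> d [^] j)) = f (x \<otimes> d [^] n) - f (x \<otimes> d [^] (0::nat))"
    by (simp only: sum_subtractf [symmetric] sum_lessThan_telescope [where f="\<lambda>j. f (x \<otimes> d [^] j)"])
  also have "norm (\<dots> / n) \<le> 2 * B / n"
  proof -
    have "norm (f (x \<otimes> d [^] n) - f (x \<otimes> d [^] (0::nat))) \<le> B + B"
      using assms by (intro norm_triangle_le_diff add_mono) auto
    then show ?thesis
      using \<open>n > 0\<close> by (simp add: norm_divide field_simps)
  qed
  finally show ?thesis .
qed

text \<open>The elements of \<open>D\<close> are treated one at a time: the list found so far is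
  multiplied by a long list of powers of the new element, and the invariance already achieved
  survives because averages commute.\<close>

lemma almost_invariant_average:
  assumes "finite D" "D \<subseteq> carrier X" "\<And>x. x \<in> carrier X \<Longrightarrow> norm (f x) \<le> B" "e > 0"
  shows "\<exists>ts. ts \<noteq> [] \<and> set ts \<subseteq> carrier X \<and>
     (\<forall>d\<in>D. \<forall>x\<in>carrier X. norm (avg ts (\<lambda>t. f (x \<otimes> d \<otimes> t)) - avg ts (\<lambda>t. f (x \<otimes> t))) \<le> e)"
  using assms(1,2)
proof (induction rule: finite_induct)
  case empty
  show ?case by (intro exI [of _ "[\<one>]"]) auto
next
  case (insert a D)
  then obtain ts where ts: "ts \<noteq> []" "set ts \<subseteq> carrier X"
    "\<forall>d\<in>D. \<forall>x\<in>carrier X. norm (avg ts (\<lambda>t. f (x \<otimes> d \<otimes> t)) - avg ts (\<lambda>t. f (x \<otimes> t))) \<le> e"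
    by auto
  have a: "a \<in> carrier X" using insert by auto
  obtain n :: nat where n: "n > 0" "2 * B / n \<le> e"
  proof -
    obtain n :: nat where "n > 2 * B / e" using reals_Archimedean2 by blast
    then show ?thesis
      using \<open>e > 0\<close> by (intro that [of "Suc n"]) (simp_all add: field_simps)
  qed
  define ps where "ps = map (\<lambda>j. a [^] (j::nat)) [0..<n]"
  have ps: "ps \<noteq> []" "set ps \<subseteq> carrier X"
    using n a by (auto simp: ps_def)
  define us where "us = map (\<lambda>(t, u). t \<otimes> u) (List.product ts ps)"
  have us: "us \<noteq> []" "set us \<subseteq> carrier X"
    using ts ps by (auto simp: us_def) (use ps(1) ts(1) in \<open>metis length_0_conv length_product mult_is_0\<close>)?
  \<comment> \<open>The two orders of the iterated average serve the two cases below: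
    \<open>av\<close> has the powers of \<open>a\<close> innermost, \<open>av'\<close> the old list
    \<open>ts\<close>.\<close>
  have av: "avg us (\<lambda>t. f (x \<otimes> t)) = avg ts (\<lambda>t. avg ps (\<lambda>u. f (x \<otimes> t \<otimes> u)))" if "x \<in> carrier X" for x
    unfolding us_def avg_product
    using that ts ps by (intro avg_cong) (simp add: m_ac subset_iff)
  have av': "avg us (\<lambda>t. f (x \<otimes> t)) = avg ps (\<lambda>u. avg ts (\<lambda>t. f (x \<otimes> u \<otimes> t)))" if "x \<in> carrier X" for x
    unfolding av [OF that] avg_swap [of ts]
    using that ts ps by (intro avg_cong) (simp add: m_ac subset_iff)
  have "norm (avg us (\<lambda>t. f (x \<otimes> d \<otimes> t)) - avg us (\<lambda>t. f (x \<otimes> t))) \<le> e"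
    if x: "x \<in> carrier X" and d: "d \<in> insert a D" for x d
  proof (cases "d = a")
    case True
    have "norm (avg us (\<lambda>t. f (x \<otimes> a \<otimes> t)) - avg us (\<lambda>t. f (x \<otimes> t))) \<le> 2 * B / n"
      unfolding av [OF x] av [OF m_closed [OF x a]]
    proof (rule norm_avg_diff_le [OF _ ts(1)])
      fix t assume t: "t \<in> set ts"
      then have "x \<otimes> a \<otimes> t = x \<otimes> t \<otimes> a"
        using x a ts by (simp add: m_ac subset_iff)
      moreover have "norm (avg ps (\<lambda>u. f (x \<otimes> t \<otimes> a \<otimes> u)) - avg ps (\<lambda>u. f (x \<otimes> t \<otimes> u))) \<le> 2 * B / n"
        unfolding ps_def using x a t ts n by (intro avg_power_translate assms(3)) auto
      ultimately show "norm (avg ps (\<lambda>u. f (x \<otimes> a \<otimes> t \<otimes> u)) - avg ps (\<lambda>u. f (x \<otimes> t \<otimes> u))) \<le> 2 * B / n"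
        by simp
    qed
    with True n show ?thesis by simp
  next
    case False
    with d have d: "d \<in> D" by auto
    then have dX: "d \<in> carrier X" using insert by auto
    show ?thesis
      unfolding av' [OF x] av' [OF m_closed [OF x dX]]
    proof (rule norm_avg_diff_le [OF _ ps(1)])
      fix u assume u: "u \<in> set ps"
      then have "x \<otimes> d \<otimes> u = x \<otimes> u \<otimes> d" "x \<otimes> u \<in> carrier X"
        using x dX ps u by (simp_all add: m_ac subset_iff)
      then show "norm (avg ts (\<lambda>t. f (x \<otimes> d \<otimes> u \<otimes> t)) - avg ts (\<lambda>t. f (x \<otimes> u \<otimes> t))) \<le> e"
        using ts(3) d by simp
    qed
  qed
  with us show ?case by blast
qed

text \<open>Passing from \<open>y\<close> to \<open>x\<close> is a translation by
  \<open>inv y \<otimes> x\<close>. The net replaces it by one of finitely many \<open>d\<close>,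
  and under those the average is almost invariant.\<close>

lemma small_oscillation_average:
  assumes "cont f" "e > 0"
  obtains ts where "ts \<noteq> []" "set ts \<subseteq> carrier X"
    "\<And>x y. x \<in> carrier X \<Longrightarrow> y \<in> carrier X \<Longrightarrow> norm (avg ts (\<lambda>t. f (x \<otimes> t)) - avg ts (\<lambda>t. f (y \<otimes> t))) \<le> e"
proof -
  obtain D where D: "finite D" "D \<subseteq> carrier X"
    "\<And>z. z \<in> carrier X \<Longrightarrow> \<exists>d\<in>D. \<forall>x\<in>carrier X. norm (f (x \<otimes> z) - f (x \<otimes> d)) < e/2"
    using cont_net [OF assms(1), of "e/2"] assms(2) by auto
  obtain B where B: "B > 0" "\<And>x. x \<in> carrier X \<Longrightarrow> norm (f x) \<le> B"
    using cont_bounded [OF assms(1)] by metis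
  obtain ts where ts: "ts \<noteq> []" "set ts \<subseteq> carrier X"
     "\<forall>d\<in>D. \<forall>x\<in>carrier X. norm (avg ts (\<lambda>t. f (x \<otimes> d \<otimes> t)) - avg ts (\<lambda>t. f (x \<otimes> t))) \<le> e/2"
    using almost_invariant_average [of D f B "e/2"] D B assms(2) by auto
  have "norm (avg ts (\<lambda>t. f (x \<otimes> t)) - avg ts (\<lambda>t. f (y \<otimes> t))) \<le> e"
    if x: "x \<in> carrier X" and y: "y \<in> carrier X" for x y
  proof -
    obtain d where d: "d \<in> D" "\<forall>w\<in>carrier X. norm (f (w \<otimes> (inv y \<otimes> x)) - f (w \<otimes> d)) < e/2"
      using D(3) [of "inv y \<otimes> x"] x y by auto
    have dX: "d \<in> carrier X" using d D by auto
    have "norm (avg ts (\<lambda>t. f (x \<otimes> t)) - avg ts (\<lambda>t. f (y \<otimes> d \<otimes> t))) \<le> e/2"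
    proof (rule norm_avg_diff_le [OF _ ts(1)])
      fix t assume "t \<in> set ts"
      then have t: "t \<in> carrier X" using ts by auto
      have "y \<otimes> t \<otimes> (inv y \<otimes> x) = x \<otimes> t" "y \<otimes> t \<otimes> d = y \<otimes> d \<otimes> t"
        using x y t dX by (simp_all add: m_ac mult_inv_cancel)
      moreover have "norm (f (y \<otimes> t \<otimes> (inv y \<otimes> x)) - f (y \<otimes> t \<otimes> d)) < e/2"
        using d(2) y t by blast
      ultimately show "norm (f (x \<otimes> t) - f (y \<otimes> d \<otimes> t)) \<le> e/2"
        by simp
    qed
    moreover have "norm (avg ts (\<lambda>t. f (y \<otimes> d \<otimes> t)) - avg ts (\<lambda>t. f (y \<otimes> t))) \<le> e/2"
      using ts(3) d y by blast
    ultimately show ?thesis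
      using norm_diff_triangle_le [of _ _ "e/2" _ "e/2"] by fastforce
  qed
  then show ?thesis using that ts by blast
qed

text \<open>Averages of oscillation at most \<open>1 / Suc n\<close> are close to constants
  \<open>c n\<close>, and \<open>avg_means_close\<close> makes these constants a Cauchy
  sequence.\<close>

lemma is_mean_exists:
  assumes "cont f"
  shows "\<exists>c. is_mean f c"
proof -
  have "\<exists>ts c. ts \<noteq> [] \<and> set ts \<subseteq> carrier X \<and>
      (\<forall>x\<in>carrier X. norm (avg ts (\<lambda>t. f (x \<otimes> t)) - c) \<le> 1 / Suc n)" for n
  proof -
    obtain ts where "ts \<noteq> []" "set ts \<subseteq> carrier X"
    "\<And>x y. x \<in> carrier X \<Longrightarrow> y \<in> carrier X \<Longrightarrow> norm (avg ts (\<lambda>t. f (x \<otimes> t)) - avg ts (\<lambda>t. f (y \<otimes> t))) \<le> 1 / Suc n"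
      using small_oscillation_average [OF assms, of "1 / Suc n"]
      by (metis of_nat_0_less_iff zero_less_Suc zero_less_divide_1_iff)
    then show ?thesis
      using one_closed by blast
  qed
  then obtain ts c where ts: "\<And>n. ts n \<noteq> []" "\<And>n. set (ts n) \<subseteq> carrier X"
    "\<And>n x. x\<in>carrier X \<Longrightarrow> norm (avg (ts n) (\<lambda>t. f (x \<otimes> t)) - c n) \<le> 1 / Suc n"
    by metis
  have close: "norm (c m - c n) \<le> 1 / Suc m + 1 / Suc n" for m n
    using avg_means_close [OF ts(1,2) ts(1,2) ts(3) ts(3)] .
  have "Cauchy c"
  proof (rule CauchyI)
    fix e :: real assume "e > 0"
    then obtain N where N: "1 / Suc N < e/2"
      using nat_approx_posE half_gt_zero by metis
    have "norm (c m - c n) < e" if "m \<ge> N" "n \<ge> N" for m n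
    proof -
      have "1 / Suc m \<le> 1 / Suc N" "1 / Suc n \<le> 1 / Suc N"
        using that by (simp_all add: frac_le)
      then show ?thesis using close [of m n] N by linarith
    qed
    then show "\<exists>M. \<forall>m\<ge>M. \<forall>n\<ge>M. norm (c m - c n) < e" by blast
  qed
  then obtain l where l: "c \<longlonglongrightarrow> l"
    using Cauchy_convergent_iff convergent_def by blast
  have "is_mean f l"
    unfolding is_mean_def
  proof (intro allI impI)
    fix e :: real assume "e > 0"
    then obtain N where N: "1 / Suc N < e/2"
      using nat_approx_posE half_gt_zero by metis
    obtain N' where N': "\<forall>n\<ge>N'. norm (c n - l) < e/2"
      using l \<open>e > 0\<close> unfolding LIMSEQ_def dist_norm by (meson half_gt_zero)
    define n where "n = max N N'"
    have "1 / Suc n \<le> 1 / Suc N" by (simp add: frac_le n_def)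
    moreover have "norm (c n - l) < e/2" using N' n_def by simp
    ultimately have "norm (avg (ts n) (\<lambda>t. f (x \<otimes> t)) - l) \<le> e" if "x \<in> carrier X" for x
      using ts(3) [OF that, of n] N
      by (smt (verit) field_sum_of_halves norm_diff_triangle_le)
    with ts show "\<exists>ts. ts \<noteq> [] \<and> set ts \<subseteq> carrier X \<and> (\<forall>x\<in>carrier X. norm (avg ts (\<lambda>t. f (x \<otimes> t)) - l) \<le> e)"
      by blast
  qed
  then show ?thesis ..
qed

section \<open>Linearity, invariance and strict positivity of the mean\<close>

definition haar :: "('x \<Rightarrow> complex) \<Rightarrow> complex" where
  "haar f = (THE c. is_mean f c)"

lemma haar_eqI: "is_mean f c \<Longrightarrow> haar f = c"
  unfolding haar_def using is_mean_unique by blast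

lemma is_mean_haar: "cont f \<Longrightarrow> is_mean f (haar f)"
  using is_mean_exists haar_eqI by metis

lemma is_mean_cong:
  assumes "is_mean f c" "\<And>x. x \<in> carrier X \<Longrightarrow> f x = g x"
  shows "is_mean g c"
proof -
  have "avg ts (\<lambda>t. g (x \<otimes> t)) = avg ts (\<lambda>t. f (x \<otimes> t))" if "set ts \<subseteq> carrier X" "x \<in> carrier X" for ts x
    using that assms(2) by (intro avg_cong) (simp add: subset_iff)
  then show ?thesis
    using assms(1) unfolding is_mean_def by metis
qed

lemma haar_cong:
  assumes "\<And>x. x \<in> carrier X \<Longrightarrow> f x = g x"
  shows "haar f = haar g"
proof -
  have "is_mean f c = is_mean g c" for c
    using is_mean_cong [of f c g] is_mean_cong [of g c f] assms by auto
  then have "is_mean f = is_mean g" by auto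
  then show ?thesis by (simp add: haar_def)
qed

text \<open>One list has to serve both functions. The products of the two lists do: averaging an
  almost constant average once more keeps it almost constant, and the order of averaging can be
  chosen for each function separately.\<close>

lemma haar_add:
  assumes "cont f" "cont g"
  shows "haar (\<lambda>x. f x + g x) = haar f + haar g"
proof (rule haar_eqI, unfold is_mean_def, intro allI impI)
  fix e :: real assume "e > 0"
  then have e: "e/2 > 0" by simp
  obtain ts where ts: "ts \<noteq> []" "set ts \<subseteq> carrier X"
      "\<And>x. x \<in> carrier X \<Longrightarrow> norm (avg ts (\<lambda>t. f (x \<otimes> t)) - haar f) \<le> e/2"
    using is_meanE [OF is_mean_haar [OF assms(1)] e] by metis
  obtain us where us: "us \<noteq> []" "set us \<subseteq> carrier X"
      "\<And>x. x \<in> carrier X \<Longrightarrow> norm (avg us (\<lambda>t. g (x \<otimes> t)) - haar g) \<le> e/2"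
    using is_meanE [OF is_mean_haar [OF assms(2)] e] by metis
  define vs where "vs = map (\<lambda>(t, u). t \<otimes> u) (List.product ts us)"
  have vs: "vs \<noteq> []" "set vs \<subseteq> carrier X"
    using ts us by (auto simp: vs_def) (use ts(1) us(1) in \<open>metis length_0_conv length_product mult_is_0\<close>)?
  have av: "avg vs (\<lambda>t. h (x \<otimes> t)) = avg ts (\<lambda>t. avg us (\<lambda>u. h (x \<otimes> t \<otimes> u)))"
     "avg vs (\<lambda>t. h (x \<otimes> t)) = avg us (\<lambda>u. avg ts (\<lambda>t. h (x \<otimes> u \<otimes> t)))" if "x \<in> carrier X" for x h
  proof -
    show *: "avg vs (\<lambda>t. h (x \<otimes> t)) = avg ts (\<lambda>t. avg us (\<lambda>u. h (x \<otimes> t \<otimes> u)))"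
      unfolding vs_def avg_product
      using that ts us by (intro avg_cong) (simp add: m_ac subset_iff)
    show "avg vs (\<lambda>t. h (x \<otimes> t)) = avg us (\<lambda>u. avg ts (\<lambda>t. h (x \<otimes> u \<otimes> t)))"
      unfolding * avg_swap [of ts]
      using that ts us by (intro avg_cong) (simp add: m_ac subset_iff)
  qed
  have "norm (avg vs (\<lambda>t. f (x \<otimes> t) + g (x \<otimes> t)) - (haar f + haar g)) \<le> e" if x: "x \<in> carrier X" for x
  proof -
    have "norm (avg vs (\<lambda>t. f (x \<otimes> t)) - haar f) \<le> e/2"
      unfolding av(2) [OF x, of f]
      by (rule norm_avg_minus_const_le) (use us ts x in \<open>auto simp: subset_iff\<close>)
    moreover have "norm (avg vs (\<lambda>t. g (x \<otimes> t)) - haar g) \<le> e/2"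
      unfolding av(1) [OF x, of g]
      by (rule norm_avg_minus_const_le) (use us ts x in \<open>auto simp: subset_iff\<close>)
    ultimately have "norm ((avg vs (\<lambda>t. f (x \<otimes> t)) - haar f) + (avg vs (\<lambda>t. g (x \<otimes> t)) - haar g)) \<le> e/2 + e/2"
      by (intro norm_triangle_le add_mono)
    then show ?thesis
      by (simp add: avg_add algebra_simps)
  qed
  with vs show "\<exists>ts. ts \<noteq> [] \<and> set ts \<subseteq> carrier X \<and>
     (\<forall>x\<in>carrier X. norm (avg ts (\<lambda>t. f (x \<otimes> t) + g (x \<otimes> t)) - (haar f + haar g)) \<le> e)"
    by blast
qed

lemma haar_cmult:
  assumes "cont f"
  shows "haar (\<lambda>x. c * f x) = c * haar f"
proof (rule haar_eqI, unfold is_mean_def, intro allI impI)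
  fix e :: real assume "e > 0"
  then have e: "e / (norm c + 1) > 0" by (simp add: add_nonneg_pos)
  obtain ts where ts: "ts \<noteq> []" "set ts \<subseteq> carrier X"
      "\<And>x. x \<in> carrier X \<Longrightarrow> norm (avg ts (\<lambda>t. f (x \<otimes> t)) - haar f) \<le> e / (norm c + 1)"
    using is_meanE [OF is_mean_haar [OF assms(1)] e] by metis
  have "norm (avg ts (\<lambda>t. c * f (x \<otimes> t)) - c * haar f) \<le> e" if "x \<in> carrier X" for x
  proof -
    have "norm (avg ts (\<lambda>t. c * f (x \<otimes> t)) - c * haar f) = norm c * norm (avg ts (\<lambda>t. f (x \<otimes> t)) - haar f)"
      by (simp add: avg_cmult right_diff_distrib [symmetric] norm_mult)
    also have "\<dots> \<le> norm c * (e / (norm c + 1))"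
      using ts(3) [OF that] by (intro mult_left_mono) auto
    also have "\<dots> \<le> e"
      using \<open>e > 0\<close> by (simp add: pos_divide_le_eq add_nonneg_pos mult.commute)
    finally show ?thesis .
  qed
  with ts show "\<exists>ts. ts \<noteq> [] \<and> set ts \<subseteq> carrier X \<and>
     (\<forall>x\<in>carrier X. norm (avg ts (\<lambda>t. c * f (x \<otimes> t)) - c * haar f) \<le> e)"
    by blast
qed

lemma haar_diff:
  assumes "cont f" "cont g"
  shows "haar (\<lambda>x. f x - g x) = haar f - haar g"
  using haar_add [OF assms(1), of "\<lambda>x. (-1) * g x"] haar_cmult [OF assms(2), of "-1"] assms
  by (simp add: continuous_map_minus)

lemma haar_const [simp]: "haar (\<lambda>x. c) = c"
  by (rule haar_eqI) (auto simp: is_mean_def avg_const intro!: exI [of _ "[\<one>]"])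

lemma haar_cnj:
  assumes "cont f"
  shows "haar (\<lambda>x. cnj (f x)) = cnj (haar f)"
proof (rule haar_eqI, unfold is_mean_def, intro allI impI)
  fix e :: real assume e: "e > 0"
  obtain ts where ts: "ts \<noteq> []" "set ts \<subseteq> carrier X"
      "\<And>x. x \<in> carrier X \<Longrightarrow> norm (avg ts (\<lambda>t. f (x \<otimes> t)) - haar f) \<le> e"
    using is_meanE [OF is_mean_haar [OF assms(1)] e] by metis
  have "avg ts (\<lambda>t. cnj (f (x \<otimes> t))) = cnj (avg ts (\<lambda>t. f (x \<otimes> t)))" for x
  proof -
    have "(\<Sum>t\<leftarrow>us. cnj (f (x \<otimes> t))) = cnj (\<Sum>t\<leftarrow>us. f (x \<otimes> t))" for us
      by (induction us) auto
    then show ?thesis by (simp add: avg_def)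
  qed
  then have "norm (avg ts (\<lambda>t. cnj (f (x \<otimes> t))) - cnj (haar f)) \<le> e" if "x \<in> carrier X" for x
    using ts(3) [OF that] by (metis complex_cnj_diff complex_mod_cnj)
  with ts show "\<exists>ts. ts \<noteq> [] \<and> set ts \<subseteq> carrier X \<and>
     (\<forall>x\<in>carrier X. norm (avg ts (\<lambda>t. cnj (f (x \<otimes> t))) - cnj (haar f)) \<le> e)"
    by blast
qed

lemma haar_translate:
  assumes "cont f" "a \<in> carrier X"
  shows "haar (\<lambda>x. f (a \<otimes> x)) = haar f"
proof (rule haar_eqI, unfold is_mean_def, intro allI impI)
  fix e :: real assume e: "e > 0"
  obtain ts where ts: "ts \<noteq> []" "set ts \<subseteq> carrier X"
      "\<And>x. x \<in> carrier X \<Longrightarrow> norm (avg ts (\<lambda>t. f (x \<otimes> t)) - haar f) \<le> e"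
    using is_meanE [OF is_mean_haar [OF assms(1)] e] by metis
  have "avg ts (\<lambda>t. f (a \<otimes> (x \<otimes> t))) = avg ts (\<lambda>t. f (a \<otimes> x \<otimes> t))" if "x \<in> carrier X" for x
    using ts that assms(2) by (intro avg_cong) (simp add: m_assoc subset_iff)
  then have "norm (avg ts (\<lambda>t. f (a \<otimes> (x \<otimes> t))) - haar f) \<le> e" if "x \<in> carrier X" for x
    using ts(3) [of "a \<otimes> x"] assms that by simp
  with ts show "\<exists>ts. ts \<noteq> [] \<and> set ts \<subseteq> carrier X \<and>
     (\<forall>x\<in>carrier X. norm (avg ts (\<lambda>t. f (a \<otimes> (x \<otimes> t))) - haar f) \<le> e)"
    by blast
qed

lemma haar_translate':
  assumes "cont f" "a \<in> carrier X"
  shows "haar (\<lambda>x. f (x \<otimes> a)) = haar f"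
proof -
  have "haar (\<lambda>x. f (x \<otimes> a)) = haar (\<lambda>x. f (a \<otimes> x))"
    using assms(2) by (intro haar_cong) (simp add: m_comm)
  then show ?thesis using haar_translate [OF assms] by simp
qed

lemma haar_inverse:
  assumes "cont f"
  shows "haar (\<lambda>x. f (inv x)) = haar f"
proof (rule haar_eqI, unfold is_mean_def, intro allI impI)
  fix e :: real assume e: "e > 0"
  obtain ts where ts: "ts \<noteq> []" "set ts \<subseteq> carrier X"
      "\<And>x. x \<in> carrier X \<Longrightarrow> norm (avg ts (\<lambda>t. f (x \<otimes> t)) - haar f) \<le> e"
    using is_meanE [OF is_mean_haar [OF assms(1)] e] by metis
  have "avg (map (\<lambda>t. inv t) ts) (\<lambda>t. f (inv (x \<otimes> t))) = avg ts (\<lambda>t. f (inv x \<otimes> t))"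
    if "x \<in> carrier X" for x
    unfolding avg_map using ts that by (intro avg_cong) (auto simp: inv_mult subset_iff)
  then have "norm (avg (map (\<lambda>t. inv t) ts) (\<lambda>t. f (inv (x \<otimes> t))) - haar f) \<le> e" if "x \<in> carrier X" for x
    using ts(3) [of "inv x"] that by simp
  with ts show "\<exists>ts. ts \<noteq> [] \<and> set ts \<subseteq> carrier X \<and>
     (\<forall>x\<in>carrier X. norm (avg ts (\<lambda>t. f (inv (x \<otimes> t))) - haar f) \<le> e)"
    by (intro exI [of _ "map (\<lambda>t. inv t) ts"]) (auto simp: subset_iff)
qed

lemma norm_haar_le:
  assumes "cont f" "\<And>x. x \<in> carrier X \<Longrightarrow> norm (f x) \<le> B"
  shows "norm (haar f) \<le> B"
proof (rule field_le_epsilon)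
  fix e :: real assume e: "e > 0"
  obtain ts where ts: "ts \<noteq> []" "set ts \<subseteq> carrier X"
      "\<And>x. x \<in> carrier X \<Longrightarrow> norm (avg ts (\<lambda>t. f (x \<otimes> t)) - haar f) \<le> e"
    using is_meanE [OF is_mean_haar [OF assms(1)] e] by metis
  have "norm (avg ts (\<lambda>t. f (\<one> \<otimes> t))) \<le> B"
    using ts assms(2) by (intro norm_avg_le) auto
  then show "norm (haar f) \<le> B + e"
    using ts(3) [OF one_closed]
    by (smt (verit) norm_minus_commute norm_triangle_sub)
qed

lemma norm_haar_diff_le:
  assumes "cont f" "cont g" "\<And>x. x \<in> carrier X \<Longrightarrow> norm (f x - g x) \<le> B"
  shows "norm (haar f - haar g) \<le> B"
  using norm_haar_le [of "\<lambda>x. f x - g x" B] assms by (simp add: haar_diff continuous_map_diff)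

lemma haar_nonneg:
  assumes "cont f" "\<And>x. x \<in> carrier X \<Longrightarrow> 0 \<le> Re (f x)"
  shows "0 \<le> Re (haar f)"
proof (rule field_le_epsilon)
  fix e :: real assume e: "e > 0"
  obtain ts where ts: "ts \<noteq> []" "set ts \<subseteq> carrier X"
      "\<And>x. x \<in> carrier X \<Longrightarrow> norm (avg ts (\<lambda>t. f (x \<otimes> t)) - haar f) \<le> e"
    using is_meanE [OF is_mean_haar [OF assms(1)] e] by metis
  have "\<And>us. set us \<subseteq> carrier X \<Longrightarrow> 0 \<le> Re (\<Sum>t\<leftarrow>us. f (\<one> \<otimes> t))"
  proof -
    fix us show "set us \<subseteq> carrier X \<Longrightarrow> 0 \<le> Re (\<Sum>t\<leftarrow>us. f (\<one> \<otimes> t))"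
      using assms(2) by (induction us) auto
  qed
  then have "0 \<le> Re (avg ts (\<lambda>t. f (\<one> \<otimes> t)))"
    using ts by (simp add: avg_def)
  then show "0 \<le> Re (haar f) + e"
    using ts(3) [OF one_closed] abs_Re_le_cmod [of "avg ts (\<lambda>t. f (\<one> \<otimes> t)) - haar f"] by simp
qed

text \<open>Finitely many translates of the open set where \<open>f\<close> stays above half its
  value at \<open>a\<close> cover the group. The sum of the corresponding translates of
  \<open>f\<close> is bounded below by a positive constant, while its mean is a multiple of the mean
  of \<open>f\<close>.\<close>

lemma haar_pos:
  assumes "cont f" "\<And>x. x \<in> carrier X \<Longrightarrow> 0 \<le> Re (f x)" "a \<in> carrier X" "0 < Re (f a)"
  shows "0 < Re (haar f)"
proof -
  let ?g = "\<lambda>x. f (x \<otimes> a)"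
  have g: "cont ?g" using assms cont_translate' by blast
  let ?U = "{x \<in> carrier X. ?g x \<in> {z. Re (f a) / 2 < Re z}}"
  have U1: "openin T ?U"
    using openin_continuous_map_preimage [OF g, of "{z. Re (f a) / 2 < Re z}"]
      open_halfspace_Re_gt [of "Re (f a) / 2"] by (simp del: less_divide_eq_numeral1 divide_less_eq_numeral1)
  have U2: "\<one> \<in> ?U"
    using assms by simp
  define U where "U = ?U"
  obtain D where D: "finite D" "D \<subseteq> carrier X" "\<And>z. z \<in> carrier X \<Longrightarrow> \<exists>d\<in>D. inv d \<otimes> z \<in> U"
    using finite_translates_cover [of U] U1 U2 unfolding U_def [symmetric] by metis
  let ?h = "\<lambda>E x. \<Sum>d\<in>E. ?g (inv d \<otimes> x)"
  have h: "cont (?h E) \<and> haar (?h E) = of_nat (card E) * haar f" if "finite E" "E \<subseteq> carrier X" for E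
    using that
  proof (induction rule: finite_induct)
    case empty
    show ?case by simp
  next
    case (insert d E)
    have "cont (\<lambda>x. ?g (inv d \<otimes> x))" "haar (\<lambda>x. ?g (inv d \<otimes> x)) = haar f"
      using insert.prems cont_translate [OF g, of "inv d"] haar_translate [OF g, of "inv d"]
        haar_translate' [OF assms(1,3)] by auto
    then show ?case
      using insert haar_add [of "\<lambda>x. ?g (inv d \<otimes> x)" "?h E"]
      by (simp add: continuous_map_add algebra_simps)
  qed
  have "Re (f a) / 2 \<le> Re (?h D x)" if x: "x \<in> carrier X" for x
  proof -
    obtain d where d: "d \<in> D" "inv d \<otimes> x \<in> U" using D x by blast
    have "Re (f a) / 2 \<le> Re (?g (inv d \<otimes> x))" using d(2) by (simp add: U_def)
    also have "\<dots> \<le> (\<Sum>d\<in>D. Re (?g (inv d \<otimes> x)))"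
      using D d x assms by (intro member_le_sum) auto
    finally show ?thesis by simp
  qed
  then have "0 \<le> Re (haar (\<lambda>x. ?h D x - of_real (Re (f a) / 2)))"
    using h [OF D(1,2)] by (intro haar_nonneg continuous_map_diff) auto
  also have "\<dots> = real (card D) * Re (haar f) - Re (f a) / 2"
    using h [OF D(1,2)] by (simp add: haar_diff)
  finally have "0 < real (card D) * Re (haar f)"
    using assms(4) by simp
  then show ?thesis
    by (simp add: zero_less_mult_iff)
qed

end

section \<open>Characters as extreme points of cones of positive definite functions\<close>

text \<open>The phase that turns \<open>\<theta> * k\<close> into \<open>- norm k\<close> gives the
  bound. This is how two-point positivity of a function yields domination by its value at
  \<open>\<one>\<close>.\<close>

lemma norm_le_of_phases:
  fixes a k :: complex
  assumes "\<And>\<theta>. norm \<theta> = 1 \<Longrightarrow> 0 \<le> Re (2 * a + \<theta> * k + cnj (\<theta> * k))"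
  shows "norm k \<le> Re a"
proof (cases "k = 0")
  case True
  then show ?thesis using assms [of 1] by simp
next
  case False
  define \<theta> where "\<theta> = - cnj k / of_real (norm k)"
  have "norm \<theta> = 1" using False by (simp add: \<theta>_def norm_divide)
  moreover have "\<theta> * k = - of_real (norm k)"
  proof -
    have "cnj k * k = of_real ((norm k)\<^sup>2)"
      by (metis complex_norm_square mult.commute)
    then show ?thesis
      using False by (simp add: \<theta>_def power2_eq_square)
  qed
  ultimately show ?thesis using assms [of \<theta>] by simp
qed

context compact_abelian_group
begin

section \<open>Convolution and perturbation\<close>

definition conv :: "('x \<Rightarrow> complex) \<Rightarrow> ('x \<Rightarrow> complex) \<Rightarrow> 'x \<Rightarrow> complex" where
  "conv g h x = haar (\<lambda>y. g (x \<otimes> inv y) * h y)"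

text \<open>Translates combined with the weights of \<open>b * b\<^sup>*\<close>, where \<open>b\<close> is a point mass at
  \<open>\<one>\<close> plus \<open>\<theta>\<close> times a point mass at \<open>t\<close>.\<close>

definition perturb :: "complex \<Rightarrow> 'x \<Rightarrow> ('x \<Rightarrow> complex) \<Rightarrow> 'x \<Rightarrow> complex" where
  "perturb \<theta> t h x = of_real (1 + (norm \<theta>)\<^sup>2) * h x + \<theta> * h (x \<otimes> t) + cnj \<theta> * h (x \<otimes> inv t)"

lemma cont_conv_kernel: "cont g \<Longrightarrow> x \<in> carrier X \<Longrightarrow> cont (\<lambda>y. g (x \<otimes> inv y))"
  using cont_inverse [OF cont_translate [of g x]] by simp

lemma cont_conv_integrand:
  "cont g \<Longrightarrow> cont h \<Longrightarrow> x \<in> carrier X \<Longrightarrow> cont (\<lambda>y. g (x \<otimes> inv y) * h y)"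
  by (intro cont_complex_mult cont_conv_kernel)

lemma conv_cong: "(\<And>y. y \<in> carrier X \<Longrightarrow> h y = k y) \<Longrightarrow> conv g h x = conv g k x"
  unfolding conv_def by (rule haar_cong) simp

lemma conv_cmult: "cont g \<Longrightarrow> cont h \<Longrightarrow> x \<in> carrier X \<Longrightarrow> conv g (\<lambda>y. c * h y) x = c * conv g h x"
  using haar_cmult [OF cont_conv_integrand [of g h x], of c] by (simp add: conv_def mult.left_commute)

lemma conv_add:
  "cont g \<Longrightarrow> cont h \<Longrightarrow> cont k \<Longrightarrow> x \<in> carrier X \<Longrightarrow> conv g (\<lambda>y. h y + k y) x = conv g h x + conv g k x"
  using haar_add [OF cont_conv_integrand [of g h x] cont_conv_integrand [of g k x]]
  by (simp add: conv_def distrib_left)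

lemma conv_translate:
  assumes "cont g" "cont h" "x \<in> carrier X" "t \<in> carrier X"
  shows "conv g (\<lambda>y. h (y \<otimes> t)) x = conv g h (x \<otimes> t)"
proof -
  have "haar (\<lambda>y. g (x \<otimes> t \<otimes> inv (y \<otimes> t)) * h (y \<otimes> t)) = haar (\<lambda>y. g (x \<otimes> t \<otimes> inv y) * h y)"
    using assms by (intro haar_translate' [where f = "\<lambda>y. g (x \<otimes> t \<otimes> inv y) * h y"] cont_conv_integrand) auto
  moreover have "x \<otimes> t \<otimes> inv (y \<otimes> t) = x \<otimes> inv y" if "y \<in> carrier X" for y
    using assms that by (simp add: inv_mult m_assoc m_comm [of "inv y" "inv t"] mult_inv_cancel)
  ultimately show ?thesis
    using haar_cong [of "\<lambda>y. g (x \<otimes> inv y) * h (y \<otimes> t)" "\<lambda>y. g (x \<otimes> t \<otimes> inv (y \<otimes> t)) * h (y \<otimes> t)"]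
    by (simp add: conv_def)
qed

text \<open>Convolution with \<open>g\<close> commutes with translations, and so with the
  combination of translates in \<open>perturb\<close>. This lets the bound by \<open>top\<close> be
  applied to every perturbation in \<open>near_eigenfunction\<close>.\<close>

lemma conv_perturb:
  assumes "cont g" "cont h" "x \<in> carrier X" "t \<in> carrier X"
  shows "conv g (perturb \<theta> t h) x = perturb \<theta> t (conv g h) x"
proof -
  have "conv g (perturb \<theta> t h) x = conv g (\<lambda>y. of_real (1 + (norm \<theta>)\<^sup>2) * h y + \<theta> * h (y \<otimes> t)) x
      + conv g (\<lambda>y. cnj \<theta> * h (y \<otimes> inv t)) x"
    unfolding perturb_def using assms by (intro conv_add cont_intros) auto
  also have "conv g (\<lambda>y. of_real (1 + (norm \<theta>)\<^sup>2) * h y + \<theta> * h (y \<otimes> t)) x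
      = conv g (\<lambda>y. of_real (1 + (norm \<theta>)\<^sup>2) * h y) x + conv g (\<lambda>y. \<theta> * h (y \<otimes> t)) x"
    using assms by (intro conv_add cont_intros) auto
  finally show ?thesis
    using assms by (simp add: conv_cmult conv_translate cont_translate' perturb_def [abs_def])
qed

lemma conv_hermitian:
  assumes "cont g" "cont h" "x \<in> carrier X"
    and "\<And>y. y \<in> carrier X \<Longrightarrow> g (inv y) = cnj (g y)" "\<And>y. y \<in> carrier X \<Longrightarrow> h (inv y) = cnj (h y)"
  shows "conv g h (inv x) = cnj (conv g h x)"
proof -
  have "haar (\<lambda>y. g (inv x \<otimes> inv (inv y)) * h (inv y)) = haar (\<lambda>y. g (inv x \<otimes> inv y) * h y)"
    using assms by (intro haar_inverse [where f = "\<lambda>y. g (inv x \<otimes> inv y) * h y"] cont_conv_integrand) auto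
  moreover have "g (inv x \<otimes> inv (inv y)) * h (inv y) = cnj (g (x \<otimes> inv y) * h y)" if "y \<in> carrier X" for y
    using assms(3) that assms(4) [of "x \<otimes> inv y"] assms(5) [of y] by (simp add: inv_mult)
  ultimately have "conv g h (inv x) = haar (\<lambda>y. cnj (g (x \<otimes> inv y) * h y))"
    unfolding conv_def by (metis (no_types, lifting) haar_cong)
  also have "\<dots> = cnj (conv g h x)"
    unfolding conv_def using assms by (intro haar_cnj cont_conv_integrand)
  finally show ?thesis .
qed

lemma norm_conv_le:
  assumes "cont g" "cont h" "x \<in> carrier X" "\<And>y. y \<in> carrier X \<Longrightarrow> norm (g y) \<le> B"
    "\<And>y. y \<in> carrier X \<Longrightarrow> norm (h y) \<le> C" "0 \<le> B"
  shows "norm (conv g h x) \<le> B * C"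
  unfolding conv_def using assms
  by (intro norm_haar_le cont_conv_integrand) (auto simp: norm_mult intro!: mult_mono)

section \<open>Uniform limits, compactness of sequences, and the energy\<close>

lemma haar_uniform_limit:
  assumes "uniform_limit (carrier X) f l sequentially" "\<And>n. cont (f n)" "cont l"
  shows "(\<lambda>n. haar (f n)) \<longlonglongrightarrow> haar l"
proof (rule LIMSEQ_I)
  fix e :: real assume "e > 0"
  then have "e/2 > 0" by simp
  then obtain N where N: "\<forall>n\<ge>N. \<forall>x\<in>carrier X. dist (f n x) (l x) < e/2"
    using assms(1) unfolding uniform_limit_sequentially_iff by blast
  have "norm (haar (f n) - haar l) \<le> e/2" if "n \<ge> N" for n
    using N that by (intro norm_haar_diff_le assms) (auto simp: dist_norm intro: less_imp_le)
  then show "\<exists>no. \<forall>n\<ge>no. norm (haar (f n) - haar l) < e"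
    using \<open>e > 0\<close> by (intro exI [of _ N]) force
qed

lemma cont_uniform_limit:
  assumes "uniform_limit (carrier X) f l sequentially" "\<And>n. cont (f n)"
  shows "cont l"
proof -
  have "continuous_map T Met_TC.mtopology l"
    using assms
    by (intro Met_TC.continuous_map_uniform_limit [where F = sequentially and f = f])
       (auto simp: uniform_limit_iff)
  then show ?thesis by simp
qed

lemma bounded_cont_image: "cont f \<Longrightarrow> bounded (f ` carrier X)"
  using cont_bounded unfolding bounded_iff by (metis imageE)

text \<open>An Arzela-Ascoli argument with a diagonal subsequence on the countable union of the
  nets. Equicontinuity is asked only from an index \<open>N\<close> on, and only relative to a
  finite net, which is what maximising sequences provide.\<close>

lemma convergent_subsequence:
  fixes h :: "nat \<Rightarrow> 'x \<Rightarrow> complex"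
  assumes bound: "\<And>n x. x \<in> carrier X \<Longrightarrow> norm (h n x) \<le> B"
    and equi: "\<And>e. e > 0 \<Longrightarrow> \<exists>D N. finite D \<and> D \<subseteq> carrier X \<and>
      (\<forall>z\<in>carrier X. \<exists>d\<in>D. \<forall>n\<ge>N. norm (h n z - h n d) < e)"
  obtains r l where "strict_mono (r :: nat \<Rightarrow> nat)" "uniform_limit (carrier X) (\<lambda>n. h (r n)) l sequentially"
proof -
  obtain D N where DN: "\<And>k::nat. finite (D k) \<and> D k \<subseteq> carrier X \<and>
      (\<forall>z\<in>carrier X. \<exists>d\<in>D k. \<forall>n\<ge>N k. norm (h n z - h n d) < 1 / Suc k)"
    using equi [of "1 / Suc k" for k] by (metis of_nat_0_less_iff zero_less_Suc zero_less_divide_1_iff)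
  have "countable (\<Union>k. D k)"
    using DN by (auto intro: countable_finite)
  moreover have "\<And>n x. x \<in> (\<Union>k. D k) \<Longrightarrow> norm (h n x) \<le> B"
    using DN bound by blast
  ultimately obtain r where r: "strict_mono (r :: nat \<Rightarrow> nat)"
    "\<And>x. x \<in> (\<Union>k. D k) \<Longrightarrow> \<exists>l. (\<lambda>n. h (r n) x) \<longlonglongrightarrow> l"
    using function_convergent_subsequence by metis
  have "uniformly_Cauchy_on (carrier X) (\<lambda>n. h (r n))"
  proof (rule uniformly_Cauchy_onI)
    fix e :: real assume "e > 0"
    then obtain k where k: "1 / Suc k < e/3"
      using nat_approx_posE [of "e/3"] by auto
    have "\<exists>M. \<forall>m\<ge>M. \<forall>n\<ge>M. dist (h (r m) d) (h (r n) d) < e/3" if "d \<in> D k" for d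
    proof -
      have "Cauchy (\<lambda>n. h (r n) d)"
        using r(2) [of d] that LIMSEQ_imp_Cauchy by blast
      then show ?thesis
        using \<open>e > 0\<close> unfolding Cauchy_def by (meson divide_pos_pos zero_less_numeral)
    qed
    then obtain M where M: "\<And>d m n. d \<in> D k \<Longrightarrow> m \<ge> M d \<Longrightarrow> n \<ge> M d \<Longrightarrow> dist (h (r m) d) (h (r n) d) < e/3"
      by metis
    define K where "K = Max (insert (N k) (M ` D k))"
    have K: "K \<ge> N k" "\<And>d. d \<in> D k \<Longrightarrow> K \<ge> M d"
      using DN by (auto simp: K_def)
    have "dist (h (r m) x) (h (r n) x) < e" if "x \<in> carrier X" "m \<ge> K" "n \<ge> K" for x m n
    proof -
      have "\<exists>d\<in>D k. \<forall>n\<ge>N k. norm (h n x - h n d) < 1 / Suc k"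
        using DN [of k, THEN conjunct2, THEN conjunct2] that(1) by (rule bspec)
      then obtain d where d: "d \<in> D k" "\<forall>n\<ge>N k. norm (h n x - h n d) < 1 / Suc k"
        by (rule bexE)
      have "r m \<ge> N k" "r n \<ge> N k"
        using K(1) that seq_suble [OF r(1), of m] seq_suble [OF r(1), of n] by linarith+
      then have "dist (h (r m) x) (h (r m) d) < 1 / Suc k" "dist (h (r n) d) (h (r n) x) < 1 / Suc k"
        using d(2) by (simp_all add: dist_norm norm_minus_commute)
      then have "dist (h (r m) x) (h (r m) d) < e/3" "dist (h (r n) d) (h (r n) x) < e/3"
        using k by linarith+
      moreover have "dist (h (r m) d) (h (r n) d) < e/3"
        using M [OF d(1), of m n] K(2) [OF d(1)] that by simp
      ultimately show ?thesis
        using dist_triangle_third by blast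
    qed
    then show "\<exists>M. \<forall>x\<in>carrier X. \<forall>m\<ge>M. \<forall>n\<ge>M. dist (h (r m) x) (h (r n) x) < e"
      by blast
  qed
  then have "uniformly_convergent_on (carrier X) (\<lambda>n. h (r n))"
    by (rule Cauchy_uniformly_convergent)
  then show ?thesis
    using that r(1) unfolding uniformly_convergent_on_def by blast
qed

definition energy :: "('x \<Rightarrow> complex) \<Rightarrow> real" where
  "energy h = Re (haar (\<lambda>x. h x * cnj (h x)))"

lemma energy_nonneg: "cont h \<Longrightarrow> 0 \<le> energy h"
  unfolding energy_def by (intro haar_nonneg cont_intros) auto

lemma energy_eq_0:
  assumes "cont h" "energy h \<le> 0" "x \<in> carrier X"
  shows "h x = 0"
proof (rule ccontr)
  assume "h x \<noteq> 0"
  then have "0 < Re (h x * cnj (h x))"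
    by (simp add: complex_neq_0 power2_eq_square)
  then have "0 < energy h"
    unfolding energy_def using assms(1,3) by (intro haar_pos [of _ x] cont_intros) auto
  with assms show False by simp
qed

lemma energy_combination:
  assumes "cont u" "cont v"
  shows "energy (\<lambda>x. of_real a * u x + of_real b * v x)
    = a\<^sup>2 * energy u + 2 * a * b * Re (haar (\<lambda>x. u x * cnj (v x))) + b\<^sup>2 * energy v"
proof -
  have c: "cont (\<lambda>x. u x * cnj (u x))" "cont (\<lambda>x. u x * cnj (v x))" "cont (\<lambda>x. cnj (u x * cnj (v x)))"
    "cont (\<lambda>x. v x * cnj (v x))"
    using assms by (intro cont_intros; simp)+
  have "haar (\<lambda>x. (of_real a * u x + of_real b * v x) * cnj (of_real a * u x + of_real b * v x))
    = haar (\<lambda>x. (of_real (a\<^sup>2) * (u x * cnj (u x)) + of_real (a * b) * (u x * cnj (v x)))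
       + (of_real (a * b) * (cnj (u x * cnj (v x))) + of_real (b\<^sup>2) * (v x * cnj (v x))))"
    by (rule haar_cong) (simp add: algebra_simps power2_eq_square)
  also have "\<dots> = (of_real (a\<^sup>2) * haar (\<lambda>x. u x * cnj (u x)) + of_real (a * b) * haar (\<lambda>x. u x * cnj (v x)))
       + (of_real (a * b) * cnj (haar (\<lambda>x. u x * cnj (v x))) + of_real (b\<^sup>2) * haar (\<lambda>x. v x * cnj (v x)))"
  proof -
    have "cont (\<lambda>x. c * f x)" if "cont f" for c f
      using that by (intro cont_intros)
    note c' = this [OF c(1)] this [OF c(2)] this [OF c(3)] this [OF c(4)]
    show ?thesis
      unfolding haar_add [OF continuous_map_add [OF c'(1) c'(2)] continuous_map_add [OF c'(3) c'(4)]]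
        haar_add [OF c'(1) c'(2)] haar_add [OF c'(3) c'(4)] haar_cmult [OF c(1)] haar_cmult [OF c(2)]
        haar_cmult [OF c(3)] haar_cmult [OF c(4)] haar_cnj [OF c(2)] ..
  qed
  finally show ?thesis
    unfolding energy_def by (simp add: algebra_simps)
qed

end

section \<open>Abstract cones, maximisers, and the character among them\<close>

lemma Sup_approximating_sequence:
  fixes F :: "'b \<Rightarrow> real"
  assumes "bdd_above (F ` S)" "S \<noteq> {}"
  obtains f where "\<And>n::nat. f n \<in> S" "(\<lambda>n. F (f n)) \<longlonglongrightarrow> Sup (F ` S)"
proof -
  have "\<exists>s\<in>S. Sup (F ` S) - 1 / Suc n < F s" for n
    using less_cSup_iff [of "F ` S" "Sup (F ` S) - 1 / Suc n"] assms by simp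
  then obtain f where f: "\<And>n. f n \<in> S" "\<And>n. Sup (F ` S) - 1 / Suc n < F (f n)"
    by metis
  have "(\<lambda>n. F (f n)) \<longlonglongrightarrow> Sup (F ` S)"
  proof (rule tendsto_sandwich)
    show "\<forall>\<^sub>F n in sequentially. Sup (F ` S) - 1 / Suc n \<le> F (f n)"
      using f(2) by (auto intro!: always_eventually less_imp_le)
    show "\<forall>\<^sub>F n in sequentially. F (f n) \<le> Sup (F ` S)"
      using f(1) assms by (auto intro!: always_eventually cSup_upper)
    show "(\<lambda>n. Sup (F ` S) - 1 / Suc n) \<longlonglongrightarrow> Sup (F ` S)"
      using tendsto_diff [OF tendsto_const LIMSEQ_inverse_real_of_nat, of "Sup (F ` S)"]
      by (simp add: inverse_eq_divide)
  qed auto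
  then show ?thesis using that f(1) by blast
qed

text \<open>Positive definiteness is encoded by \<open>K_perturb\<close> and \<open>K_one\<close>
  together: a perturbation evaluated at \<open>\<one>\<close> is the quadratic form of
  \<open>h\<close> on the two points \<open>\<one>\<close> and \<open>t\<close>.\<close>

locale positive_cone = compact_abelian_group +
  fixes K :: "('a \<Rightarrow> complex) set"
  assumes K_cont: "h \<in> K \<Longrightarrow> cont h"
    and K_perturb: "h \<in> K \<Longrightarrow> t \<in> carrier X \<Longrightarrow> perturb \<theta> t h \<in> K"
    and K_one: "h \<in> K \<Longrightarrow> 0 \<le> Re (h \<one>) \<and> Im (h \<one>) = 0"
    and K_scale: "h \<in> K \<Longrightarrow> 0 \<le> c \<Longrightarrow> (\<lambda>x. of_real c * h x) \<in> K"
    and K_closed: "(\<And>e. 0 < e \<Longrightarrow> \<exists>k\<in>K. \<forall>x\<in>carrier X. norm (h x - k x) \<le> e) \<Longrightarrow> h \<in> K"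
begin

lemma K_one_eq: "h \<in> K \<Longrightarrow> h \<one> = of_real (Re (h \<one>))"
  using K_one by (simp add: complex_eq_iff)

lemma K_hermitian:
  assumes "h \<in> K" "t \<in> carrier X"
  shows "h (inv t) = cnj (h t)"
proof -
  \<comment> \<open>Reality for \<open>\<theta> = 1\<close> makes the imaginary parts at
    \<open>t\<close> and \<open>inv t\<close> opposite; reality for \<open>\<theta> = \<i>\<close>
    makes the real parts equal.\<close>
  have "Im (perturb 1 t h \<one>) = 0" "Im (perturb \<i> t h \<one>) = 0"
    using K_one [OF K_perturb [OF assms]] by auto
  then show ?thesis
    using assms K_one [OF assms(1)] by (simp add: perturb_def complex_eq_iff)
qed

lemma K_bound:
  assumes "h \<in> K" "t \<in> carrier X"
  shows "norm (h t) \<le> Re (h \<one>)"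
proof (rule norm_le_of_phases)
  fix \<theta> :: complex assume "norm \<theta> = 1"
  then have "2 * h \<one> + \<theta> * h t + cnj (\<theta> * h t) = perturb \<theta> t h \<one>"
    using assms by (simp add: perturb_def K_hermitian)
  then show "0 \<le> Re (2 * h \<one> + \<theta> * h t + cnj (\<theta> * h t))"
    using K_one [OF K_perturb [OF assms]] by simp
qed

lemma K_zero: "h \<in> K \<Longrightarrow> Re (h \<one>) = 0 \<Longrightarrow> t \<in> carrier X \<Longrightarrow> h t = 0"
  using K_bound [of h t] by simp

lemma K_normalise:
  assumes "h \<in> K" "Re (h \<one>) \<noteq> 0"
  shows "(\<lambda>x. of_real (1 / Re (h \<one>)) * h x) \<in> K" "of_real (1 / Re (h \<one>)) * h \<one> = 1"
proof -
  show "(\<lambda>x. of_real (1 / Re (h \<one>)) * h x) \<in> K"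
    using K_one [OF assms(1)] by (intro K_scale assms) auto
  show "of_real (1 / Re (h \<one>)) * h \<one> = 1"
    by (subst (2) K_one_eq [OF assms(1)]) (use assms in simp)
qed

end

text \<open>The functional to be maximised is the real part of \<open>conv g h \<one>\<close>. The
  element \<open>h0\<close> makes its supremum positive, so that estimates can be divided by
  \<open>top\<close>.\<close>

locale cone_functional = positive_cone +
  fixes g :: "'a \<Rightarrow> complex" and h0 :: "'a \<Rightarrow> complex"
  assumes g_cont: "cont g" and g_hermitian: "x \<in> carrier X \<Longrightarrow> g (inv x) = cnj (g x)"
    and h0: "h0 \<in> K" "0 < Re (conv g h0 \<one>)"
begin

definition top :: real where
  "top = Sup {Re (conv g h \<one>) | h. h \<in> K \<and> h \<one> = 1}"

lemma bdd_top: "bdd_above {Re (conv g h \<one>) | h. h \<in> K \<and> h \<one> = 1}"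
proof -
  obtain B where B: "B > 0" "\<And>x. x \<in> carrier X \<Longrightarrow> norm (g x) \<le> B"
    using cont_bounded [OF g_cont] by metis
  have "Re (conv g h \<one>) \<le> B" if "h \<in> K" "h \<one> = 1" for h
  proof -
    have "norm (conv g h \<one>) \<le> B * 1"
      using that B K_bound [OF that(1)] by (intro norm_conv_le g_cont K_cont) auto
    then show ?thesis using complex_Re_le_cmod [of "conv g h \<one>"] by simp
  qed
  then show ?thesis by (auto simp: bdd_above_def)
qed

lemma top_upper1: "h \<in> K \<Longrightarrow> h \<one> = 1 \<Longrightarrow> Re (conv g h \<one>) \<le> top"
  unfolding top_def using bdd_top by (intro cSup_upper) auto

lemma conv_zero: "h \<in> K \<Longrightarrow> Re (h \<one>) = 0 \<Longrightarrow> conv g h x = 0"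
  using conv_cong [of h "\<lambda>_. 0" g x] K_zero by (simp add: conv_def)

lemma top_upper:
  assumes "h \<in> K"
  shows "Re (conv g h \<one>) \<le> top * Re (h \<one>)"
proof (cases "Re (h \<one>) = 0")
  case True
  then show ?thesis using conv_zero [OF assms] by simp
next
  case False
  then have "Re (conv g (\<lambda>x. of_real (1 / Re (h \<one>)) * h x) \<one>) \<le> top"
    using K_normalise [OF assms] by (intro top_upper1) auto
  then have "Re (conv g h \<one>) / Re (h \<one>) \<le> top"
    by (subst (asm) conv_cmult) (use g_cont assms K_cont in auto)
  then show ?thesis
    using False K_one [OF assms] by (simp add: field_simps)
qed

lemma normalised_h0:
  obtains h where "h \<in> K" "h \<one> = 1" "0 < Re (conv g h \<one>)"
proof -
  have "Re (h0 \<one>) \<noteq> 0" using conv_zero h0 by force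
  moreover have "0 \<le> Re (h0 \<one>)" using K_one h0 by blast
  moreover have "conv g (\<lambda>x. of_real (1 / Re (h0 \<one>)) * h0 x) \<one> = of_real (1 / Re (h0 \<one>)) * conv g h0 \<one>"
    by (intro conv_cmult g_cont K_cont h0 one_closed)
  ultimately show ?thesis
    using that [OF K_normalise [OF h0(1)]] h0(2) by (simp del: of_real_divide)
qed

lemma top_pos: "0 < top"
  using normalised_h0 top_upper1 by (metis less_le_trans)

text \<open>The function \<open>top * h - conv g h\<close> is hermitian, and its perturbations are
  nonnegative at \<open>\<one>\<close>: convolution commutes with \<open>perturb\<close>, and
  \<open>top_upper\<close> applies to the perturbed \<open>h\<close>. So it is dominated by its
  value at \<open>\<one>\<close>.\<close>

lemma near_eigenfunction:
  assumes "h \<in> K" "t \<in> carrier X"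
  shows "norm (of_real top * h t - conv g h t) \<le> top * Re (h \<one>) - Re (conv g h \<one>)"
proof -
  define k where "k x = of_real top * h x - conv g h x" for x
  have hc: "cont h" using assms K_cont by blast
  have "norm (k t) \<le> Re (k \<one>)"
  proof (rule norm_le_of_phases)
    fix \<theta> :: complex assume n: "norm \<theta> = 1"
    have herm: "k (inv t) = cnj (k t)"
      using assms hc K_hermitian [OF assms(1)] g_cont g_hermitian by (simp add: k_def conv_hermitian)
    have "2 * k \<one> + \<theta> * k t + cnj (\<theta> * k t) = perturb \<theta> t k \<one>"
      using assms n by (simp add: perturb_def herm)
    also have "\<dots> = of_real top * perturb \<theta> t h \<one> - perturb \<theta> t (conv g h) \<one>"
      by (simp add: perturb_def k_def algebra_simps)
    also have "perturb \<theta> t (conv g h) \<one> = conv g (perturb \<theta> t h) \<one>"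
      using assms g_cont hc by (simp add: conv_perturb)
    finally show "0 \<le> Re (2 * k \<one> + \<theta> * k t + cnj (\<theta> * k t))"
      using top_upper [OF K_perturb [OF assms, of \<theta>]] by simp
  qed
  then show ?thesis by (simp add: k_def)
qed

lemma conv_uniform_limit:
  assumes "uniform_limit (carrier X) f l sequentially" "\<And>n. cont (f n)"
  shows "(\<lambda>n. conv g (f n) \<one>) \<longlonglongrightarrow> conv g l \<one>"
  unfolding conv_def
proof (intro haar_uniform_limit cont_conv_integrand g_cont assms(2) one_closed)
  show l: "cont l" using cont_uniform_limit assms by blast
  show "uniform_limit (carrier X) (\<lambda>n y. g (\<one> \<otimes> inv y) * f n y) (\<lambda>y. g (\<one> \<otimes> inv y) * l y) sequentially"
    by (intro uniform_lim_mult uniform_limit_const assms bounded_cont_image cont_conv_kernel g_cont l one_closed)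
qed

lemma energy_uniform_limit:
  assumes "uniform_limit (carrier X) f l sequentially" "\<And>n. cont (f n)"
  shows "(\<lambda>n. energy (f n)) \<longlonglongrightarrow> energy l"
proof -
  have l: "cont l" using cont_uniform_limit assms by blast
  have "uniform_limit (carrier X) (\<lambda>n y. cnj (f n y)) (\<lambda>y. cnj (l y)) sequentially"
    by (rule bounded_linear.uniform_limit [OF bounded_linear_cnj assms(1)])
  then have "uniform_limit (carrier X) (\<lambda>n y. f n y * cnj (f n y)) (\<lambda>y. l y * cnj (l y)) sequentially"
    by (intro uniform_lim_mult assms bounded_cont_image cont_cnj l)
  then show ?thesis
    unfolding energy_def
    by (intro tendsto_Re haar_uniform_limit cont_intros assms(2) l)
qed

lemma K_uniform_limit:
  assumes "uniform_limit (carrier X) f l sequentially" "\<And>n. f n \<in> K"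
  shows "l \<in> K"
proof (rule K_closed)
  fix e :: real assume "e > 0"
  then obtain N where "\<forall>n\<ge>N. \<forall>x\<in>carrier X. dist (f n x) (l x) < e"
    using assms(1) unfolding uniform_limit_sequentially_iff by blast
  then have "\<forall>x\<in>carrier X. norm (l x - f N x) \<le> e"
    by (auto simp: dist_norm norm_minus_commute intro: less_imp_le)
  then show "\<exists>k\<in>K. \<forall>x\<in>carrier X. norm (l x - k x) \<le> e"
    using assms(2) by blast
qed

text \<open>Maximising sequences are equicontinuous in the limit, since they are almost fixed by
  convolution with a multiple of the single function \<open>g\<close>.\<close>

lemma maximising_sequence:
  assumes f: "\<And>n. f n \<in> K" "\<And>n. f n \<one> = 1" and lim: "(\<lambda>n. Re (conv g (f n) \<one>)) \<longlonglongrightarrow> top"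
  obtains r l where "strict_mono (r :: nat \<Rightarrow> nat)" "uniform_limit (carrier X) (\<lambda>n. f (r n)) l sequentially"
    "l \<in> K" "l \<one> = 1" "Re (conv g l \<one>) = top"
proof -
  have fc: "cont (f n)" for n using f K_cont by blast
  have bound: "norm (f n x) \<le> 1" if "x \<in> carrier X" for n x
    using K_bound [OF f(1) that, of n] f(2) by simp
  have equi: "\<exists>D N. finite D \<and> D \<subseteq> carrier X \<and> (\<forall>z\<in>carrier X. \<exists>d\<in>D. \<forall>n\<ge>N. norm (f n z - f n d) < e)"
    if e: "e > 0" for e
  proof -
    \<comment> \<open>Three errors of this size will add up: the distance of \<open>f n\<close> from
      its convolution at \<open>z\<close> and at \<open>d\<close>, and the distance between the two
      convolutions. Division by \<open>top\<close> leaves less than \<open>e\<close>.\<close>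
    have e': "top * e / 4 > 0" using top_pos e by simp
    obtain D where D: "finite D" "D \<subseteq> carrier X"
      "\<And>z. z \<in> carrier X \<Longrightarrow> \<exists>d\<in>D. \<forall>x\<in>carrier X. norm (g (x \<otimes> z) - g (x \<otimes> d)) < top * e / 4"
      using cont_net [OF g_cont e'] by metis
    obtain N where N: "\<forall>n\<ge>N. norm (Re (conv g (f n) \<one>) - top) < top * e / 4"
      using LIMSEQ_D [OF lim e'] by blast
    have "norm (f n z - f n d) < e"
      if n: "n \<ge> N" and z: "z \<in> carrier X" and d: "d \<in> D"
        and zd: "\<forall>x\<in>carrier X. norm (g (x \<otimes> z) - g (x \<otimes> d)) < top * e / 4" for n z d
    proof -
      have dX: "d \<in> carrier X" using d D by auto
      have small: "norm (of_real top * f n x - conv g (f n) x) < top * e / 4" if "x \<in> carrier X" for x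
      proof -
        have "\<bar>Re (conv g (f n) \<one>) - top\<bar> < top * e / 4" using N n by simp
        moreover have "norm (of_real top * f n x - conv g (f n) x) \<le> top - Re (conv g (f n) \<one>)"
          using near_eigenfunction [OF f(1) that, of n] f(2) [of n] by simp
        ultimately show ?thesis by linarith
      qed
      have "norm (conv g (f n) z - conv g (f n) d) \<le> top * e / 4"
        unfolding conv_def
      proof (intro norm_haar_diff_le cont_conv_integrand g_cont fc z dX)
        fix y assume y: "y \<in> carrier X"
        have "norm (g (inv y \<otimes> z) - g (inv y \<otimes> d)) * norm (f n y) \<le> top * e / 4 * 1"
          using zd y bound [OF y] e' by (intro mult_mono) (auto intro: less_imp_le)
        then show "norm (g (z \<otimes> inv y) * f n y - g (d \<otimes> inv y) * f n y) \<le> top * e / 4"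
          using y z dX by (simp add: m_comm left_diff_distrib [symmetric] norm_mult)
      qed
      moreover have "norm (a + b - c) \<le> norm a + norm b + norm c" for a b c :: complex
        using norm_triangle_ineq [of a b] norm_triangle_ineq4 [of "a + b" c] by linarith
      note this [of "of_real top * f n z - conv g (f n) z" "conv g (f n) z - conv g (f n) d"
          "of_real top * f n d - conv g (f n) d"]
      moreover have "(of_real top * f n z - conv g (f n) z) + (conv g (f n) z - conv g (f n) d)
          - (of_real top * f n d - conv g (f n) d) = of_real top * (f n z - f n d)"
        by (simp add: algebra_simps)
      ultimately have "norm (of_real top * (f n z - f n d)) < top * e / 4 + top * e / 4 + top * e / 4"
        using small [OF z] small [OF dX] by (simp only:)
      then have "top * norm (f n z - f n d) < top * e"
        using top_pos e by (simp add: norm_mult)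
      then show ?thesis using top_pos by simp
    qed
    then have "\<forall>z\<in>carrier X. \<exists>d\<in>D. \<forall>n\<ge>N. norm (f n z - f n d) < e"
      using D(3) by meson
    with D(1,2) show ?thesis by blast
  qed
  obtain r l where rl: "strict_mono (r :: nat \<Rightarrow> nat)" "uniform_limit (carrier X) (\<lambda>n. f (r n)) l sequentially"
    using convergent_subsequence [OF bound equi] by metis
  have "l \<in> K" using K_uniform_limit [OF rl(2)] f by blast
  have "(\<lambda>n. f (r n) \<one>) \<longlonglongrightarrow> l \<one>"
    using rl(2) tendsto_uniform_limitI by fastforce
  then have "l \<one> = 1"
    using f(2) by (simp add: LIMSEQ_const_iff)
  have "(\<lambda>n. Re (conv g (f (r n)) \<one>)) \<longlonglongrightarrow> Re (conv g l \<one>)"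
    using conv_uniform_limit [OF rl(2)] fc by (intro tendsto_Re) auto
  moreover have "(\<lambda>n. Re (conv g (f (r n)) \<one>)) \<longlonglongrightarrow> top"
    using LIMSEQ_subseq_LIMSEQ [OF lim rl(1)] by (simp add: o_def)
  ultimately have "Re (conv g l \<one>) = top"
    using LIMSEQ_unique by blast
  then show ?thesis
    using that rl \<open>l \<in> K\<close> \<open>l \<one> = 1\<close> by blast
qed

definition maximisers :: "('a \<Rightarrow> complex) set" where
  "maximisers = {h \<in> K. h \<one> = 1 \<and> Re (conv g h \<one>) = top}"

lemma maximisers_nonempty: "maximisers \<noteq> {}"
proof -
  let ?S = "{h \<in> K. h \<one> = 1}"
  let ?F = "\<lambda>h. Re (conv g h \<one>)"
  have eq: "{Re (conv g h \<one>) | h. h \<in> K \<and> h \<one> = 1} = ?F ` ?S"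
    by auto
  have ne: "?S \<noteq> {}" using normalised_h0 by blast
  have bdd: "bdd_above (?F ` ?S)" using bdd_top by (simp only: eq)
  obtain f where f: "\<And>n::nat. f n \<in> ?S" "(\<lambda>n. ?F (f n)) \<longlonglongrightarrow> Sup (?F ` ?S)"
    using Sup_approximating_sequence [OF bdd ne] by blast
  have "(\<lambda>n. Re (conv g (f n) \<one>)) \<longlonglongrightarrow> top"
    using f(2) by (simp only: top_def eq)
  then obtain l where "l \<in> K" "l \<one> = 1" "Re (conv g l \<one>) = top"
    using maximising_sequence [of f] f(1) by auto
  then show ?thesis unfolding maximisers_def by blast
qed

text \<open>A sequence of maximisers is in particular a maximising sequence, so it has a uniform
  limit within the maximisers, and the energy is continuous along it.\<close>

lemma energy_maximiser:
  obtains h where "h \<in> maximisers" "\<And>k. k \<in> maximisers \<Longrightarrow> energy k \<le> energy h"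
proof -
  have "energy h \<le> 1" if "h \<in> maximisers" for h
  proof -
    have h: "h \<in> K" "h \<one> = 1" using that by (auto simp: maximisers_def)
    have "norm (haar (\<lambda>x. h x * cnj (h x))) \<le> 1"
    proof (intro norm_haar_le cont_intros K_cont h)
      fix x assume "x \<in> carrier X"
      then have "norm (h x) \<le> 1" using K_bound [OF h(1)] h(2) by simp
      then show "norm (h x * cnj (h x)) \<le> 1" by (simp add: norm_mult mult_le_one)
    qed
    then show ?thesis
      unfolding energy_def using complex_Re_le_cmod order_trans by blast
  qed
  then have bdd: "bdd_above (energy ` maximisers)" by (auto simp: bdd_above_def)
  then obtain f where f: "\<And>n::nat. f n \<in> maximisers" "(\<lambda>n. energy (f n)) \<longlonglongrightarrow> Sup (energy ` maximisers)"
    using Sup_approximating_sequence maximisers_nonempty by metis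
  have f': "f n \<in> K" "f n \<one> = 1" "Re (conv g (f n) \<one>) = top" for n
    using f(1) [of n] by (auto simp: maximisers_def)
  obtain r l where rl: "strict_mono (r :: nat \<Rightarrow> nat)" "uniform_limit (carrier X) (\<lambda>n. f (r n)) l sequentially"
    "l \<in> K" "l \<one> = 1" "Re (conv g l \<one>) = top"
    using maximising_sequence [of f] f' by auto
  have "(\<lambda>n. energy (f (r n))) \<longlonglongrightarrow> energy l"
    using energy_uniform_limit [OF rl(2)] f' K_cont by blast
  moreover have "(\<lambda>n. energy (f (r n))) \<longlonglongrightarrow> Sup (energy ` maximisers)"
    using LIMSEQ_subseq_LIMSEQ [OF f(2) rl(1)] by (simp add: o_def)
  ultimately have "energy l = Sup (energy ` maximisers)"
    using LIMSEQ_unique by blast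
  then have "energy k \<le> energy l" if "k \<in> maximisers" for k
    using bdd that by (simp add: cSup_upper)
  moreover have "l \<in> maximisers" using rl by (simp add: maximisers_def)
  ultimately show ?thesis using that by blast
qed

lemma energy_scaled_le:
  assumes h: "\<And>k. k \<in> maximisers \<Longrightarrow> energy k \<le> energy h"
    and k: "k \<in> K" "Re (conv g k \<one>) = top * Re (k \<one>)"
  shows "energy k \<le> (Re (k \<one>))\<^sup>2 * energy h"
proof (cases "Re (k \<one>) = 0")
  case True
  then have "haar (\<lambda>x. k x * cnj (k x)) = haar (\<lambda>x. 0)"
    using K_zero [OF k(1)] by (intro haar_cong) auto
  then show ?thesis using True by (simp add: energy_def)
next
  case False
  let ?k = "\<lambda>x. of_real (1 / Re (k \<one>)) * k x"
  have kc: "cont k" using k K_cont by blast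
  have "Re (conv g ?k \<one>) = top"
    using kc g_cont k(2) False by (subst conv_cmult) auto
  then have "?k \<in> maximisers"
    unfolding maximisers_def using K_normalise [OF k(1) False] by blast
  then have "energy ?k \<le> energy h" by (rule h)
  moreover have "energy ?k = energy k / (Re (k \<one>))\<^sup>2"
    using energy_combination [OF kc kc, of "1 / Re (k \<one>)" 0] by (simp add: power_divide)
  ultimately have "energy k / (Re (k \<one>))\<^sup>2 \<le> energy h" by simp
  then show ?thesis
    using False by (simp add: pos_divide_le_eq mult.commute)
qed

text \<open>Two perturbations of \<open>h\<close> with opposite phases average to \<open>h\<close>.
  Both must attain the maximum relative to their values at \<open>\<one>\<close>, and maximality of
  the energy then forces them to be multiples of \<open>h\<close>. Letting the phase vary separates
  the two translates in \<open>perturb\<close>.\<close>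

lemma maximal_energy_multiplicative:
  assumes hF: "h \<in> maximisers" and max: "\<And>k. k \<in> maximisers \<Longrightarrow> energy k \<le> energy h"
    and t: "t \<in> carrier X" and x: "x \<in> carrier X"
  shows "h (x \<otimes> t) = h x * h t"
proof -
  have h: "h \<in> K" "h \<one> = 1" "Re (conv g h \<one>) = top" and hc: "cont h"
    using hF K_cont by (auto simp: maximisers_def)
  have phase: "\<theta> * h (x \<otimes> t) + cnj \<theta> * h (x \<otimes> inv t) = of_real (2 * Re (\<theta> * h t)) * h x" if \<theta>: "norm \<theta> = 1" for \<theta>
  proof -
    define q where "q y = (\<theta> * h (y \<otimes> t) + cnj \<theta> * h (y \<otimes> inv t)) / 2" for y
    define r where "r = Re (\<theta> * h t)"
    define s where "s = Re (haar (\<lambda>x. h x * cnj (q x)))"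
    have qc: "cont q"
    proof -
      have "cont (\<lambda>y. (1/2) * (\<theta> * h (y \<otimes> t) + cnj \<theta> * h (y \<otimes> inv t)))"
        using t hc by (intro cont_intros) auto
      then show ?thesis by (simp add: q_def [abs_def])
    qed
    have q1: "q \<one> = of_real r"
      using t K_hermitian [OF h(1) t] by (simp add: q_def r_def complex_eq_iff)
    have r: "\<bar>r\<bar> \<le> 1"
    proof -
      have "\<bar>r\<bar> \<le> norm (\<theta> * h t)" unfolding r_def by (rule abs_Re_le_cmod)
      then show ?thesis using \<theta> K_bound [OF h(1) t] h(2) by (simp add: norm_mult)
    qed
    \<comment> \<open>These are half the perturbations with phases \<open>\<theta>\<close> and
      \<open>- \<theta>\<close>, because \<open>1 + (norm \<theta>)\<^sup>2 = 2\<close>.\<close>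
    have mem: "(\<lambda>y. h y + of_real c * q y) \<in> K" if "c = 1 \<or> c = -1" for c :: real
    proof -
      have "(\<lambda>y. of_real (1/2) * perturb (of_real c * \<theta>) t h y) \<in> K"
        using K_perturb [OF h(1) t] by (intro K_scale) auto
      moreover have "(\<lambda>y. of_real (1/2) * perturb (of_real c * \<theta>) t h y) = (\<lambda>y. h y + of_real c * q y)"
        using that \<theta> by (auto simp: perturb_def q_def norm_mult field_simps)
      ultimately show ?thesis by (simp only:)
    qed
    have cv: "conv g (\<lambda>y. h y + of_real c * q y) \<one> = conv g h \<one> + of_real c * conv g q \<one>" for c
      using hc qc g_cont conv_add [of g h "\<lambda>y. of_real c * q y" \<one>] conv_cmult [of g q \<one> "of_real c"]
        cont_complex_mult [of "\<lambda>y. of_real c" q] by simp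
    \<comment> \<open>The bound of \<open>top_upper\<close> holds for \<open>h + q\<close> and for
      \<open>h - q\<close>, and \<open>h\<close> attains it. The two opposite inequalities for
      \<open>q\<close> leave equality, so both sums attain the bound as well.\<close>
    have eq: "Re (conv g q \<one>) = top * r"
    proof -
      have "top + c * Re (conv g q \<one>) \<le> top + c * (top * r)" if "c = 1 \<or> c = -1" for c :: real
        using top_upper [OF mem [OF that]] cv [of c] h q1 by (simp add: algebra_simps)
      from this [of 1] this [of "-1"] show ?thesis by simp
    qed
    have le: "energy (\<lambda>y. h y + of_real c * q y) \<le> (1 + c * r)\<^sup>2 * energy h" if c: "c = 1 \<or> c = -1" for c :: real
      using energy_scaled_le [OF max mem [OF c]] h q1 cv [of c] eq by (simp add: algebra_simps)
    have E: "energy (\<lambda>y. h y + of_real c * q y) = energy h + 2 * c * s + c\<^sup>2 * energy q" for c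
      using energy_combination [OF hc qc, of 1 c] by (simp add: s_def)
    have le1: "2 * s + energy q \<le> (2 * r + r\<^sup>2) * energy h"
      using le [of 1] E [of 1] by (simp add: algebra_simps power2_eq_square)
    have le2: "- 2 * s + energy q \<le> (- 2 * r + r\<^sup>2) * energy h"
      using le [of "-1"] E [of "-1"] by (simp add: algebra_simps power2_eq_square)
    \<comment> \<open>The weights are nonnegative since \<open>\<bar>r\<bar> \<le> 1\<close>, and
      they are chosen so that the combination is twice the statement that \<open>q - r * h\<close>
      has energy at most \<open>0\<close>.\<close>
    have "(1 - r) * (2 * s + energy q) + (1 + r) * (- 2 * s + energy q)
       \<le> (1 - r) * ((2 * r + r\<^sup>2) * energy h) + (1 + r) * ((- 2 * r + r\<^sup>2) * energy h)"
      using r le1 le2 by (intro add_mono mult_left_mono) auto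
    then have "r\<^sup>2 * energy h - 2 * r * s + energy q \<le> 0"
      by (simp add: algebra_simps power2_eq_square)
    moreover have "energy (\<lambda>y. of_real (- r) * h y + of_real 1 * q y) = r\<^sup>2 * energy h - 2 * r * s + energy q"
      using energy_combination [OF hc qc, of "- r" 1] by (simp add: s_def)
    moreover have "cont (\<lambda>y. of_real (- r) * h y + of_real 1 * q y)"
      using hc qc by (intro cont_intros)
    ultimately have "of_real (- r) * h x + of_real 1 * q x = 0"
      using energy_eq_0 [of "\<lambda>y. of_real (- r) * h y + of_real 1 * q y" x] x by simp
    then have "2 * q x = 2 * (of_real r * h x)"
      by simp
    moreover have "\<theta> * h (x \<otimes> t) + cnj \<theta> * h (x \<otimes> inv t) = 2 * q x"
      unfolding q_def by simp
    ultimately have "\<theta> * h (x \<otimes> t) + cnj \<theta> * h (x \<otimes> inv t) = 2 * (of_real r * h x)"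
      by (simp only:)
    then show ?thesis
      unfolding r_def by (simp only: of_real_mult of_real_numeral mult.assoc)
  qed
  \<comment> \<open>The phase \<open>1\<close> gives the sum and the phase \<open>\<i>\<close> the
    difference of the two translates; adding them isolates \<open>h (x \<otimes> t)\<close>.\<close>
  have "h (x \<otimes> t) + h (x \<otimes> inv t) = of_real (2 * Re (h t)) * h x"
    using phase [of 1] by simp
  moreover have "h (x \<otimes> t) - h (x \<otimes> inv t) = 2 * \<i> * of_real (Im (h t)) * h x"
    using phase [of \<i>] by (simp add: complex_eq_iff)
  ultimately have "2 * h (x \<otimes> t) = 2 * (of_real (Re (h t)) + \<i> * of_real (Im (h t))) * h x"
    by (simp add: algebra_simps)
  also have "of_real (Re (h t)) + \<i> * of_real (Im (h t)) = h t"
    by (simp add: complex_eq_iff)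
  finally show ?thesis by simp
qed

theorem character_in_cone:
  obtains \<psi> where "\<psi> \<in> K" "\<And>x y. x \<in> carrier X \<Longrightarrow> y \<in> carrier X \<Longrightarrow> \<psi> (x \<otimes> y) = \<psi> x * \<psi> y"
    "\<And>x. x \<in> carrier X \<Longrightarrow> norm (\<psi> x) = 1" "0 < Re (conv g \<psi> \<one>)"
proof -
  obtain \<psi> where \<psi>: "\<psi> \<in> maximisers" "\<And>k. k \<in> maximisers \<Longrightarrow> energy k \<le> energy \<psi>"
    using energy_maximiser by metis
  then have K: "\<psi> \<in> K" "\<psi> \<one> = 1" "Re (conv g \<psi> \<one>) = top" by (auto simp: maximisers_def)
  have mult: "\<psi> (x \<otimes> y) = \<psi> x * \<psi> y" if "x \<in> carrier X" "y \<in> carrier X" for x y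
    using maximal_energy_multiplicative [OF \<psi>] that by blast
  have "norm (\<psi> x) = 1" if x: "x \<in> carrier X" for x
  proof -
    have "\<psi> x * cnj (\<psi> x) = 1"
      using mult [of x "inv x"] K_hermitian [OF K(1) x] K(2) x by simp
    then have "(norm (\<psi> x))\<^sup>2 = 1"
      by (metis complex_norm_square of_real_eq_1_iff)
    then show ?thesis by (simp add: power2_eq_1_iff) (use norm_ge_zero [of "\<psi> x"] in linarith)
  qed
  then show ?thesis using that K mult top_pos by simp
qed

end

section \<open>Separation and extension of characters\<close>

context compact_abelian_group
begin

lemma closed_subgroup_compact_metrizable:
  assumes "subgroup Y X" "closedin T Y"
  shows "compact_metrizable_abelian_group (X\<lparr>carrier := Y\<rparr>) (subtopology T Y)"
proof -
  have YX: "Y \<subseteq> carrier X" using assms(1) by (rule subgroup.subset)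
  have "group (X\<lparr>carrier := Y\<rparr>)"
    using subgroup.subgroup_is_group [OF assms(1) is_group] .
  moreover have "comm_monoid (X\<lparr>carrier := Y\<rparr>)"
    using group.is_monoid [OF calculation] YX
    by (intro monoid.monoid_comm_monoidI) (auto intro: m_comm)
  ultimately have "comm_group (X\<lparr>carrier := Y\<rparr>)"
    by (simp add: comm_group_def)
  moreover have "continuous_map (prod_topology (subtopology T Y) (subtopology T Y)) (subtopology T Y)
      (\<lambda>(x, y). x \<otimes> y)"
  proof -
    have *: "prod_topology (subtopology T Y) (subtopology T Y) = subtopology (prod_topology T T) (Y \<times> Y)"
      using YX by (simp add: prod_topology_subtopology subtopology_subtopology Times_Int_Times Int_absorb1)
    show ?thesis
      unfolding * continuous_map_in_subtopology
      using continuous_map_from_subtopology [OF cont_mult] YX subgroup.m_closed [OF assms(1)] by auto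
  qed
  moreover have "continuous_map (subtopology T Y) (subtopology T Y) (\<lambda>x. inv\<^bsub>X\<lparr>carrier := Y\<rparr>\<^esub> x)"
  proof (rule continuous_map_eq)
    show "continuous_map (subtopology T Y) (subtopology T Y) (\<lambda>x. inv x)"
      unfolding continuous_map_in_subtopology
      using continuous_map_from_subtopology [OF cont_inv] subgroup.m_inv_closed [OF assms(1)] by auto
  qed (use assms in auto)
  moreover have "compact_space (subtopology T Y)"
    using assms(2) compact closedin_compact_space compact_space_subtopology by blast
  moreover have "metrizable_space (subtopology T Y)"
    using metrizable metrizable_space_subtopology by blast
  ultimately show ?thesis
    using YX by (simp add: compact_metrizable_abelian_group_def Int_absorb1)
qed

definition unitary_character :: "('x \<Rightarrow> complex) \<Rightarrow> bool" where
  "unitary_character \<psi> \<longleftrightarrow> cont \<psi> \<and> (\<forall>x\<in>carrier X. \<forall>y\<in>carrier X. \<psi> (x \<otimes> y) = \<psi> x * \<psi> y) \<and>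
     (\<forall>x\<in>carrier X. norm (\<psi> x) = 1)"

lemma unitary_character_one: "unitary_character \<psi> \<Longrightarrow> \<psi> \<one> = 1"
  unfolding unitary_character_def
  by (metis mult_cancel_right1 norm_zero one_closed r_one zero_neq_one)

lemma unitary_character_inv: "unitary_character \<psi> \<Longrightarrow> x \<in> carrier X \<Longrightarrow> \<psi> (inv x) = cnj (\<psi> x)"
proof -
  assume \<psi>: "unitary_character \<psi>" and x: "x \<in> carrier X"
  have "\<psi> x * \<psi> (inv x) = 1"
    using \<psi> x unitary_character_one [OF \<psi>] unfolding unitary_character_def
    by (metis inv_closed r_inv)
  moreover have "\<psi> x * cnj (\<psi> x) = 1"
    using \<psi> x unfolding unitary_character_def by (metis complex_norm_square of_real_1 power_one)
  ultimately have "\<psi> x * \<psi> (inv x) = \<psi> x * cnj (\<psi> x)" "\<psi> x \<noteq> 0"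
    by auto
  then show ?thesis by simp
qed

section \<open>Autocorrelations and bump functions\<close>

definition autocorrelation :: "('x \<Rightarrow> complex) \<Rightarrow> 'x \<Rightarrow> complex" where
  "autocorrelation f z = haar (\<lambda>w. f (z \<otimes> w) * cnj (f w))"

lemma cont_autocorrelation_integrand:
  "cont f \<Longrightarrow> cont h \<Longrightarrow> z \<in> carrier X \<Longrightarrow> cont (\<lambda>w. f (z \<otimes> w) * cnj (h w))"
  by (intro cont_intros)

lemma cont_autocorrelation:
  assumes "cont f"
  shows "cont (autocorrelation f)"
proof (rule contI_uniform)
  fix e :: real assume e: "e > 0"
  obtain B where B: "B > 0" "\<And>x. x \<in> carrier X \<Longrightarrow> norm (f x) \<le> B"
    using cont_bounded [OF assms] by metis
  have "e / 2 / B > 0" using e B by simp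
  then obtain U where U: "openin T U" "\<one> \<in> U"
    "\<And>x u. x \<in> carrier X \<Longrightarrow> u \<in> U \<Longrightarrow> norm (f (x \<otimes> u) - f x) < e / 2 / B"
    using cont_uniform [OF assms] by metis
  have "norm (autocorrelation f (x \<otimes> u) - autocorrelation f x) < e" if x: "x \<in> carrier X" and u: "u \<in> U" for x u
  proof -
    have uX: "u \<in> carrier X" using openin_subset [OF U(1)] u by auto
    have "norm (autocorrelation f (x \<otimes> u) - autocorrelation f x) \<le> e / 2"
      unfolding autocorrelation_def
    proof (intro norm_haar_diff_le cont_autocorrelation_integrand assms m_closed x uX)
      fix w assume w: "w \<in> carrier X"
      have "norm (f (x \<otimes> w \<otimes> u) - f (x \<otimes> w)) * norm (cnj (f w)) \<le> e / 2 / B * B"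
        using U(3) [of "x \<otimes> w" u] x u w B e by (intro mult_mono) (auto intro: less_imp_le)
      moreover have "x \<otimes> w \<otimes> u = x \<otimes> u \<otimes> w" using x uX w by (simp add: m_ac)
      ultimately show "norm (f (x \<otimes> u \<otimes> w) * cnj (f w) - f (x \<otimes> w) * cnj (f w)) \<le> e / 2"
        using B(1) by (simp add: left_diff_distrib [symmetric] norm_mult)
    qed
    with e show ?thesis by simp
  qed
  with U show "\<exists>U. openin T U \<and> \<one> \<in> U \<and>
      (\<forall>x\<in>carrier X. \<forall>u\<in>U. norm (autocorrelation f (x \<otimes> u) - autocorrelation f x) < e)"
    by blast
qed

lemma autocorrelation_one:
  assumes "cont f"
  shows "autocorrelation f \<one> = of_real (energy f)"
proof -
  have "autocorrelation f \<one> = haar (\<lambda>w. f w * cnj (f w))"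
    unfolding autocorrelation_def by (rule haar_cong) simp
  moreover have "cnj (haar (\<lambda>w. f w * cnj (f w))) = haar (\<lambda>w. cnj (f w * cnj (f w)))"
    using haar_cnj [OF cont_complex_mult [OF assms cont_cnj [OF assms]]] by simp
  then have "cnj (haar (\<lambda>w. f w * cnj (f w))) = haar (\<lambda>w. f w * cnj (f w))"
    by (simp add: mult.commute)
  ultimately show ?thesis
    unfolding energy_def by (metis Reals_cnj_iff of_real_Re)
qed

text \<open>This identity explains the coefficients of \<open>perturb\<close>: it replaces
  \<open>f\<close> by \<open>f\<close> plus \<open>\<theta>\<close> times a translate, so
  autocorrelations remain autocorrelations.\<close>

lemma perturb_autocorrelation:
  assumes f: "cont f" and t: "t \<in> carrier X" and z: "z \<in> carrier X"
  shows "perturb \<theta> t (autocorrelation f) z = autocorrelation (\<lambda>w. f w + \<theta> * f (w \<otimes> t)) z"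
proof -
  define ft where "ft w = f (w \<otimes> t)" for w
  have ft: "cont ft" unfolding ft_def [abs_def] using f t by (rule cont_translate')
  note c = cont_autocorrelation_integrand
  have tz: "z \<otimes> t \<in> carrier X" "z \<otimes> inv t \<in> carrier X" using t z by auto
  have 1: "haar (\<lambda>w. ft (z \<otimes> w) * cnj (ft w)) = autocorrelation f z"
  proof -
    have "haar (\<lambda>w. ft (z \<otimes> w) * cnj (ft w)) = haar (\<lambda>w. f (z \<otimes> (w \<otimes> t)) * cnj (f (w \<otimes> t)))"
      using t z by (intro haar_cong) (simp add: ft_def m_assoc)
    then show ?thesis
      using haar_translate' [OF c [OF f f z] t] by (simp add: autocorrelation_def)
  qed
  have 2: "haar (\<lambda>w. ft (z \<otimes> w) * cnj (f w)) = autocorrelation f (z \<otimes> t)"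
    unfolding autocorrelation_def using t z by (intro haar_cong) (simp add: ft_def m_ac)
  have 3: "haar (\<lambda>w. f (z \<otimes> w) * cnj (ft w)) = autocorrelation f (z \<otimes> inv t)"
  proof -
    have "haar (\<lambda>w. f (z \<otimes> w) * cnj (ft w)) = haar (\<lambda>w. f (z \<otimes> inv t \<otimes> (w \<otimes> t)) * cnj (f (w \<otimes> t)))"
    proof (rule haar_cong)
      fix w assume w: "w \<in> carrier X"
      have "z \<otimes> inv t \<otimes> (w \<otimes> t) = z \<otimes> w"
        using t z w mult_inv_cancel [of "inv t" w] by (simp add: m_assoc m_comm [of w t])
      then show "f (z \<otimes> w) * cnj (ft w) = f (z \<otimes> inv t \<otimes> (w \<otimes> t)) * cnj (f (w \<otimes> t))"
        using t z w by (simp add: ft_def)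
    qed
    then show ?thesis
      using haar_translate' [OF c [OF f f tz(2)] t] by (simp add: autocorrelation_def)
  qed
  have "autocorrelation (\<lambda>w. f w + \<theta> * f (w \<otimes> t)) z
     = haar (\<lambda>w. ((f (z \<otimes> w) * cnj (f w)) + (cnj \<theta> * (f (z \<otimes> w) * cnj (ft w))))
        + ((\<theta> * (ft (z \<otimes> w) * cnj (f w))) + (of_real ((norm \<theta>)\<^sup>2) * (ft (z \<otimes> w) * cnj (ft w)))))"
    unfolding autocorrelation_def
    by (intro haar_cong) (simp add: ft_def algebra_simps complex_norm_square flip: of_real_power)
  also have "\<dots> = (autocorrelation f z + cnj \<theta> * autocorrelation f (z \<otimes> inv t))
     + (\<theta> * autocorrelation f (z \<otimes> t) + of_real ((norm \<theta>)\<^sup>2) * autocorrelation f z)"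
  proof -
    have sc: "cont (\<lambda>x. a * h x)" if "cont h" for a h using that by (intro cont_intros)
    note c1 = c [OF f f z] and c2 = sc [OF c [OF f ft z], of "cnj \<theta>"] and c3 = sc [OF c [OF ft f z], of \<theta>]
      and c4 = sc [OF c [OF ft ft z], of "of_real ((norm \<theta>)\<^sup>2)"]
    show ?thesis
      unfolding haar_add [OF continuous_map_add [OF c1 c2] continuous_map_add [OF c3 c4]]
        haar_add [OF c1 c2] haar_add [OF c3 c4] haar_cmult [OF c [OF f ft z]] haar_cmult [OF c [OF ft f z]]
        haar_cmult [OF c [OF ft ft z]] 1 2 3 by (simp add: autocorrelation_def)
  qed
  finally show ?thesis
    by (simp add: perturb_def algebra_simps)
qed

lemma bump_function:
  assumes "openin T U" "\<one> \<in> U"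
  obtains a :: "'x \<Rightarrow> real" where "cont (\<lambda>x. of_real (a x))" "a \<one> = 1"
    "\<And>x. x \<in> carrier X \<Longrightarrow> 0 \<le> a x" "\<And>x. x \<in> carrier X \<Longrightarrow> x \<notin> U \<Longrightarrow> a x = 0"
proof -
  have "closedin T {\<one>}"
    using Hausdorff closedin_Hausdorff_singleton by fastforce
  moreover have "closedin T (carrier X - U)"
    using assms(1) by (metis closedin_diff closedin_topspace topspace_eq)
  moreover have "disjnt (carrier X - U) {\<one>}"
    using assms(2) by (simp add: disjnt_def)
  ultimately obtain a where a: "continuous_map T (top_of_set {0..1::real}) a"
      "a ` (carrier X - U) \<subseteq> {0}" "a ` {\<one>} \<subseteq> {1}"
    using Urysohn_lemma [OF metrizable_imp_normal_space [OF metrizable], of "carrier X - U" "{\<one>}" 0 1] by auto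
  have "continuous_map T euclideanreal a" "a ` carrier X \<subseteq> {0..1}"
    using a(1) by (auto simp: continuous_map_in_subtopology)
  moreover have "continuous_map euclideanreal euclidean complex_of_real"
    by simp
  ultimately have "cont (\<lambda>x. of_real (a x))"
    using continuous_map_compose [of T euclideanreal a euclidean complex_of_real] by (simp add: o_def)
  then show ?thesis
    using that [of a] a(2,3) \<open>a ` carrier X \<subseteq> {0..1}\<close>
    by (metis Diff_iff atLeastAtMost_iff image_subset_iff singleton_iff insertI1)
qed

end

section \<open>The cone belonging to a character of a closed subgroup\<close>

locale closed_subgroup_character = compact_abelian_group +
  fixes Y :: "'a set" and \<kappa> :: "'a \<Rightarrow> complex"
  assumes Y: "subgroup Y X" "closedin T Y"
    and \<kappa>_cont: "continuous_map (subtopology T Y) euclidean \<kappa>"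
    and \<kappa>_mult: "x \<in> Y \<Longrightarrow> y \<in> Y \<Longrightarrow> \<kappa> (x \<otimes> y) = \<kappa> x * \<kappa> y"
    and \<kappa>_norm: "y \<in> Y \<Longrightarrow> norm (\<kappa> y) = 1"
begin

lemma Y_subset: "y \<in> Y \<Longrightarrow> y \<in> carrier X"
  using Y(1) subgroup.subset by blast

sublocale N: compact_abelian_group "X\<lparr>carrier := Y\<rparr>" "subtopology T Y"
  using closed_subgroup_compact_metrizable [OF Y] by unfold_locales

definition equivariant :: "('a \<Rightarrow> complex) \<Rightarrow> bool" where
  "equivariant f \<longleftrightarrow> cont f \<and> (\<forall>x\<in>carrier X. \<forall>y\<in>Y. f (x \<otimes> y) = \<kappa> y * f x)"

text \<open>The uniform closure is built in, so that limits of maximising sequences stay in the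
  cone.\<close>

definition cone :: "('a \<Rightarrow> complex) set" where
  "cone = {h. \<forall>e>0. \<exists>f. equivariant f \<and> (\<forall>x\<in>carrier X. norm (h x - autocorrelation f x) \<le> e)}"

lemma equivariant_cont: "equivariant f \<Longrightarrow> cont f"
  by (simp add: equivariant_def)

lemma autocorrelation_in_cone: "equivariant f \<Longrightarrow> autocorrelation f \<in> cone"
  unfolding cone_def by (auto intro!: exI [of _ f])

lemma coneE:
  assumes "h \<in> cone" "e > 0"
  obtains f where "equivariant f" "\<forall>x\<in>carrier X. norm (h x - autocorrelation f x) \<le> e"
  using assms unfolding cone_def by blast

sublocale positive_cone X T cone
proof
  fix h assume h: "h \<in> cone"
  have "\<exists>f. equivariant f \<and> (\<forall>x\<in>carrier X. norm (h x - autocorrelation f x) \<le> 1 / Suc n)" for n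
    using h by (simp add: cone_def)
  then obtain f where f: "\<And>n. equivariant (f n)"
    "\<And>n x. x \<in> carrier X \<Longrightarrow> norm (h x - autocorrelation (f n) x) \<le> 1 / Suc n"
    by metis
  have "uniform_limit (carrier X) (\<lambda>n. autocorrelation (f n)) h sequentially"
    unfolding uniform_limit_sequentially_iff
  proof (intro allI impI)
    fix e :: real assume "e > 0"
    then obtain N where N: "1 / Suc N < e"
      using nat_approx_posE by metis
    have "dist (autocorrelation (f n) x) (h x) < e" if "n \<ge> N" "x \<in> carrier X" for n x
    proof -
      have "1 / Suc n \<le> 1 / Suc N" using that by (simp add: frac_le)
      then show ?thesis
        using f(2) [OF that(2), of n] N by (simp add: dist_norm norm_minus_commute)
    qed
    then show "\<exists>N. \<forall>n\<ge>N. \<forall>x\<in>carrier X. dist (autocorrelation (f n) x) (h x) < e"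
      by blast
  qed
  then show "cont h"
    using cont_uniform_limit cont_autocorrelation equivariant_cont f(1) by blast
next
  fix h t \<theta> assume h: "h \<in> cone" and t: "t \<in> carrier X"
  show "perturb \<theta> t h \<in> cone"
    unfolding cone_def
  proof (intro CollectI allI impI)
    fix e :: real assume e: "e > 0"
    \<comment> \<open>\<open>C\<close> bounds \<open>perturb \<theta> t\<close> as an operator in
      the uniform norm, so an approximation of \<open>h\<close> within \<open>e / C\<close> is good
      enough.\<close>
    define C where "C = 1 + (norm \<theta>)\<^sup>2 + norm \<theta> + norm \<theta>"
    have "1 \<le> C" by (simp add: C_def)
    then have C: "C > 0" by simp
    obtain f where f: "equivariant f" "\<forall>x\<in>carrier X. norm (h x - autocorrelation f x) \<le> e / C"
      by (rule coneE [OF h, of "e / C"]) (use C e in auto)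
    define f' where "f' w = f w + \<theta> * f (w \<otimes> t)" for w
    have "cont f'"
      unfolding f'_def [abs_def] using f(1) t by (intro cont_intros equivariant_cont)
    moreover have "f' (x \<otimes> y) = \<kappa> y * f' x" if "x \<in> carrier X" "y \<in> Y" for x y
    proof -
      have "x \<otimes> y \<otimes> t = x \<otimes> t \<otimes> y" using that t Y_subset by (simp add: m_ac)
      then show ?thesis
        using f(1) that t by (simp add: f'_def equivariant_def algebra_simps)
    qed
    ultimately have "equivariant f'" by (simp add: equivariant_def)
    moreover have "norm (perturb \<theta> t h x - autocorrelation f' x) \<le> e" if x: "x \<in> carrier X" for x
    proof -
      define d where "d x = h x - autocorrelation f x" for x
      have d: "norm (d y) \<le> e / C" if "y \<in> carrier X" for y using f(2) that by (simp add: d_def)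
      have "autocorrelation f' x = perturb \<theta> t (autocorrelation f) x"
        unfolding f'_def [abs_def] using perturb_autocorrelation [OF equivariant_cont [OF f(1)] t x] by simp
      then have eq: "perturb \<theta> t h x - autocorrelation f' x
         = of_real (1 + (norm \<theta>)\<^sup>2) * d x + \<theta> * d (x \<otimes> t) + cnj \<theta> * d (x \<otimes> inv t)"
        by (simp add: perturb_def d_def algebra_simps)
      have "norm (of_real (1 + (norm \<theta>)\<^sup>2) * d x) \<le> (1 + (norm \<theta>)\<^sup>2) * (e / C)"
        unfolding norm_mult norm_of_real using d [OF x] by (intro mult_mono) auto
      moreover have "norm (\<theta> * d (x \<otimes> t)) \<le> norm \<theta> * (e / C)" "norm (cnj \<theta> * d (x \<otimes> inv t)) \<le> norm \<theta> * (e / C)"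
        unfolding norm_mult using d [of "x \<otimes> t"] d [of "x \<otimes> inv t"] x t
        by (simp_all add: mult_left_mono del: times_divide_eq_right)
      moreover have "norm (a + b + c) \<le> norm a + norm b + norm c" for a b c :: complex
        using norm_triangle_ineq [of a b] norm_triangle_ineq [of "a + b" c] by linarith
      note this [of "of_real (1 + (norm \<theta>)\<^sup>2) * d x" "\<theta> * d (x \<otimes> t)" "cnj \<theta> * d (x \<otimes> inv t)", folded eq]
      ultimately have "norm (perturb \<theta> t h x - autocorrelation f' x)
          \<le> (1 + (norm \<theta>)\<^sup>2) * (e / C) + norm \<theta> * (e / C) + norm \<theta> * (e / C)"
        by linarith
      also have "\<dots> = C * (e / C)" by (simp only: C_def distrib_right)
      finally show ?thesis using C by simp
    qed
    ultimately show "\<exists>f. equivariant f \<and> (\<forall>x\<in>carrier X. norm (perturb \<theta> t h x - autocorrelation f x) \<le> e)"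
      by blast
  qed
next
  fix h assume h: "h \<in> cone"
  have near: "\<exists>r. 0 \<le> r \<and> norm (h \<one> - of_real r) \<le> e" if e: "e > 0" for e
  proof -
    obtain f where f: "equivariant f" "\<forall>x\<in>carrier X. norm (h x - autocorrelation f x) \<le> e"
      by (rule coneE [OF h e])
    then show ?thesis
      using f(2) [rule_format, OF one_closed] energy_nonneg [OF equivariant_cont [OF f(1)]] autocorrelation_one [OF equivariant_cont [OF f(1)]]
      by (intro exI [of _ "energy f"]) simp
  qed
  have "- Re (h \<one>) \<le> 0 + e" "\<bar>Im (h \<one>)\<bar> \<le> 0 + e" if e: "e > 0" for e
  proof -
    obtain r where r: "0 \<le> r" "norm (h \<one> - of_real r) \<le> e" using near [OF e] by blast
    show "- Re (h \<one>) \<le> 0 + e" "\<bar>Im (h \<one>)\<bar> \<le> 0 + e"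
      using abs_Re_le_cmod [of "h \<one> - of_real r"] abs_Im_le_cmod [of "h \<one> - of_real r"] r by auto
  qed
  then have "- Re (h \<one>) \<le> 0" "\<bar>Im (h \<one>)\<bar> \<le> 0"
    using field_le_epsilon by blast+
  then show "0 \<le> Re (h \<one>) \<and> Im (h \<one>) = 0" by simp
next
  fix h and c :: real assume h: "h \<in> cone" and c: "0 \<le> c"
  show "(\<lambda>x. of_real c * h x) \<in> cone"
    unfolding cone_def
  proof (intro CollectI allI impI)
    fix e :: real assume e: "e > 0"
    then have "e / (c + 1) > 0" using c by simp
    then obtain f where f: "equivariant f" "\<forall>x\<in>carrier X. norm (h x - autocorrelation f x) \<le> e / (c + 1)"
      by (rule coneE [OF h])
    have fc: "cont f" using f(1) by (rule equivariant_cont)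
    define f' where "f' w = of_real (sqrt c) * f w" for w
    have "cont f'" unfolding f'_def [abs_def] using fc by (intro cont_intros)
    then have "equivariant f'"
      using f(1) by (simp add: equivariant_def f'_def)
    moreover have "norm (of_real c * h x - autocorrelation f' x) \<le> e" if x: "x \<in> carrier X" for x
    proof -
      have "autocorrelation f' x = haar (\<lambda>w. of_real c * (f (x \<otimes> w) * cnj (f w)))"
        unfolding autocorrelation_def
      proof (rule haar_cong)
        fix w
        have "complex_of_real (sqrt c) * of_real (sqrt c) = of_real c"
          using c by (simp flip: of_real_mult)
        then show "f' (x \<otimes> w) * cnj (f' w) = of_real c * (f (x \<otimes> w) * cnj (f w))"
          by (simp add: f'_def mult_ac)
      qed
      also have "\<dots> = of_real c * autocorrelation f x"
        unfolding autocorrelation_def by (rule haar_cmult [OF cont_autocorrelation_integrand [OF fc fc x]])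
      finally have "norm (of_real c * h x - autocorrelation f' x) = c * norm (h x - autocorrelation f x)"
        using c by (simp add: right_diff_distrib [symmetric] norm_mult)
      also have "\<dots> \<le> c * (e / (c + 1))"
        using f(2) [rule_format, OF x] c by (rule mult_left_mono)
      also have "\<dots> \<le> e" using c e by (simp add: pos_divide_le_eq)
      finally show ?thesis .
    qed
    ultimately show "\<exists>f. equivariant f \<and> (\<forall>x\<in>carrier X. norm (of_real c * h x - autocorrelation f x) \<le> e)"
      by blast
  qed
next
  fix h assume h: "\<And>e::real. 0 < e \<Longrightarrow> \<exists>k\<in>cone. \<forall>x\<in>carrier X. norm (h x - k x) \<le> e"
  show "h \<in> cone"
    unfolding cone_def
  proof (intro CollectI allI impI)
    fix e :: real assume "e > 0"
    then have e: "e / 2 > 0" by simp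
    obtain k where k: "k \<in> cone" "\<forall>x\<in>carrier X. norm (h x - k x) \<le> e / 2"
      using h [OF e] by blast
    obtain f where f: "equivariant f" "\<forall>x\<in>carrier X. norm (k x - autocorrelation f x) \<le> e / 2"
      by (rule coneE [OF k(1) e])
    have "norm (h x - autocorrelation f x) \<le> e" if "x \<in> carrier X" for x
      using norm_triangle_ineq [of "h x - k x" "k x - autocorrelation f x"] k(2) f(2) [rule_format, OF that] that by auto
    with f(1) show "\<exists>f. equivariant f \<and> (\<forall>x\<in>carrier X. norm (h x - autocorrelation f x) \<le> e)"
      by blast
  qed
qed

lemma autocorrelation_equivariant:
  assumes "equivariant f" "x \<in> carrier X" "y \<in> Y"
  shows "autocorrelation f (x \<otimes> y) = \<kappa> y * autocorrelation f x"
proof -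
  have "f (x \<otimes> y \<otimes> w) = \<kappa> y * f (x \<otimes> w)" if "w \<in> carrier X" for w
  proof -
    have "x \<otimes> y \<otimes> w = x \<otimes> w \<otimes> y" using assms that Y_subset by (simp add: m_ac)
    then show ?thesis using assms that by (simp add: equivariant_def)
  qed
  then have "autocorrelation f (x \<otimes> y) = haar (\<lambda>w. \<kappa> y * (f (x \<otimes> w) * cnj (f w)))"
    unfolding autocorrelation_def by (intro haar_cong) simp
  then show ?thesis
    using haar_cmult [OF cont_autocorrelation_integrand [OF equivariant_cont equivariant_cont]] assms
    by (simp add: autocorrelation_def)
qed

lemma cone_equivariant:
  assumes "h \<in> cone" "x \<in> carrier X" "y \<in> Y"
  shows "h (x \<otimes> y) = \<kappa> y * h x"
proof -
  have "norm (h (x \<otimes> y) - \<kappa> y * h x) \<le> 0 + e" if e: "e > 0" for e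
  proof -
    obtain f where f: "equivariant f" "\<forall>x\<in>carrier X. norm (h x - autocorrelation f x) \<le> e / 2"
      by (rule coneE [OF assms(1) half_gt_zero [OF e]])
    have eq: "h (x \<otimes> y) - \<kappa> y * h x = (h (x \<otimes> y) - autocorrelation f (x \<otimes> y)) - \<kappa> y * (h x - autocorrelation f x)"
      using autocorrelation_equivariant [OF f(1) assms(2,3)] by (simp add: algebra_simps)
    have "norm (\<kappa> y * (h x - autocorrelation f x)) \<le> e / 2"
      using f(2) [rule_format, OF assms(2)] \<kappa>_norm [OF assms(3)] by (simp add: norm_mult)
    moreover have "norm (h (x \<otimes> y) - autocorrelation f (x \<otimes> y)) \<le> e / 2"
      using f(2) [rule_format, of "x \<otimes> y"] assms Y_subset by simp
    ultimately show ?thesis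
      using norm_triangle_ineq4 [of "h (x \<otimes> y) - autocorrelation f (x \<otimes> y)" "\<kappa> y * (h x - autocorrelation f x)"]
      unfolding eq by linarith
  qed
  then show ?thesis
    using field_le_epsilon [of "norm (h (x \<otimes> y) - \<kappa> y * h x)" 0] by simp
qed

text \<open>The projection onto the functions that transform under \<open>Y\<close> by
  \<open>\<kappa>\<close>; the mean is that of the compact group \<open>Y\<close> itself.\<close>

definition average :: "('a \<Rightarrow> complex) \<Rightarrow> 'a \<Rightarrow> complex" where
  "average a x = N.haar (\<lambda>y. a (x \<otimes> y) * cnj (\<kappa> y))"

lemma cont_average_integrand:
  assumes "cont a" "x \<in> carrier X"
  shows "N.cont (\<lambda>y. a (x \<otimes> y) * cnj (\<kappa> y))"
  by (intro N.cont_complex_mult N.cont_cnj \<kappa>_cont continuous_map_from_subtopology cont_translate assms)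

lemma average_equivariant:
  assumes a: "cont a"
  shows "equivariant (average a)"
  unfolding equivariant_def
proof (intro conjI ballI)
  show "cont (average a)"
  proof (rule contI_uniform)
    fix e :: real assume e: "e > 0"
    then obtain U where U: "openin T U" "\<one> \<in> U"
      "\<And>x u. x \<in> carrier X \<Longrightarrow> u \<in> U \<Longrightarrow> norm (a (x \<otimes> u) - a x) < e / 2"
      using cont_uniform [OF a half_gt_zero] by metis
    have "norm (average a (x \<otimes> u) - average a x) < e" if x: "x \<in> carrier X" and u: "u \<in> U" for x u
    proof -
      have uX: "u \<in> carrier X" using openin_subset [OF U(1)] u by auto
      have "norm (average a (x \<otimes> u) - average a x) \<le> e / 2"
        unfolding average_def
      proof (intro N.norm_haar_diff_le cont_average_integrand a x uX m_closed)
        fix y assume "y \<in> carrier (X\<lparr>carrier := Y\<rparr>)"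
        then have y: "y \<in> Y" "y \<in> carrier X" using Y_subset by auto
        have "x \<otimes> u \<otimes> y = x \<otimes> y \<otimes> u" using x uX y by (simp add: m_ac)
        then show "norm (a (x \<otimes> u \<otimes> y) * cnj (\<kappa> y) - a (x \<otimes> y) * cnj (\<kappa> y)) \<le> e / 2"
          using U(3) [of "x \<otimes> y" u] x u y \<kappa>_norm [OF y(1)]
          by (simp add: left_diff_distrib [symmetric] norm_mult)
      qed
      with e show ?thesis by simp
    qed
    with U show "\<exists>U. openin T U \<and> \<one> \<in> U \<and> (\<forall>x\<in>carrier X. \<forall>u\<in>U. norm (average a (x \<otimes> u) - average a x) < e)"
      by blast
  qed
next
  fix x y assume x: "x \<in> carrier X" and y: "y \<in> Y"
  have yX: "y \<in> carrier X" using y Y_subset by blast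
  let ?F = "\<lambda>w. a (x \<otimes> w) * cnj (\<kappa> w)"
  have "a (x \<otimes> y \<otimes> w) * cnj (\<kappa> w) = \<kappa> y * ?F (y \<otimes> w)" if w: "w \<in> Y" for w
  proof -
    have "\<kappa> y * cnj (\<kappa> y) = 1"
      using \<kappa>_norm [OF y] by (metis complex_norm_square of_real_1 power_one)
    then show ?thesis
      using x y w yX Y_subset [OF w] \<kappa>_mult [OF y w] by (simp add: m_assoc algebra_simps)
  qed
  then have "average a (x \<otimes> y) = N.haar (\<lambda>w. \<kappa> y * ?F (y \<otimes> w))"
    unfolding average_def by (intro N.haar_cong) simp
  also have "\<dots> = \<kappa> y * N.haar (\<lambda>w. ?F (y \<otimes> w))"
    using N.cont_translate [OF cont_average_integrand [OF a x], of y] y by (intro N.haar_cmult) simp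
  also have "N.haar (\<lambda>w. ?F (y \<otimes> w)) = average a x"
    unfolding average_def using N.haar_translate [OF cont_average_integrand [OF a x], of y] y by simp
  finally show "average a (x \<otimes> y) = \<kappa> y * average a x" .
qed

text \<open>The element \<open>g\<close> serves both as kernel and as \<open>h0\<close>: by
  hermitian symmetry \<open>conv g g \<one>\<close> is its energy. The character found lies in the
  cone, so its equivariance, read at \<open>\<one>\<close>, says that it restricts to
  \<open>\<kappa>\<close>.\<close>

lemma character_from_cone:
  assumes g: "g \<in> cone" "g \<one> \<noteq> 0"
  obtains \<psi> where "unitary_character \<psi>" "\<And>y. y \<in> Y \<Longrightarrow> \<psi> y = \<kappa> y" "0 < Re (conv g \<psi> \<one>)"
proof -
  have gc: "cont g" using g K_cont by blast
  have "conv g g \<one> = haar (\<lambda>y. g y * cnj (g y))"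
    unfolding conv_def using K_hermitian [OF g(1)] by (intro haar_cong) (simp add: mult.commute)
  then have "Re (conv g g \<one>) = energy g" by (simp add: energy_def)
  moreover have "0 < energy g"
    using energy_eq_0 [OF gc _ one_closed] g(2) by force
  ultimately have "0 < Re (conv g g \<one>)" by simp
  then interpret F: cone_functional X T cone g g
    by (intro cone_functional.intro positive_cone_axioms cone_functional_axioms.intro)
      (use gc g K_hermitian in auto)
  obtain \<psi> where \<psi>: "\<psi> \<in> cone" "\<And>x y. x \<in> carrier X \<Longrightarrow> y \<in> carrier X \<Longrightarrow> \<psi> (x \<otimes> y) = \<psi> x * \<psi> y"
    "\<And>x. x \<in> carrier X \<Longrightarrow> norm (\<psi> x) = 1" "0 < Re (conv g \<psi> \<one>)"
    using F.character_in_cone by metis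
  have u: "unitary_character \<psi>"
    unfolding unitary_character_def using \<psi> K_cont by blast
  have "\<psi> y = \<kappa> y" if "y \<in> Y" for y
    using cone_equivariant [OF \<psi>(1) one_closed that] unitary_character_one [OF u] that Y_subset by simp
  then show ?thesis using that u \<psi>(4) by blast
qed

text \<open>It suffices to find an equivariant function that does not vanish at
  \<open>\<one>\<close>. The bump vanishes outside an open set that meets \<open>Y\<close> only
  where \<open>\<kappa>\<close> has positive real part, so no cancellation occurs in its average at
  \<open>\<one>\<close>.\<close>

lemma character_extends:
  obtains \<psi> where "unitary_character \<psi>" "\<And>y. y \<in> Y \<Longrightarrow> \<psi> y = \<kappa> y"
proof -
  have oneY: "\<one> \<in> Y" using Y(1) subgroup.one_closed by blast
  have \<kappa>1: "\<kappa> \<one> = 1"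
    using \<kappa>_mult [OF oneY oneY] \<kappa>_norm [OF oneY] by force
  have "openin (subtopology T Y) {y \<in> topspace (subtopology T Y). \<kappa> y \<in> {z. 0 < Re z}}"
    by (rule openin_continuous_map_preimage [OF \<kappa>_cont]) (simp add: open_halfspace_Re_gt)
  then obtain U where U: "openin T U" "{y \<in> topspace (subtopology T Y). \<kappa> y \<in> {z. 0 < Re z}} = U \<inter> Y"
    unfolding openin_subtopology by blast
  have "\<one> \<in> {y \<in> topspace (subtopology T Y). \<kappa> y \<in> {z. 0 < Re z}}"
    using \<kappa>1 oneY by simp
  then have "\<one> \<in> U" unfolding U(2) by blast
  then obtain a :: "'a \<Rightarrow> real" where a: "cont (\<lambda>x. of_real (a x))" "a \<one> = 1"
    "\<And>x. x \<in> carrier X \<Longrightarrow> 0 \<le> a x" "\<And>x. x \<in> carrier X \<Longrightarrow> x \<notin> U \<Longrightarrow> a x = 0"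
    using bump_function [OF U(1)] by metis
  define f where "f = average (\<lambda>x. of_real (a x))"
  have f: "equivariant f" unfolding f_def using a(1) by (rule average_equivariant)
  have "0 < Re (f \<one>)"
    unfolding f_def average_def
  proof (rule N.haar_pos [of _ \<one>])
    fix y assume "y \<in> carrier (X\<lparr>carrier := Y\<rparr>)"
    then have y: "y \<in> Y" "y \<in> carrier X" using Y_subset by auto
    show "0 \<le> Re (of_real (a (\<one> \<otimes> y)) * cnj (\<kappa> y))"
    proof (cases "y \<in> U")
      case True
      then have "0 < Re (\<kappa> y)" using U(2) y by blast
      then show ?thesis using a(3) y by simp
    next
      case False
      then show ?thesis using a(4) y by simp
    qed
  qed (use cont_average_integrand [OF a(1) one_closed] oneY \<kappa>1 a(2) in auto)
  then have "f \<one> \<noteq> 0" by auto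
  then have "autocorrelation f \<one> \<noteq> 0"
    using autocorrelation_one [OF equivariant_cont [OF f]] energy_eq_0 [OF equivariant_cont [OF f] _ one_closed]
    by force
  then show ?thesis
    using character_from_cone [OF autocorrelation_in_cone [OF f]] that by metis
qed

end

section \<open>The extension and separation theorems\<close>

context compact_abelian_group
begin

theorem character_extension:
  assumes "subgroup Y X" "closedin T Y" "continuous_map (subtopology T Y) euclidean \<kappa>"
    and "\<And>x y. x \<in> Y \<Longrightarrow> y \<in> Y \<Longrightarrow> \<kappa> (x \<otimes> y) = \<kappa> x * \<kappa> y" "\<And>y. y \<in> Y \<Longrightarrow> norm (\<kappa> y) = 1"
  obtains \<psi> where "unitary_character \<psi>" "\<And>y. y \<in> Y \<Longrightarrow> \<psi> y = \<kappa> y"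
proof -
  interpret closed_subgroup_character X T Y \<kappa>
    by (intro closed_subgroup_character.intro compact_abelian_group_axioms closed_subgroup_character_axioms.intro)
      (use assms in auto)
  show ?thesis using character_extends that by blast
qed

text \<open>The kernel is chosen so that a character with value \<open>1\<close> at \<open>x\<close>
  cannot correlate with it. It is the perturbation of an autocorrelation \<open>h\<close> with phase
  \<open>-1\<close> at \<open>x\<close>, and against such a character it gives
  \<open>2 * c - c - c\<close> for one and the same \<open>c\<close>. It is nonzero at
  \<open>\<one>\<close> because \<open>f\<close> takes different values at \<open>\<one>\<close> and
  \<open>x\<close>.\<close>

theorem separating_character:
  assumes Y: "subgroup Y X" "closedin T Y" and x: "x \<in> carrier X" "x \<notin> Y"
  obtains \<psi> where "unitary_character \<psi>" "\<And>y. y \<in> Y \<Longrightarrow> \<psi> y = 1" "\<psi> x \<noteq> 1"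
proof -
  interpret closed_subgroup_character X T Y "\<lambda>_. 1"
    by (intro closed_subgroup_character.intro compact_abelian_group_axioms closed_subgroup_character_axioms.intro)
      (use Y in auto)
  have oneY: "\<one> \<in> Y" using Y(1) subgroup.one_closed by blast
  \<comment> \<open>The complement of the coset of \<open>x\<close> modulo \<open>Y\<close>: a bump
    supported here has an average over \<open>Y\<close> that vanishes at \<open>x\<close> but not at
    \<open>\<one>\<close>.\<close>
  define U where "U = {z \<in> carrier X. inv x \<otimes> z \<in> carrier X - Y}"
  have "openin T (carrier X - Y)"
    using Y(2) by (metis openin_diff openin_topspace topspace_eq)
  then have U: "openin T U"
    unfolding U_def using x by (intro openin_translate) auto
  have "inv x \<notin> Y"
    using subgroup.m_inv_closed [OF Y(1), of "inv x"] x by auto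
  then have "\<one> \<in> U" using x by (simp add: U_def)
  then obtain a :: "'x \<Rightarrow> real" where a: "cont (\<lambda>x. of_real (a x))" "a \<one> = 1"
    "\<And>x. x \<in> carrier X \<Longrightarrow> 0 \<le> a x" "\<And>x. x \<in> carrier X \<Longrightarrow> x \<notin> U \<Longrightarrow> a x = 0"
    using bump_function [OF U] by metis
  define f where "f = average (\<lambda>x. of_real (a x))"
  have f: "equivariant f" unfolding f_def using a(1) by (rule average_equivariant)
  have fc: "cont f" using f by (rule equivariant_cont)
  have "0 < Re (f \<one>)"
    unfolding f_def average_def
    by (rule N.haar_pos [of _ \<one>]) (use cont_average_integrand [OF a(1) one_closed] oneY a Y_subset in auto)
  moreover have "f x = 0"
  proof -
    have "a (x \<otimes> y) = 0" if "y \<in> Y" for y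
    proof (rule a(4))
      have "inv x \<otimes> (x \<otimes> y) = y"
        using x Y_subset [OF that] by (simp add: m_assoc [symmetric])
      then show "x \<otimes> y \<notin> U" using that by (simp add: U_def)
    qed (use x Y_subset that in auto)
    then have "f x = N.haar (\<lambda>y. 0)"
      unfolding f_def average_def by (intro N.haar_cong) simp
    then show ?thesis by simp
  qed
  ultimately have ne: "f \<one> - f (\<one> \<otimes> x) \<noteq> 0" using x by auto
  define h where "h = autocorrelation f"
  have h: "h \<in> cone" unfolding h_def using f by (rule autocorrelation_in_cone)
  have hc: "cont h" using h K_cont by blast
  define g where "g = perturb (-1) x h"
  have g: "g \<in> cone" unfolding g_def using h x by (intro K_perturb)
  have "g \<one> \<noteq> 0"
  proof -
    have c: "cont (\<lambda>w. f w + (-1) * f (w \<otimes> x))" using fc x by (intro cont_intros)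
    have "g \<one> = of_real (energy (\<lambda>w. f w + (-1) * f (w \<otimes> x)))"
      unfolding g_def h_def perturb_autocorrelation [OF fc x(1) one_closed] autocorrelation_one [OF c] ..
    moreover have "energy (\<lambda>w. f w + (-1) * f (w \<otimes> x)) \<noteq> 0"
      using energy_eq_0 [OF c _ one_closed] ne by force
    ultimately show ?thesis by simp
  qed
  then obtain \<psi> where \<psi>: "unitary_character \<psi>" "\<And>y. y \<in> Y \<Longrightarrow> \<psi> y = 1" "0 < Re (conv g \<psi> \<one>)"
    using character_from_cone [OF g] by metis
  have \<psi>c: "cont \<psi>" using \<psi>(1) by (simp add: unitary_character_def)
  have "\<psi> x \<noteq> 1"
  proof
    assume 1: "\<psi> x = 1"
    have inv1: "\<psi> (inv x) = 1" using unitary_character_inv [OF \<psi>(1) x(1)] 1 by simp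
    have eq: "conv h \<psi> t = conv h \<psi> \<one>" if t: "t \<in> carrier X" "\<psi> t = 1" for t
    proof -
      have "conv h (\<lambda>y. \<psi> (y \<otimes> t)) \<one> = conv h \<psi> \<one>"
        using \<psi>(1) t by (intro conv_cong) (simp add: unitary_character_def)
      then show ?thesis using conv_translate [OF hc \<psi>c one_closed t(1)] t by simp
    qed
    have ci: "cont (\<lambda>y. h (t \<otimes> inv y) * \<psi> y)" if "t \<in> carrier X" for t
      using cont_conv_integrand hc \<psi>c that by blast
    have "conv g \<psi> \<one> = haar (\<lambda>y. (2 * (h (\<one> \<otimes> inv y) * \<psi> y) - h (x \<otimes> inv y) * \<psi> y) - h (inv x \<otimes> inv y) * \<psi> y)"
      unfolding conv_def using x by (intro haar_cong) (simp add: g_def perturb_def algebra_simps m_comm)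
    also have "\<dots> = (2 * conv h \<psi> \<one> - conv h \<psi> x) - conv h \<psi> (inv x)"
    proof -
      have c2: "cont (\<lambda>y. 2 * (h (\<one> \<otimes> inv y) * \<psi> y))"
        using cont_complex_mult [OF continuous_map_canonical_const ci [OF one_closed]] .
      show ?thesis
        unfolding haar_diff [OF continuous_map_diff [OF c2 ci [OF x(1)]] ci [OF inv_closed [OF x(1)]]]
          haar_diff [OF c2 ci [OF x(1)]] haar_cmult [OF ci [OF one_closed]] conv_def ..
    qed
    finally have "conv g \<psi> \<one> = 0"
      using eq [of x] eq [of "inv x"] 1 inv1 x by simp
    with \<psi>(3) show False by simp
  qed
  then show ?thesis using that \<psi> by blast
qed

end

section \<open>The dual module of an algebraic action\<close>

lemma algebraic_actionI:
  assumes "compact_metrizable_abelian_group X T" and G: "group G"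
    and ext: "\<And>g. g \<in> carrier G \<Longrightarrow> \<alpha> g \<in> extensional (carrier X)"
    and closed: "\<And>g x. g \<in> carrier G \<Longrightarrow> x \<in> carrier X \<Longrightarrow> \<alpha> g x \<in> carrier X"
    and mult: "\<And>g x y. g \<in> carrier G \<Longrightarrow> x \<in> carrier X \<Longrightarrow> y \<in> carrier X \<Longrightarrow>
      \<alpha> g (x \<otimes>\<^bsub>X\<^esub> y) = \<alpha> g x \<otimes>\<^bsub>X\<^esub> \<alpha> g y"
    and comp: "\<And>g h x. g \<in> carrier G \<Longrightarrow> h \<in> carrier G \<Longrightarrow> x \<in> carrier X \<Longrightarrow>
      \<alpha> (g \<otimes>\<^bsub>G\<^esub> h) x = \<alpha> g (\<alpha> h x)"
    and id: "\<And>x. x \<in> carrier X \<Longrightarrow> \<alpha> \<one>\<^bsub>G\<^esub> x = x"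
    and cont: "\<And>g. g \<in> carrier G \<Longrightarrow> continuous_map T T (\<alpha> g)"
  shows "algebraic_action G X T \<alpha>"
proof -
  interpret X: compact_abelian_group X T using assms(1) by unfold_locales
  interpret G: group G by fact
  have bij: "bij_betw (\<alpha> g) (carrier X) (carrier X)" if g: "g \<in> carrier G" for g
  proof (rule bij_betw_byWitness [where f' = "\<alpha> (inv\<^bsub>G\<^esub> g)"])
    show "\<forall>x\<in>carrier X. \<alpha> (inv\<^bsub>G\<^esub> g) (\<alpha> g x) = x"
      using comp [of "inv\<^bsub>G\<^esub> g" g] g id by simp
    show "\<forall>x\<in>carrier X. \<alpha> g (\<alpha> (inv\<^bsub>G\<^esub> g) x) = x"
      using comp [of g "inv\<^bsub>G\<^esub> g"] g id by simp
  qed (use closed g in auto)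
  have Bij: "\<alpha> g \<in> Bij (carrier X)" if "g \<in> carrier G" for g
    using bij ext that by (simp add: Bij_def)
  have auto: "\<alpha> g \<in> auto X" if "g \<in> carrier G" for g
    using Bij that mult closed by (auto simp: auto_def hom_def)
  have "\<alpha> (g \<otimes>\<^bsub>G\<^esub> h) = compose (carrier X) (\<alpha> g) (\<alpha> h)" if "g \<in> carrier G" "h \<in> carrier G" for g h
    using that ext by (intro extensionalityI [where A = "carrier X"]) (auto simp: compose_eq comp)
  then have "\<alpha> \<in> hom G (AutoGroup X)"
    using auto Bij by (auto simp: hom_def AutoGroup_def BijGroup_def)
  then have "group_hom G (AutoGroup X) \<alpha>"
    by (simp add: group_hom_def group_hom_axioms_def G X.AutoGroup)
  then show ?thesis
    using assms(1) cont by (simp add: algebraic_action_def)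
qed

lemma unit_circle_topology: "continuous_map T (top_of_set (sphere 0 1)) f \<longleftrightarrow>
    continuous_map T euclidean f \<and> (\<forall>x\<in>topspace T. norm (f x) = (1::real))"
  for f :: "'a \<Rightarrow> complex"
  by (auto simp: continuous_map_in_subtopology)

section \<open>The Pontryagin dual group and annihilators\<close>

context compact_abelian_group
begin

abbreviation D where "D \<equiv> pontryagin_dual X T"

lemma dual_carrier: "\<phi> \<in> carrier D \<longleftrightarrow> \<phi> \<in> extensional (carrier X) \<and> unitary_character \<phi>"
  by (auto simp: pontryagin_dual_def unitary_character_def unit_circle_topology hom_def circle_group_def)

lemma dual_mult [simp]: "x \<in> carrier X \<Longrightarrow> (\<phi> \<otimes>\<^bsub>D\<^esub> \<psi>) x = \<phi> x * \<psi> x"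
  and dual_mult_eq: "\<phi> \<otimes>\<^bsub>D\<^esub> \<psi> = (\<lambda>x\<in>carrier X. \<phi> x * \<psi> x)"
  and dual_one_eq: "\<one>\<^bsub>D\<^esub> = (\<lambda>x\<in>carrier X. 1)"
  and dual_one [simp]: "x \<in> carrier X \<Longrightarrow> \<one>\<^bsub>D\<^esub> x = 1"
  by (simp_all add: pontryagin_dual_def)

lemma dualD:
  assumes "\<phi> \<in> carrier D"
  shows "cont \<phi>" "x \<in> carrier X \<Longrightarrow> y \<in> carrier X \<Longrightarrow> \<phi> (x \<otimes> y) = \<phi> x * \<phi> y"
    "x \<in> carrier X \<Longrightarrow> norm (\<phi> x) = 1" "\<phi> \<one> = 1" "x \<in> carrier X \<Longrightarrow> \<phi> (inv x) = cnj (\<phi> x)"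
    "\<phi> \<in> extensional (carrier X)"
  using assms unitary_character_one unitary_character_inv by (auto simp: dual_carrier unitary_character_def)

lemma dual_nonzero: "\<phi> \<in> carrier D \<Longrightarrow> x \<in> carrier X \<Longrightarrow> \<phi> x \<noteq> 0"
  using dualD(3) by force

lemma restrict_in_dual: "unitary_character \<psi> \<Longrightarrow> restrict \<psi> (carrier X) \<in> carrier D"
  unfolding dual_carrier unitary_character_def
  using continuous_map_eq [of T euclidean \<psi> "restrict \<psi> (carrier X)"] by simp

lemma dual_eqI: "\<phi> \<in> carrier D \<Longrightarrow> \<psi> \<in> carrier D \<Longrightarrow> (\<And>x. x \<in> carrier X \<Longrightarrow> \<phi> x = \<psi> x) \<Longrightarrow> \<phi> = \<psi>"
  using extensionalityI dualD(6) by metis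

lemma dual_comm_group: "comm_group D"
proof (rule comm_groupI)
  fix \<phi> \<psi> assume "\<phi> \<in> carrier D" "\<psi> \<in> carrier D"
  then have "unitary_character (\<lambda>x. \<phi> x * \<psi> x)"
    by (auto simp: unitary_character_def dual_carrier norm_mult cont_complex_mult)
  then show "\<phi> \<otimes>\<^bsub>D\<^esub> \<psi> \<in> carrier D"
    unfolding dual_mult_eq by (rule restrict_in_dual)
  show "\<phi> \<otimes>\<^bsub>D\<^esub> \<psi> = \<psi> \<otimes>\<^bsub>D\<^esub> \<phi>"
    by (simp add: dual_mult_eq mult.commute)
next
  show "\<one>\<^bsub>D\<^esub> \<in> carrier D"
    unfolding dual_one_eq by (rule restrict_in_dual) (simp add: unitary_character_def)
next
  fix \<phi> \<psi> \<eta> show "\<phi> \<otimes>\<^bsub>D\<^esub> \<psi> \<otimes>\<^bsub>D\<^esub> \<eta> = \<phi> \<otimes>\<^bsub>D\<^esub> (\<psi> \<otimes>\<^bsub>D\<^esub> \<eta>)"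
    by (auto simp: dual_mult_eq mult.assoc)
next
  fix \<phi> assume \<phi>: "\<phi> \<in> carrier D"
  show "\<one>\<^bsub>D\<^esub> \<otimes>\<^bsub>D\<^esub> \<phi> = \<phi>"
    using dualD(6) [OF \<phi>] by (auto simp: dual_mult_eq intro: extensionalityI [of _ "carrier X"])
  have "unitary_character (\<lambda>x. cnj (\<phi> x))"
    using \<phi> by (auto simp: unitary_character_def dual_carrier cont_cnj)
  then have "(\<lambda>x\<in>carrier X. cnj (\<phi> x)) \<in> carrier D" by (rule restrict_in_dual)
  moreover have "(\<lambda>x\<in>carrier X. cnj (\<phi> x)) \<otimes>\<^bsub>D\<^esub> \<phi> = \<one>\<^bsub>D\<^esub>"
  proof -
    have "cnj (\<phi> x) * \<phi> x = 1" if "x \<in> carrier X" for x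
      using dualD(3) [OF \<phi> that] by (metis complex_norm_square mult.commute of_real_1 power_one)
    then show ?thesis by (simp add: dual_mult_eq dual_one_eq cong: restrict_cong)
  qed
  ultimately show "\<exists>\<psi>\<in>carrier D. \<psi> \<otimes>\<^bsub>D\<^esub> \<phi> = \<one>\<^bsub>D\<^esub>" by blast
qed

sublocale D: comm_group D by (rule dual_comm_group)

lemma dual_inv [simp]:
  assumes "\<phi> \<in> carrier D" "x \<in> carrier X"
  shows "(inv\<^bsub>D\<^esub> \<phi>) x = cnj (\<phi> x)"
proof -
  have "(inv\<^bsub>D\<^esub> \<phi>) x * \<phi> x = 1"
    using assms by (metis D.l_inv dual_mult dual_one)
  moreover have "cnj (\<phi> x) * \<phi> x = 1"
    using dualD(3) [OF assms] by (metis complex_norm_square mult.commute of_real_1 power_one)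
  ultimately have "(inv\<^bsub>D\<^esub> \<phi>) x * \<phi> x = cnj (\<phi> x) * \<phi> x" by simp
  then show ?thesis using dual_nonzero [OF assms] by simp
qed

lemma dual_nat_pow [simp]:
  assumes "\<phi> \<in> carrier D" "x \<in> carrier X"
  shows "(\<phi> [^]\<^bsub>D\<^esub> (n::nat)) x = \<phi> x ^ n"
  using assms by (induction n) simp_all

lemma dual_apply_nat_pow:
  assumes "\<phi> \<in> carrier D" "x \<in> carrier X"
  shows "\<phi> (x [^] (n::nat)) = \<phi> x ^ n"
  using assms by (induction n) (simp_all add: dualD)

lemma dual_separates:
  assumes "subgroup Y X" "closedin T Y" "x \<in> carrier X" "x \<notin> Y"
  obtains \<phi> where "\<phi> \<in> carrier D" "\<And>y. y \<in> Y \<Longrightarrow> \<phi> y = 1" "\<phi> x \<noteq> 1"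
proof -
  obtain \<psi> where \<psi>: "unitary_character \<psi>" "\<And>y. y \<in> Y \<Longrightarrow> \<psi> y = 1" "\<psi> x \<noteq> 1"
    using separating_character [OF assms] by metis
  show ?thesis
  proof (rule that [OF restrict_in_dual [OF \<psi>(1)]])
    show "\<And>y. y \<in> Y \<Longrightarrow> restrict \<psi> (carrier X) y = 1"
      using \<psi>(2) subgroup.subset [OF assms(1)] by auto
  qed (use \<psi>(3) assms(3) in auto)
qed

lemma closed_one: "closedin T {\<one>}"
  using Hausdorff closedin_Hausdorff_singleton by fastforce

lemma dual_separates_points:
  assumes "x \<in> carrier X" "x \<noteq> \<one>"
  obtains \<phi> where "\<phi> \<in> carrier D" "\<phi> x \<noteq> 1"
  using dual_separates [OF triv_subgroup closed_one assms(1)] assms(2) by blast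

definition annihilator :: "'x set \<Rightarrow> ('x \<Rightarrow> complex) set" where
  "annihilator Y = {\<phi> \<in> carrier D. \<forall>y\<in>Y. \<phi> y = 1}"

text \<open>Separation makes the passage from closed subgroups to annihilators injective, so that
  chains of subgroups can be studied inside the dual.\<close>

lemma subset_if_annihilator_subset:
  assumes "subgroup Y X" "closedin T Y" "Z \<subseteq> carrier X" "annihilator Y \<subseteq> annihilator Z"
  shows "Z \<subseteq> Y"
proof (rule ccontr)
  assume "\<not> Z \<subseteq> Y"
  then obtain z where z: "z \<in> Z" "z \<notin> Y" "z \<in> carrier X" using assms(3) by auto
  obtain \<phi> where "\<phi> \<in> carrier D" "\<And>y. y \<in> Y \<Longrightarrow> \<phi> y = 1" "\<phi> z \<noteq> 1"
    using dual_separates [OF assms(1,2) z(3,2)] by metis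
  with assms(4) z(1) show False unfolding annihilator_def by blast
qed

end

section \<open>Submodules of the dual and the descending chain condition\<close>

locale alg_action = compact_abelian_group X T
  for X :: "('x, 'n) monoid_scheme" (structure) and T :: "'x topology" +
  fixes G :: "('g, 'm) monoid_scheme" and \<alpha> :: "'g \<Rightarrow> 'x \<Rightarrow> 'x"
  assumes algebraic: "algebraic_action G X T \<alpha>"
begin

sublocale G: group G
  using algebraic unfolding algebraic_action_def group_hom_def by auto

lemma act_auto: "g \<in> carrier G \<Longrightarrow> \<alpha> g \<in> auto X"
  using algebraic unfolding algebraic_action_def group_hom_def group_hom_axioms_def hom_def AutoGroup_def
  by auto

lemma act_closed [simp, intro]: "g \<in> carrier G \<Longrightarrow> x \<in> carrier X \<Longrightarrow> \<alpha> g x \<in> carrier X"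
  and act_mult: "g \<in> carrier G \<Longrightarrow> x \<in> carrier X \<Longrightarrow> y \<in> carrier X \<Longrightarrow> \<alpha> g (x \<otimes> y) = \<alpha> g x \<otimes> \<alpha> g y"
  and act_ext: "g \<in> carrier G \<Longrightarrow> \<alpha> g \<in> extensional (carrier X)"
  using act_auto by (auto simp: auto_def hom_def Bij_def)

lemma act_cont: "g \<in> carrier G \<Longrightarrow> continuous_map T T (\<alpha> g)"
  using algebraic unfolding algebraic_action_def by auto

lemma act_comp:
  assumes "g \<in> carrier G" "h \<in> carrier G" "x \<in> carrier X"
  shows "\<alpha> (g \<otimes>\<^bsub>G\<^esub> h) x = \<alpha> g (\<alpha> h x)"
proof -
  have "\<alpha> (g \<otimes>\<^bsub>G\<^esub> h) = \<alpha> g \<otimes>\<^bsub>AutoGroup X\<^esub> \<alpha> h"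
    using algebraic assms unfolding algebraic_action_def by (metis group_hom.hom_mult)
  also have "\<dots> = compose (carrier X) (\<alpha> g) (\<alpha> h)"
    using act_auto assms by (simp add: AutoGroup_def BijGroup_def auto_def)
  finally show ?thesis using assms by (simp add: compose_eq)
qed

lemma act_id [simp]: "x \<in> carrier X \<Longrightarrow> \<alpha> \<one>\<^bsub>G\<^esub> x = x"
proof -
  assume x: "x \<in> carrier X"
  have "\<alpha> \<one>\<^bsub>G\<^esub> = \<one>\<^bsub>AutoGroup X\<^esub>"
    using algebraic unfolding algebraic_action_def by (metis group_hom.hom_one)
  then show ?thesis using x by (simp add: AutoGroup_def BijGroup_def)
qed

lemma act_inv_act [simp]: "g \<in> carrier G \<Longrightarrow> x \<in> carrier X \<Longrightarrow> \<alpha> (inv\<^bsub>G\<^esub> g) (\<alpha> g x) = x"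
  and act_act_inv [simp]: "g \<in> carrier G \<Longrightarrow> x \<in> carrier X \<Longrightarrow> \<alpha> g (\<alpha> (inv\<^bsub>G\<^esub> g) x) = x"
  by (simp_all flip: act_comp)

lemma act_one [simp]: "g \<in> carrier G \<Longrightarrow> \<alpha> g \<one> = \<one>"
  using act_mult [of g \<one> \<one>] act_closed [of g \<one>] by (metis l_cancel_one one_closed r_one)

lemma act_inv: "g \<in> carrier G \<Longrightarrow> x \<in> carrier X \<Longrightarrow> \<alpha> g (inv x) = inv (\<alpha> g x)"
  using act_mult [of g "inv x" x] by (metis act_closed act_one inv_closed inv_equality l_inv)

lemma act_nat_pow: "g \<in> carrier G \<Longrightarrow> x \<in> carrier X \<Longrightarrow> \<alpha> g (x [^] (n::nat)) = \<alpha> g x [^] n"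
  by (induction n) (simp_all add: act_mult)

abbreviation dact :: "'g \<Rightarrow> ('x \<Rightarrow> complex) \<Rightarrow> 'x \<Rightarrow> complex" where
  "dact \<equiv> dual_action G X \<alpha>"

lemma dact_apply [simp]: "x \<in> carrier X \<Longrightarrow> dact g \<phi> x = \<phi> (\<alpha> (inv\<^bsub>G\<^esub> g) x)"
  by (simp add: dual_action_def)

lemma dact_closed [simp, intro]:
  assumes g: "g \<in> carrier G" and \<phi>: "\<phi> \<in> carrier D"
  shows "dact g \<phi> \<in> carrier D"
proof -
  have "cont (\<lambda>x. \<phi> (\<alpha> (inv\<^bsub>G\<^esub> g) x))"
    using continuous_map_compose [OF act_cont dualD(1) [OF \<phi>], of "inv\<^bsub>G\<^esub> g"] g by (simp add: o_def)
  then have "unitary_character (\<lambda>x. \<phi> (\<alpha> (inv\<^bsub>G\<^esub> g) x))"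
    using dualD [OF \<phi>] g by (simp add: unitary_character_def act_mult)
  then show ?thesis unfolding dual_action_def by (rule restrict_in_dual)
qed

definition submodule :: "('x \<Rightarrow> complex) set \<Rightarrow> bool" where
  "submodule N \<longleftrightarrow> subgroup N D \<and> (\<forall>g\<in>carrier G. \<forall>\<phi>\<in>N. dact g \<phi> \<in> N)"

lemma submoduleI:
  assumes "N \<subseteq> carrier D" "\<one>\<^bsub>D\<^esub> \<in> N" "\<And>\<phi> \<psi>. \<phi> \<in> N \<Longrightarrow> \<psi> \<in> N \<Longrightarrow> \<phi> \<otimes>\<^bsub>D\<^esub> \<psi> \<in> N"
    "\<And>\<phi>. \<phi> \<in> N \<Longrightarrow> inv\<^bsub>D\<^esub> \<phi> \<in> N" "\<And>g \<phi>. g \<in> carrier G \<Longrightarrow> \<phi> \<in> N \<Longrightarrow> dact g \<phi> \<in> N"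
  shows "submodule N"
  using assms by (simp add: submodule_def subgroup_def)

lemma submoduleD:
  assumes "submodule N"
  shows "\<phi> \<in> N \<Longrightarrow> \<phi> \<in> carrier D" "\<one>\<^bsub>D\<^esub> \<in> N" "\<phi> \<in> N \<Longrightarrow> \<psi> \<in> N \<Longrightarrow> \<phi> \<otimes>\<^bsub>D\<^esub> \<psi> \<in> N"
    "\<phi> \<in> N \<Longrightarrow> inv\<^bsub>D\<^esub> \<phi> \<in> N" "g \<in> carrier G \<Longrightarrow> \<phi> \<in> N \<Longrightarrow> dact g \<phi> \<in> N"
  using assms by (auto simp: submodule_def subgroup_def)

text \<open>Every group element is a ring element, as the indicator of a singleton; conversely the
  ring acts by finite products of integer powers of translates. So stability under the group ring
  amounts to stability under \<open>G\<close>.\<close>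

lemma dual_submodule_iff: "dual_submodule G X T \<alpha> N \<longleftrightarrow> submodule N"
proof
  assume N: "dual_submodule G X T \<alpha> N"
  then have sub: "subgroup N D" by (simp add: dual_submodule_def)
  have "dact g \<phi> \<in> N" if g: "g \<in> carrier G" and \<phi>: "\<phi> \<in> N" for g \<phi>
  proof -
    let ?f = "\<lambda>h. if h = g then 1 else 0 :: int"
    have eq: "{h. ?f h \<noteq> 0} = {g}" by auto
    have "?f \<in> group_ring_elems G"
      unfolding group_ring_elems_def eq using g by auto
    then have "dual_smult G X T \<alpha> ?f \<phi> \<in> N"
      using N \<phi> by (simp add: dual_submodule_def)
    moreover have \<phi>D: "\<phi> \<in> carrier D" using subgroup.subset [OF sub] \<phi> by blast
    have "finprod D (\<lambda>h. dact h \<phi> [^]\<^bsub>D\<^esub> ?f h) (insert g {}) = dact g \<phi> [^]\<^bsub>D\<^esub> ?f g \<otimes>\<^bsub>D\<^esub> finprod D (\<lambda>h. dact h \<phi> [^]\<^bsub>D\<^esub> ?f h) {}"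
      using g \<phi>D by (intro D.finprod_insert) auto
    then have "dual_smult G X T \<alpha> ?f \<phi> = dact g \<phi>"
      unfolding dual_smult_def eq using g \<phi>D by simp
    ultimately show ?thesis by simp
  qed
  with sub show "submodule N" by (simp add: submodule_def)
next
  assume N: "submodule N"
  then have sub: "subgroup N D" by (simp add: submodule_def)
  have "dual_smult G X T \<alpha> f \<phi> \<in> N" if f: "f \<in> group_ring_elems G" and \<phi>: "\<phi> \<in> N" for f \<phi>
  proof -
    have pow: "dact g \<phi> [^]\<^bsub>D\<^esub> f g \<in> N" if "g \<in> carrier G" for g
      using D.subgroup_int_pow_closed [OF sub submoduleD(5) [OF N that \<phi>]] .
    have "finprod D (\<lambda>g. dact g \<phi> [^]\<^bsub>D\<^esub> f g) A \<in> N" if "finite A" "A \<subseteq> carrier G" for A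
      using that
    proof (induction rule: finite_induct)
      case empty
      show ?case using submoduleD(2) [OF N] by simp
    next
      case (insert g A)
      have "finprod D (\<lambda>g. dact g \<phi> [^]\<^bsub>D\<^esub> f g) (insert g A)
        = dact g \<phi> [^]\<^bsub>D\<^esub> f g \<otimes>\<^bsub>D\<^esub> finprod D (\<lambda>g. dact g \<phi> [^]\<^bsub>D\<^esub> f g) A"
        using insert pow submoduleD(1) [OF N] by (intro D.finprod_insert) auto
      then show ?case
        using insert pow submoduleD(3) [OF N] by simp
    qed
    then show ?thesis
      unfolding dual_smult_def using f by (simp add: group_ring_elems_def)
  qed
  with sub show "dual_submodule G X T \<alpha> N" by (simp add: dual_submodule_def)
qed

lemma noetherian_dual_iff:
  "noetherian_dual G X T \<alpha> \<longleftrightarrow> (\<forall>N. submodule N \<longrightarrow>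
     (\<exists>S. finite S \<and> S \<subseteq> N \<and> (\<forall>Q. submodule Q \<longrightarrow> S \<subseteq> Q \<longrightarrow> N \<subseteq> Q)))"
proof -
  have *: "N = dual_span G X T \<alpha> S \<longleftrightarrow> (\<forall>Q. submodule Q \<longrightarrow> S \<subseteq> Q \<longrightarrow> N \<subseteq> Q)" if "submodule N" "S \<subseteq> N" for N S
    unfolding dual_span_def dual_submodule_iff using that by blast
  show ?thesis
    unfolding noetherian_dual_def dual_submodule_iff
    by (intro all_cong1 imp_cong refl ex_cong1 conj_cong) (rule *)
qed

lemma submodule_whole: "submodule (carrier D)"
  by (rule submoduleI) auto

lemma submodule_Int: "submodule N \<Longrightarrow> submodule Q \<Longrightarrow> submodule (N \<inter> Q)"
  by (rule submoduleI) (auto simp: submoduleD)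

definition invariant_subgroup :: "'x set \<Rightarrow> bool" where
  "invariant_subgroup Y \<longleftrightarrow> subgroup Y X \<and> closedin T Y \<and> (\<forall>g\<in>carrier G. \<forall>y\<in>Y. \<alpha> g y \<in> Y)"

lemma submodule_annihilator:
  assumes "invariant_subgroup Y"
  shows "submodule (annihilator Y)"
proof -
  have Y: "\<And>y. y \<in> Y \<Longrightarrow> y \<in> carrier X" "\<And>g y. g \<in> carrier G \<Longrightarrow> y \<in> Y \<Longrightarrow> \<alpha> g y \<in> Y"
    using assms subgroup.subset unfolding invariant_subgroup_def by auto
  show ?thesis
    by (rule submoduleI) (auto simp: annihilator_def Y)
qed

text \<open>The annihilators increase and their union is a submodule. Its finitely many generators
  lie in one annihilator already, from which point on the annihilators, and by separation the
  subgroups, are constant.\<close>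

theorem descending_chain:
  assumes noeth: "noetherian_dual G X T \<alpha>" and Y: "\<And>n::nat. invariant_subgroup (Y n)"
    and dec: "\<And>n. Y (Suc n) \<subseteq> Y n"
  obtains n where "\<And>m. n \<le> m \<Longrightarrow> Y m = Y n"
proof -
  have mono: "Y m \<subseteq> Y n" if "n \<le> m" for m n
    using that by (induction rule: dec_induct) (use dec in auto)
  have anti: "annihilator (Y n) \<subseteq> annihilator (Y m)" if "n \<le> m" for m n
    using mono [OF that] by (auto simp: annihilator_def)
  define U where "U = (\<Union>n. annihilator (Y n))"
  have ann: "submodule (annihilator (Y n))" for n
    using submodule_annihilator Y by blast
  have subU: "submodule U"
  proof (rule submoduleI)
    fix \<phi> \<psi> assume "\<phi> \<in> U" "\<psi> \<in> U"
    then obtain m n where "\<phi> \<in> annihilator (Y m)" "\<psi> \<in> annihilator (Y n)"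
      unfolding U_def by blast
    then have "\<phi> \<in> annihilator (Y (max m n))" "\<psi> \<in> annihilator (Y (max m n))"
      using anti [of m "max m n"] anti [of n "max m n"] by auto
    then show "\<phi> \<otimes>\<^bsub>D\<^esub> \<psi> \<in> U" using submoduleD(3) [OF ann] unfolding U_def by blast
  next
    fix \<phi> assume "\<phi> \<in> U"
    then obtain n where n: "\<phi> \<in> annihilator (Y n)" unfolding U_def by blast
    show "inv\<^bsub>D\<^esub> \<phi> \<in> U" using submoduleD(4) [OF ann n] unfolding U_def by blast
    show "dact g \<phi> \<in> U" if "g \<in> carrier G" for g
      using submoduleD(5) [OF ann that n] unfolding U_def by blast
  next
    show "\<one>\<^bsub>D\<^esub> \<in> U" using submoduleD(2) [OF ann] unfolding U_def by blast
  qed (auto simp: U_def annihilator_def)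
  then obtain S where S: "finite S" "S \<subseteq> U" "\<forall>Q. submodule Q \<longrightarrow> S \<subseteq> Q \<longrightarrow> U \<subseteq> Q"
    using noeth [unfolded noetherian_dual_iff, rule_format, OF subU] by (elim exE conjE)
  have "\<exists>n. S \<subseteq> annihilator (Y n)"
    using S(1,2)
  proof (induction rule: finite_induct)
    case (insert \<phi> S)
    then obtain m n where "S \<subseteq> annihilator (Y m)" "\<phi> \<in> annihilator (Y n)"
      unfolding U_def by auto
    then have "insert \<phi> S \<subseteq> annihilator (Y (max m n))"
      using anti [of m "max m n"] anti [of n "max m n"] by auto
    then show ?case by blast
  qed auto
  then obtain n where n: "S \<subseteq> annihilator (Y n)" by blast
  have U: "U \<subseteq> annihilator (Y n)" using S(3) ann n by blast
  have "Y m = Y n" if "n \<le> m" for m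
  proof
    show "Y m \<subseteq> Y n" using mono that .
    have "annihilator (Y m) \<subseteq> annihilator (Y n)" using U U_def by blast
    moreover have "subgroup (Y m) X" "closedin T (Y m)" "Y n \<subseteq> carrier X"
      using Y [of m] Y [of n] subgroup.subset unfolding invariant_subgroup_def by blast+
    ultimately show "Y n \<subseteq> Y m"
      using subset_if_annihilator_subset [of "Y m" "Y n"] by blast
  qed
  from that [OF this] show ?thesis .
qed

end

section \<open>Equivariant homomorphisms and the transfer of the Noetherian property\<close>

locale equivariant_hom = A: alg_action X T G \<alpha> + B: alg_action X' T' G \<alpha>'
  for X :: "('x, 'n) monoid_scheme" and T and G :: "('g, 'm) monoid_scheme" and \<alpha>
    and X' :: "('y, 'k) monoid_scheme" and T' and \<alpha>' +
  fixes q :: "'x \<Rightarrow> 'y"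
  assumes q_hom: "q \<in> hom X X'"
    and q_cont: "continuous_map T T' q"
    and q_equiv: "g \<in> carrier G \<Longrightarrow> x \<in> carrier X \<Longrightarrow> q (\<alpha> g x) = \<alpha>' g (q x)"
begin

lemma q_closed [simp, intro]: "x \<in> carrier X \<Longrightarrow> q x \<in> carrier X'"
  and q_mult [simp]: "x \<in> carrier X \<Longrightarrow> y \<in> carrier X \<Longrightarrow> q (x \<otimes>\<^bsub>X\<^esub> y) = q x \<otimes>\<^bsub>X'\<^esub> q y"
  using q_hom by (auto simp: hom_def)

sublocale q: group_hom X X' q
  using q_hom by unfold_locales auto

definition pull :: "('y \<Rightarrow> complex) \<Rightarrow> 'x \<Rightarrow> complex" where
  "pull \<phi> = (\<lambda>x\<in>carrier X. \<phi> (q x))"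

lemma pull_apply [simp]: "x \<in> carrier X \<Longrightarrow> pull \<phi> x = \<phi> (q x)"
  by (simp add: pull_def)

lemma pull_closed [simp, intro]:
  assumes \<phi>: "\<phi> \<in> carrier B.D"
  shows "pull \<phi> \<in> carrier A.D"
proof -
  have "A.cont (\<lambda>x. \<phi> (q x))"
    using continuous_map_compose [OF q_cont B.dualD(1) [OF \<phi>]] by (simp add: o_def)
  then have "A.unitary_character (\<lambda>x. \<phi> (q x))"
    using B.dualD [OF \<phi>] by (simp add: A.unitary_character_def)
  then show ?thesis unfolding pull_def by (rule A.restrict_in_dual)
qed

lemma pull_one [simp]: "pull \<one>\<^bsub>B.D\<^esub> = \<one>\<^bsub>A.D\<^esub>"
  by (rule A.dual_eqI) auto

lemma pull_mult [simp]: "\<phi> \<in> carrier B.D \<Longrightarrow> \<psi> \<in> carrier B.D \<Longrightarrow>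
    pull (\<phi> \<otimes>\<^bsub>B.D\<^esub> \<psi>) = pull \<phi> \<otimes>\<^bsub>A.D\<^esub> pull \<psi>"
  by (rule A.dual_eqI) auto

lemma pull_inv [simp]: "\<phi> \<in> carrier B.D \<Longrightarrow> pull (inv\<^bsub>B.D\<^esub> \<phi>) = inv\<^bsub>A.D\<^esub> pull \<phi>"
  by (rule A.dual_eqI) auto

lemma pull_dact: "\<phi> \<in> carrier B.D \<Longrightarrow> g \<in> carrier G \<Longrightarrow> pull (B.dact g \<phi>) = A.dact g (pull \<phi>)"
  by (rule A.dual_eqI) (auto simp: q_equiv)

lemma submodule_preimage:
  assumes "A.submodule N"
  shows "B.submodule {\<phi> \<in> carrier B.D. pull \<phi> \<in> N}"
  by (rule B.submoduleI) (auto simp: A.submoduleD [OF assms] pull_dact)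

lemma submodule_image:
  assumes N: "B.submodule N"
  shows "A.submodule (pull ` N)"
proof (rule A.submoduleI)
  show "\<one>\<^bsub>A.D\<^esub> \<in> pull ` N"
    using B.submoduleD(2) [OF N] pull_one by (metis imageI)
  fix \<phi> assume "\<phi> \<in> pull ` N"
  then obtain \<phi>' where \<phi>: "\<phi> = pull \<phi>'" "\<phi>' \<in> N" "\<phi>' \<in> carrier B.D"
    using B.submoduleD(1) [OF N] by blast
  show "inv\<^bsub>A.D\<^esub> \<phi> \<in> pull ` N"
    using \<phi> B.submoduleD(4) [OF N] pull_inv by (metis imageI)
  fix g assume "g \<in> carrier G"
  then show "A.dact g \<phi> \<in> pull ` N"
    using \<phi> B.submoduleD(5) [OF N] pull_dact by (metis imageI)
next
  fix \<phi> \<psi> assume "\<phi> \<in> pull ` N" "\<psi> \<in> pull ` N"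
  then obtain \<phi>' \<psi>' where "\<phi> = pull \<phi>'" "\<phi>' \<in> N" "\<phi>' \<in> carrier B.D"
     "\<psi> = pull \<psi>'" "\<psi>' \<in> N" "\<psi>' \<in> carrier B.D"
    using B.submoduleD(1) [OF N] by blast
  then show "\<phi> \<otimes>\<^bsub>A.D\<^esub> \<psi> \<in> pull ` N"
    using B.submoduleD(3) [OF N] pull_mult by (metis imageI)
qed (use B.submoduleD(1) [OF N] in auto)

text \<open>The dual of \<open>X\<close> is here a quotient module of the dual of \<open>X'\<close>,
  and generators of the preimage of a submodule map to generators of it. For a closed subgroup the
  surjectivity is the extension of characters.\<close>

lemma noetherian_if_dual_surjective:
  assumes noeth: "noetherian_dual G X' T' \<alpha>'" and surj: "carrier A.D \<subseteq> pull ` carrier B.D"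
  shows "noetherian_dual G X T \<alpha>"
  unfolding A.noetherian_dual_iff
proof (intro allI impI)
  fix N assume N: "A.submodule N"
  let ?N = "{\<phi> \<in> carrier B.D. pull \<phi> \<in> N}"
  obtain S where S: "finite S" "S \<subseteq> ?N" "\<forall>Q. B.submodule Q \<longrightarrow> S \<subseteq> Q \<longrightarrow> ?N \<subseteq> Q"
    using noeth submodule_preimage [OF N] unfolding B.noetherian_dual_iff by meson
  have "N \<subseteq> Q" if Q: "A.submodule Q" "pull ` S \<subseteq> Q" for Q
  proof
    fix \<psi> assume "\<psi> \<in> N"
    moreover then obtain \<phi> where "\<phi> \<in> carrier B.D" "\<psi> = pull \<phi>"
      using surj A.submoduleD(1) [OF N] by blast
    moreover have "?N \<subseteq> {\<phi> \<in> carrier B.D. pull \<phi> \<in> Q}"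
      using S(2,3) submodule_preimage [OF Q(1)] Q(2) by blast
    ultimately show "\<psi> \<in> Q" by blast
  qed
  then show "\<exists>S. finite S \<and> S \<subseteq> N \<and> (\<forall>Q. A.submodule Q \<longrightarrow> S \<subseteq> Q \<longrightarrow> N \<subseteq> Q)"
    using S(1,2) by (intro exI [of _ "pull ` S"]) auto
qed

text \<open>Lifts of generators of the image, together with the finitely many kernel elements in
  \<open>N\<close>, generate \<open>N\<close>. A trivial kernel gives the case of quotients, a
  finite one that of finite extensions.\<close>

lemma noetherian_if_dual_finite_kernel:
  assumes noeth: "noetherian_dual G X T \<alpha>" and fin: "finite {\<phi> \<in> carrier B.D. pull \<phi> = \<one>\<^bsub>A.D\<^esub>}"
  shows "noetherian_dual G X' T' \<alpha>'"
  unfolding B.noetherian_dual_iff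
proof (intro allI impI)
  fix N assume N: "B.submodule N"
  let ?K = "{\<phi> \<in> carrier B.D. pull \<phi> = \<one>\<^bsub>A.D\<^esub>}"
  obtain S' where S': "finite S'" "S' \<subseteq> pull ` N" "\<forall>Q. A.submodule Q \<longrightarrow> S' \<subseteq> Q \<longrightarrow> pull ` N \<subseteq> Q"
    using noeth submodule_image [OF N] unfolding A.noetherian_dual_iff by meson
  obtain S where S: "S \<subseteq> N" "finite S" "S' = pull ` S"
    using finite_subset_image [OF S'(1,2)] by blast
  have "N \<subseteq> Q" if Q: "B.submodule Q" "S \<union> (N \<inter> ?K) \<subseteq> Q" for Q
  proof
    fix \<phi> assume \<phi>: "\<phi> \<in> N"
    have "pull ` N \<subseteq> pull ` (N \<inter> Q)"
      using S'(3) submodule_image [OF B.submodule_Int [OF N Q(1)]] S Q(2) by blast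
    then obtain \<psi> where \<psi>: "\<psi> \<in> N" "\<psi> \<in> Q" "pull \<phi> = pull \<psi>"
      using \<phi> by blast
    have D: "\<phi> \<in> carrier B.D" "\<psi> \<in> carrier B.D"
      using \<phi> \<psi> B.submoduleD(1) [OF N] by auto
    have "\<phi> \<otimes>\<^bsub>B.D\<^esub> inv\<^bsub>B.D\<^esub> \<psi> \<in> N"
      using \<phi> \<psi> B.submoduleD(3,4) [OF N] by blast
    moreover have "pull (\<phi> \<otimes>\<^bsub>B.D\<^esub> inv\<^bsub>B.D\<^esub> \<psi>) = \<one>\<^bsub>A.D\<^esub>"
      using D \<psi>(3) by simp
    ultimately have "\<phi> \<otimes>\<^bsub>B.D\<^esub> inv\<^bsub>B.D\<^esub> \<psi> \<in> Q"
      using Q(2) D by auto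
    then have "\<phi> \<otimes>\<^bsub>B.D\<^esub> inv\<^bsub>B.D\<^esub> \<psi> \<otimes>\<^bsub>B.D\<^esub> \<psi> \<in> Q"
      using \<psi> B.submoduleD(3) [OF Q(1)] by blast
    then show "\<phi> \<in> Q"
      using D by (simp add: B.D.m_assoc)
  qed
  then show "\<exists>S. finite S \<and> S \<subseteq> N \<and> (\<forall>Q. B.submodule Q \<longrightarrow> S \<subseteq> Q \<longrightarrow> N \<subseteq> Q)"
    using S fin by (intro exI [of _ "S \<union> (N \<inter> ?K)"]) auto
qed

lemma noetherian_image:
  assumes "noetherian_dual G X T \<alpha>" and surj: "q ` carrier X = carrier X'"
  shows "noetherian_dual G X' T' \<alpha>'"
proof (rule noetherian_if_dual_finite_kernel [OF assms(1)])
  have "\<phi> = \<one>\<^bsub>B.D\<^esub>" if "\<phi> \<in> carrier B.D" "pull \<phi> = \<one>\<^bsub>A.D\<^esub>" for \<phi>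
  proof (rule B.dual_eqI [OF that(1)])
    fix y assume "y \<in> carrier X'"
    then obtain x where "x \<in> carrier X" "y = q x" using surj by blast
    then show "\<phi> y = \<one>\<^bsub>B.D\<^esub> y"
      using that(2) by (metis A.dual_one B.dual_one pull_apply q_closed)
  qed auto
  then have "{\<phi> \<in> carrier B.D. pull \<phi> = \<one>\<^bsub>A.D\<^esub>} \<subseteq> {\<one>\<^bsub>B.D\<^esub>}" by blast
  then show "finite {\<phi> \<in> carrier B.D. pull \<phi> = \<one>\<^bsub>A.D\<^esub>}"
    using finite_subset by blast
qed

end

section \<open>Closed invariant subgroups\<close>

context alg_action
begin

abbreviation sub_group :: "'x set \<Rightarrow> ('x, 'n) monoid_scheme" where
  "sub_group Y \<equiv> X\<lparr>carrier := Y\<rparr>"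

definition sub_action :: "'x set \<Rightarrow> 'g \<Rightarrow> 'x \<Rightarrow> 'x" where
  "sub_action Y g = restrict (\<alpha> g) Y"

lemma sub_action_apply [simp]: "y \<in> Y \<Longrightarrow> sub_action Y g y = \<alpha> g y"
  by (simp add: sub_action_def)

lemma invariant_subgroupD:
  assumes "invariant_subgroup Y"
  shows "subgroup Y X" "closedin T Y" "y \<in> Y \<Longrightarrow> y \<in> carrier X"
    "g \<in> carrier G \<Longrightarrow> y \<in> Y \<Longrightarrow> \<alpha> g y \<in> Y"
  using assms subgroup.subset unfolding invariant_subgroup_def by blast+

lemma alg_action_sub:
  assumes Y: "invariant_subgroup Y"
  shows "alg_action (sub_group Y) (subtopology T Y) G (sub_action Y)"
proof -
  note Y' = invariant_subgroupD [OF Y]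
  have cm: "compact_metrizable_abelian_group (sub_group Y) (subtopology T Y)"
    using closed_subgroup_compact_metrizable Y' by blast
  have "algebraic_action G (sub_group Y) (subtopology T Y) (sub_action Y)"
  proof (rule algebraic_actionI [OF cm G.is_group])
    fix g assume g: "g \<in> carrier G"
    show "continuous_map (subtopology T Y) (subtopology T Y) (sub_action Y g)"
    proof (rule continuous_map_eq)
      show "continuous_map (subtopology T Y) (subtopology T Y) (\<alpha> g)"
        unfolding continuous_map_in_subtopology
        using continuous_map_from_subtopology [OF act_cont [OF g]] Y' g by auto
    qed auto
  qed (use Y' subgroup.m_closed [OF Y'(1)] in \<open>auto simp: sub_action_def act_mult act_comp\<close>)
  with cm show ?thesis
    by (simp add: alg_action_def alg_action_axioms_def compact_abelian_group_def)
qed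

lemma equivariant_hom_sub:
  assumes Y: "invariant_subgroup Y"
  shows "equivariant_hom (sub_group Y) (subtopology T Y) G (sub_action Y) X T \<alpha> (\<lambda>x. x)"
proof -
  have "continuous_map (subtopology T Y) T (\<lambda>x. x)"
    using continuous_map_from_subtopology [OF continuous_map_id [unfolded id_def]] .
  then show ?thesis
    using alg_action_sub [OF Y] alg_action_axioms invariant_subgroupD [OF Y]
    by (auto simp: equivariant_hom_def equivariant_hom_axioms_def hom_def)
qed

lemma noetherian_sub:
  assumes noeth: "noetherian_dual G X T \<alpha>" and Y: "invariant_subgroup Y"
  shows "noetherian_dual G (sub_group Y) (subtopology T Y) (sub_action Y)"
proof -
  interpret i: equivariant_hom "sub_group Y" "subtopology T Y" G "sub_action Y" X T \<alpha> "\<lambda>x. x"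
    by (rule equivariant_hom_sub [OF Y])
  note Y' = invariant_subgroupD [OF Y]
  have "\<phi> \<in> i.pull ` carrier D" if \<phi>: "\<phi> \<in> carrier i.A.D" for \<phi>
  proof -
    have "\<And>x y. x \<in> Y \<Longrightarrow> y \<in> Y \<Longrightarrow> \<phi> (x \<otimes> y) = \<phi> x * \<phi> y" "\<And>y. y \<in> Y \<Longrightarrow> norm (\<phi> y) = 1"
      using i.A.dualD(2,3) [OF \<phi>] by auto
    then obtain \<psi> where \<psi>: "unitary_character \<psi>" "\<And>y. y \<in> Y \<Longrightarrow> \<psi> y = \<phi> y"
      using character_extension [OF Y'(1,2) i.A.dualD(1) [OF \<phi>]] by metis
    have D: "restrict \<psi> (carrier X) \<in> carrier D"
      using restrict_in_dual [OF \<psi>(1)] .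
    have "\<phi> = i.pull (restrict \<psi> (carrier X))"
      by (rule i.A.dual_eqI [OF \<phi> i.pull_closed [OF D]]) (use \<psi>(2) Y'(3) in auto)
    with D show ?thesis by blast
  qed
  then show ?thesis
    by (intro i.noetherian_if_dual_surjective [OF noeth]) blast
qed

lemma closedin_equalizer:
  assumes "continuous_map T T f" "continuous_map T T h"
  shows "closedin T {x \<in> carrier X. f x = h x}"
  using closedin_continuous_maps_eq [OF Hausdorff assms] by simp

lemma cont_nat_pow: "continuous_map T T (\<lambda>x. x [^] (n::nat))"
proof (induction n)
  case (Suc n)
  then show ?case
    using continuous_map_mult2 [OF Suc.IH continuous_map_id [unfolded id_def]] by simp
qed simp

lemma invariant_torsion:
  assumes "invariant_subgroup Y"
  shows "invariant_subgroup {y \<in> Y. y [^] (n::nat) = \<one>}"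
  unfolding invariant_subgroup_def
proof (intro conjI)
  note Y' = invariant_subgroupD [OF assms]
  show "subgroup {y \<in> Y. y [^] n = \<one>} X"
    using Y' by unfold_locales
      (auto simp: nat_pow_distrib subgroup.m_closed subgroup.one_closed subgroup.m_inv_closed nat_pow_inv)
  have "{y \<in> Y. y [^] n = \<one>} = Y \<inter> {x \<in> carrier X. x [^] n = \<one>}" using Y' by auto
  then show "closedin T {y \<in> Y. y [^] n = \<one>}"
    using Y'(2) closedin_equalizer [OF cont_nat_pow continuous_map_const_in [OF one_closed]] by auto
  show "\<forall>g\<in>carrier G. \<forall>y\<in>{y \<in> Y. y [^] n = \<one>}. \<alpha> g y \<in> {y \<in> Y. y [^] n = \<one>}"
    using Y' by (auto simp flip: act_nat_pow)
qed

lemma invariant_power: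
  assumes "invariant_subgroup Y"
  shows "invariant_subgroup ((\<lambda>y. y [^] (n::nat)) ` Y)"
  unfolding invariant_subgroup_def
proof (intro conjI)
  note Y' = invariant_subgroupD [OF assms]
  show "subgroup ((\<lambda>y. y [^] n) ` Y) X"
  proof (rule subgroupI)
    fix a b assume "a \<in> (\<lambda>y. y [^] n) ` Y" "b \<in> (\<lambda>y. y [^] n) ` Y"
    then obtain y z where yz: "y \<in> Y" "z \<in> Y" "a = y [^] n" "b = z [^] n" by blast
    have "a \<otimes> b = (y \<otimes> z) [^] n" "inv a = (inv y) [^] n"
      using yz Y' by (simp_all add: nat_pow_distrib nat_pow_inv)
    then show "a \<otimes> b \<in> (\<lambda>y. y [^] n) ` Y" "inv a \<in> (\<lambda>y. y [^] n) ` Y"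
      using yz Y'(1) by (auto simp: subgroup.m_closed subgroup.m_inv_closed)
  qed (use Y' subgroup.one_closed [OF Y'(1)] in auto)
  have "compactin T Y" using closedin_compact_space [OF compact Y'(2)] .
  then have "compactin T ((\<lambda>y. y [^] n) ` Y)"
    using cont_nat_pow by (rule image_compactin)
  then show "closedin T ((\<lambda>y. y [^] n) ` Y)"
    by (rule compactin_imp_closedin [OF Hausdorff])
  show "\<forall>g\<in>carrier G. \<forall>y\<in>(\<lambda>y. y [^] n) ` Y. \<alpha> g y \<in> (\<lambda>y. y [^] n) ` Y"
    using Y' by (auto simp: act_nat_pow)
qed

lemma orbit_eq: "orbit G \<alpha> x = (\<lambda>g. \<alpha> g x) ` carrier G"
  by (auto simp: orbit_def)

lemma finite_action_periodic: "finite (\<alpha> ` carrier G) \<Longrightarrow> periodic_point G \<alpha> x"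
proof -
  assume "finite (\<alpha> ` carrier G)"
  then have "finite ((\<lambda>f. f x) ` \<alpha> ` carrier G)" by (rule finite_imageI)
  then show ?thesis by (simp add: periodic_point_def orbit_eq image_image)
qed

end

section \<open>Zero-dimensional groups\<close>

context compact_abelian_group
begin

text \<open>A character maps the component of \<open>\<one>\<close> onto a connected set of
  \<open>n\<close>-th roots of unity, which is a single point; and characters separate
  points.\<close>

lemma zero_dimensional_if_bounded_torsion:
  assumes n: "n > 0" and tors: "\<And>x. x \<in> carrier X \<Longrightarrow> x [^] (n::nat) = \<one>"
  shows "zero_dimensional X T"
proof -
  let ?C = "connected_component_of_set T \<one>"
  have "x = \<one>" if x: "x \<in> ?C" for x
  proof (rule ccontr)
    assume ne: "x \<noteq> \<one>"
    have CX: "?C \<subseteq> carrier X" using connected_component_of_subset_topspace by fastforce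
    obtain \<phi> where \<phi>: "\<phi> \<in> carrier D" "\<phi> x \<noteq> 1"
      using dual_separates_points [of x] x ne CX by blast
    have "connected (\<phi> ` ?C)"
      using connectedin_continuous_map_image [OF dualD(1) [OF \<phi>(1)] connectedin_connected_component_of]
      by simp
    moreover have "\<phi> y ^ n = 1" if "y \<in> ?C" for y
    proof -
      have y: "y \<in> carrier X" using CX that by blast
      show ?thesis using dual_apply_nat_pow [OF \<phi>(1) y, of n] tors [OF y] dualD(4) [OF \<phi>(1)] by simp
    qed
    then have roots: "\<phi> ` ?C \<subseteq> {z. z ^ n = 1}" by blast
    have "finite {z::complex. z ^ n = 1}"
      using finite_roots_unity [of n] n by simp
    with roots have "finite (\<phi> ` ?C)" by (rule finite_subset)
    moreover have "\<one> \<in> ?C"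
      by (simp add: connected_component_of_refl)
    ultimately obtain a where "\<phi> ` ?C = {a}"
      using connected_finite_iff_sing [of "\<phi> ` ?C"] by auto
    then have "\<phi> x = a" "\<phi> \<one> = a" using x \<open>\<one> \<in> ?C\<close> by auto
    then have "\<phi> x = \<phi> \<one>" by simp
    then show False using \<phi> dualD(4) by simp
  qed
  moreover have "\<one> \<in> ?C"
    by (simp add: connected_component_of_refl)
  ultimately show ?thesis
    unfolding zero_dimensional_def by blast
qed

text \<open>The circle has no small subgroups. As long as the real part is nonnegative, squaring at
  least doubles the defect \<open>1 - Re z\<close>, so repeated squaring would push it beyond
  \<open>1\<close>.\<close>

lemma unit_eq_1_if_powers_right:
  fixes z :: complex
  assumes "norm z = 1" "\<And>k::nat. 0 < Re (z ^ k)"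
  shows "z = 1"
proof (rule ccontr)
  assume "z \<noteq> 1"
  have Re1: "Re z < 1"
  proof (rule ccontr)
    assume "\<not> Re z < 1"
    then have "Re z = 1" using complex_Re_le_cmod [of z] assms(1) by simp
    moreover have "Im z = 0" using assms(1) \<open>Re z = 1\<close> by (simp add: cmod_def)
    ultimately show False using \<open>z \<noteq> 1\<close> by (simp add: complex_eq_iff)
  qed
  have "2 ^ k * (1 - Re z) \<le> 1 - Re (z ^ (2 ^ k))" for k :: nat
  proof (induction k)
    case (Suc k)
    let ?w = "z ^ (2 ^ k)"
    have "norm ?w = 1" using assms(1) by (simp add: norm_power)
    then have "(Re ?w)\<^sup>2 + (Im ?w)\<^sup>2 = 1" by (metis cmod_power2 power_one)
    moreover have "Re (?w\<^sup>2) = (Re ?w)\<^sup>2 - (Im ?w)\<^sup>2" by (simp add: power2_eq_square)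
    ultimately have eq: "1 - Re (?w\<^sup>2) = 2 * (1 - Re ?w) * (1 + Re ?w)"
      by (simp add: power2_eq_square algebra_simps)
    have "0 \<le> 1 - Re ?w" using complex_Re_le_cmod [of ?w] \<open>norm ?w = 1\<close> by simp
    then have "2 * (1 - Re ?w) * 1 \<le> 2 * (1 - Re ?w) * (1 + Re ?w)"
      using assms(2) [of "2 ^ k"] by (intro mult_left_mono) auto
    then have "2 * (1 - Re ?w) \<le> 1 - Re (?w\<^sup>2)" using eq by simp
    moreover have "?w\<^sup>2 = z ^ (2 ^ Suc k)" by (simp add: power_mult [symmetric] mult.commute)
    ultimately show ?case using Suc.IH by simp
  qed simp
  moreover obtain k where "1 / (1 - Re z) < 2 ^ k"
    using real_arch_pow [of 2 "1 / (1 - Re z)"] by auto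
  then have "1 < 2 ^ k * (1 - Re z)" using Re1 by (simp add: divide_less_eq)
  ultimately have "1 < 1 - Re (z ^ (2 ^ k))" by (meson less_le_trans)
  with assms(2) [of "2 ^ k"] show False by simp
qed

text \<open>Zero-dimensionality gives a clopen neighbourhood \<open>V\<close> of
  \<open>\<one>\<close> on which \<open>\<phi>\<close> has positive real part. Some neighbourhood
  \<open>U\<close> maps \<open>V\<close> into itself, so all powers of its elements stay in
  \<open>V\<close> and \<open>\<phi>\<close> is trivial on \<open>U\<close>. Finitely many
  translates of \<open>U\<close> cover, hence \<open>\<phi>\<close> takes finitely many
  values.\<close>

lemma character_finite_order:
  assumes zd: "zero_dimensional X T" and \<phi>: "\<phi> \<in> carrier D"
  obtains n where "n > 0" "\<And>x. x \<in> carrier X \<Longrightarrow> \<phi> x ^ n = 1"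
proof -
  define W where "W = {x \<in> carrier X. \<phi> x \<in> {z. 0 < Re z}}"
  have W: "openin T W"
    using openin_continuous_map_preimage [OF dualD(1) [OF \<phi>], of "{z. 0 < Re z}"]
    by (simp add: W_def open_halfspace_Re_gt)
  have oneW: "{\<one>} \<subseteq> W" using dualD(4) [OF \<phi>] by (simp add: W_def)
  have "{\<one>} \<in> connected_components_of T"
    using zd connected_component_in_connected_components_of [of T \<one>]
    unfolding zero_dimensional_def by simp
  moreover have "locally_compact_space T"
    using compact compact_imp_locally_compact_space by blast
  ultimately obtain V V' where V: "openin T V" "openin T V'" "disjnt V V'" "V \<union> V' = topspace T" "{\<one>} \<subseteq> V" "V \<subseteq> W"
    using wilder_locally_compact_component_thm [of T "{\<one>}" W] Hausdorff W oneW by auto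
  \<comment> \<open>The indicator of a clopen set is continuous. Its uniform continuity with
    tolerance \<open>1\<close> means that multiplication by \<open>U\<close> never leads out of
    \<open>V\<close>.\<close>
  have "cont (\<lambda>x. if x \<in> V then 1 else 0)"
    unfolding continuous_map_def
  proof (intro conjI allI impI)
    fix A :: "complex set"
    have "{x \<in> topspace T. (if x \<in> V then 1 else 0) \<in> A} = (if 1 \<in> A then V else {}) \<union> (if 0 \<in> A then V' else {})"
      using V(3,4) openin_subset [OF V(1)] openin_subset [OF V(2)] unfolding disjnt_iff by (auto split: if_splits)
    moreover have "openin T ((if 1 \<in> A then V else {}) \<union> (if 0 \<in> A then V' else {}))"
      using V(1,2) by (intro openin_Un) auto
    ultimately show "openin T {x \<in> topspace T. (if x \<in> V then 1 else 0) \<in> A}"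
      by (simp only:)
  qed auto
  then obtain U where U: "openin T U" "\<one> \<in> U"
    "\<And>x u. x \<in> carrier X \<Longrightarrow> u \<in> U \<Longrightarrow> norm ((if x \<otimes> u \<in> V then 1 else 0) - (if x \<in> V then 1 else 0 :: complex)) < 1"
    using cont_uniform [of "\<lambda>x. if x \<in> V then 1 else 0" 1] by auto
  have step: "x \<otimes> u \<in> V" if "x \<in> V" "u \<in> U" for x u
    using U(3) [of x u] that openin_subset [OF V(1)] by (auto split: if_splits)
  have UX: "u \<in> carrier X" if "u \<in> U" for u using openin_subset [OF U(1)] that by auto
  have triv: "\<phi> u = 1" if u: "u \<in> U" for u
  proof (rule unit_eq_1_if_powers_right)
    show "norm (\<phi> u) = 1" using dualD(3) [OF \<phi> UX [OF u]] .
    fix k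
    have "u [^] (k::nat) \<in> V"
    proof (induction k)
      case (Suc k)
      then show ?case using step [OF Suc u] by simp
    qed (use V in simp)
    then have "0 < Re (\<phi> (u [^] k))" using V(6) by (auto simp: W_def)
    then show "0 < Re (\<phi> u ^ k)" using dual_apply_nat_pow [OF \<phi> UX [OF u]] by simp
  qed
  obtain E where E: "finite E" "E \<subseteq> carrier X" "\<And>z. z \<in> carrier X \<Longrightarrow> \<exists>d\<in>E. inv d \<otimes> z \<in> U"
    using finite_translates_cover [OF U(1,2)] by metis
  have "\<phi> ` carrier X \<subseteq> \<phi> ` E"
  proof (rule image_subsetI)
    fix z assume z: "z \<in> carrier X"
    obtain d where d: "d \<in> E" "inv d \<otimes> z \<in> U" using E(3) z by blast
    have dX: "d \<in> carrier X" using d E by blast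
    have "\<phi> (d \<otimes> (inv d \<otimes> z)) = \<phi> d"
      using triv [OF d(2)] dualD(2) [OF \<phi> dX UX [OF d(2)]] by simp
    then show "\<phi> z \<in> \<phi> ` E" using mult_inv_cancel [OF dX z] d(1) by (metis imageI)
  qed
  then have fin: "finite (\<phi> ` carrier X)" using E(1) finite_surj by blast
  define N where "N = card (\<phi> ` carrier X)"
  \<comment> \<open>Two of the \<open>N + 1\<close> powers with exponents up to \<open>N\<close>
    coincide, so the order of \<open>\<phi> x\<close> is at most \<open>N\<close>; the factorial is
    a multiple of every such order and independent of \<open>x\<close>.\<close>
  have "\<phi> x ^ fact N = 1" if x: "x \<in> carrier X" for x
  proof -
    have "\<not> inj_on (\<lambda>k. \<phi> x ^ k) {..N}"
    proof
      assume "inj_on (\<lambda>k. \<phi> x ^ k) {..N}"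
      moreover have "(\<lambda>k. \<phi> x ^ k) ` {..N} \<subseteq> \<phi> ` carrier X"
        using dual_apply_nat_pow [OF \<phi> x] x by (metis image_eqI image_subsetI nat_pow_closed)
      ultimately have "card {..N} \<le> card (\<phi> ` carrier X)"
        using card_inj_on_le fin by blast
      then show False by (simp add: N_def)
    qed
    then obtain i j where ij: "i < j" "j \<le> N" "\<phi> x ^ i = \<phi> x ^ j"
      by (auto simp: inj_on_def) (metis nat_neq_iff)
    have "\<phi> x ^ i * \<phi> x ^ (j - i) = \<phi> x ^ j"
      using ij(1) by (simp flip: power_add)
    then have "\<phi> x ^ i * \<phi> x ^ (j - i) = \<phi> x ^ i * 1"
      using ij(3) by simp
    then have 1: "\<phi> x ^ (j - i) = 1" using dual_nonzero [OF \<phi> x] by simp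
    have "(j - i) dvd fact N" using ij by (intro dvd_fact) auto
    then obtain k where "fact N = (j - i) * k" by (auto simp: dvd_def)
    then show ?thesis using 1 by (simp add: power_mult)
  qed
  then show ?thesis using that [of "fact N"] by simp
qed

end

text \<open>A common multiple of the orders of finitely many generators kills the whole dual, since
  the characters killed by it form a submodule. By separation it then kills
  \<open>X\<close>.\<close>

lemma (in alg_action) zero_dimensional_bounded_torsion:
  assumes noeth: "noetherian_dual G X T \<alpha>" and zd: "zero_dimensional X T"
  obtains n :: nat where "n > 0" "\<And>x. x \<in> carrier X \<Longrightarrow> x [^] n = \<one>"
proof -
  obtain S where S: "finite S" "S \<subseteq> carrier D" "\<forall>Q. submodule Q \<longrightarrow> S \<subseteq> Q \<longrightarrow> carrier D \<subseteq> Q"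
    using noeth [unfolded noetherian_dual_iff, rule_format, OF submodule_whole] by (elim exE conjE)
  have "\<exists>n>0. \<forall>\<phi>\<in>S. \<forall>x\<in>carrier X. \<phi> x ^ n = 1"
    using S(1,2)
  proof (induction rule: finite_induct)
    case (insert \<phi> S)
    then obtain n where n: "n > 0" "\<forall>\<phi>\<in>S. \<forall>x\<in>carrier X. \<phi> x ^ n = 1" by auto
    obtain m where m: "m > 0" "\<And>x. x \<in> carrier X \<Longrightarrow> \<phi> x ^ m = 1"
      using character_finite_order [OF zd] insert.prems by auto
    have "\<forall>\<psi>\<in>insert \<phi> S. \<forall>x\<in>carrier X. \<psi> x ^ (m * n) = 1"
      using n m by (auto simp: power_mult) (metis mult.commute power_mult power_one)
    then show ?case using n m by (intro exI [of _ "m * n"]) simp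
  qed auto
  then obtain n where n: "n > 0" "\<forall>\<phi>\<in>S. \<forall>x\<in>carrier X. \<phi> x ^ n = 1" by blast
  let ?Q = "{\<phi> \<in> carrier D. \<forall>x\<in>carrier X. \<phi> x ^ n = 1}"
  have "submodule ?Q"
    by (rule submoduleI) (auto simp: power_mult_distrib simp flip: complex_cnj_power)
  then have Q: "carrier D \<subseteq> ?Q" using S(2,3) n by blast
  have "x [^] n = \<one>" if x: "x \<in> carrier X" for x
  proof (rule ccontr)
    assume "x [^] n \<noteq> \<one>"
    then obtain \<phi> where \<phi>: "\<phi> \<in> carrier D" "\<phi> (x [^] n) \<noteq> 1"
      using dual_separates_points [of "x [^] n"] x by auto
    then show False using Q x dual_apply_nat_pow by auto
  qed
  then show ?thesis using that n by blast
qed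

section \<open>Torsion points of actions of finite groups\<close>

text \<open>Moving one generator at a time from \<open>S\<close> into the subgroup reduces the claim
  to a divisible group that is cyclic modulo \<open>H\<close>, and such a quotient is
  trivial.\<close>

lemma (in comm_group) finitely_generated_divisible:
  assumes S: "finite S" "S \<subseteq> carrier G" and H: "subgroup H G" and gen: "carrier G = generate G (H \<union> S)"
    and div: "\<And>x n. x \<in> carrier G \<Longrightarrow> n > 0 \<Longrightarrow> \<exists>y\<in>carrier G. y [^] (n::nat) = x"
  shows "H = carrier G"
  using S H gen
proof (induction arbitrary: H rule: finite_induct)
  case empty
  then show ?case using generate_subgroup_incl [of H H] generate.incl subgroup.subset by fastforce
next
  case (insert a S)
  have a: "a \<in> carrier G" using insert by auto
  have HG: "\<And>h. h \<in> H \<Longrightarrow> h \<in> carrier G" using subgroup.subset [OF insert.prems(2)] by blast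
  let ?H = "{h \<otimes> a [^] (k::int) | h k. h \<in> H}"
  note Hc = subgroup.m_closed [OF insert.prems(2)] subgroup.m_inv_closed [OF insert.prems(2)]
    subgroup.one_closed [OF insert.prems(2)]
  have sub: "subgroup ?H G"
  proof (rule subgroupI)
    show "?H \<subseteq> carrier G" using HG a by auto
    show "?H \<noteq> {}" using Hc by auto
    fix x assume "x \<in> ?H"
    then obtain h and k :: int where x: "x = h \<otimes> a [^] k" "h \<in> H" by blast
    have "inv x = inv h \<otimes> a [^] (- k)"
      using x HG a by (simp add: inv_mult int_pow_neg)
    then show "inv x \<in> ?H" using x Hc by blast
    fix y assume "y \<in> ?H"
    then obtain h' and l :: int where y: "y = h' \<otimes> a [^] l" "h' \<in> H" by blast
    have "x \<otimes> y = (h \<otimes> h') \<otimes> a [^] (k + l)"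
      using x y HG a by (simp add: int_pow_mult m_ac)
    then show "x \<otimes> y \<in> ?H" using x y Hc by blast
  qed
  have incl: "H \<subseteq> ?H" "a \<in> ?H"
  proof -
    have "h = h \<otimes> a [^] (0::int)" if "h \<in> H" for h using that HG a by simp
    then show "H \<subseteq> ?H" by blast
    have "a = \<one> \<otimes> a [^] (1::int)" using a by simp
    then show "a \<in> ?H" using Hc by blast
  qed
  have "carrier G \<subseteq> generate G (?H \<union> S)"
    unfolding insert.prems(3) using incl
    by (intro mono_generate) auto
  moreover have "generate G (?H \<union> S) \<subseteq> carrier G"
    using subgroup.subset [OF sub] insert.prems(1) by (intro generate_incl) auto
  ultimately have "carrier G = generate G (?H \<union> S)" by (rule equalityI)
  with insert.prems(1) have whole: "?H = carrier G"
    by (intro insert.IH sub) simp_all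
  \<comment> \<open>Halving \<open>a\<close> shows that the power with exponent
    \<open>1 - 2 * k\<close>, which is odd and therefore nonzero, lies in \<open>H\<close>. Dividing
    \<open>a\<close> by the absolute value of this exponent then puts \<open>a\<close> itself into
    \<open>H\<close>.\<close>
  obtain b where b: "b \<in> carrier G" "b [^] (2::nat) = a" using div [OF a, of 2] by auto
  obtain h and k :: int where hk: "b = h \<otimes> a [^] k" "h \<in> H" using b(1) unfolding whole [symmetric] by blast
  have "a = (h \<otimes> h) \<otimes> a [^] (2 * k)"
    using b hk HG a by (simp add: numeral_2_eq_2 m_ac flip: int_pow_mult)
  moreover have "a = a [^] (1 - 2 * k) \<otimes> a [^] (2 * k)"
    using a by (simp flip: int_pow_mult)
  ultimately have "a [^] (1 - 2 * k) = h \<otimes> h"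
    using a HG hk by (metis int_pow_closed m_closed right_cancel)
  then have "a [^] (1 - 2 * k) \<in> H" using Hc hk by simp
  moreover have "a [^] (- (1 - 2 * k)) = inv (a [^] (1 - 2 * k))" using a by (rule int_pow_neg)
  ultimately have pm: "a [^] (1 - 2 * k) \<in> H" "a [^] (- (1 - 2 * k)) \<in> H" using Hc by simp_all
  define d where "d = nat \<bar>1 - 2 * k\<bar>"
  have "1 - 2 * k \<noteq> 0" by presburger
  then have d: "d > 0" "a [^] d \<in> H"
    using pm by (auto simp: d_def int_pow_int [symmetric] abs_if split: if_splits)
  obtain c where c: "c \<in> carrier G" "c [^] d = a" using div [OF a d(1)] by auto
  obtain h' and l :: int where hl: "c = h' \<otimes> a [^] l" "h' \<in> H" using c(1) unfolding whole [symmetric] by blast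
  have "a = h' [^] d \<otimes> (a [^] d) [^] l"
  proof -
    have "(a [^] l) [^] d = (a [^] d) [^] l"
      using a by (simp add: int_pow_pow mult.commute flip: int_pow_int)
    then show ?thesis using c hl HG a by (simp add: nat_pow_distrib)
  qed
  moreover have "h' [^] d \<in> H" using hl(2) insert.prems(2) subgroup_int_pow_closed [of H h' "int d"] by (simp add: int_pow_int)
  moreover have "(a [^] d) [^] l \<in> H" using d(2) insert.prems(2) subgroup_int_pow_closed by blast
  ultimately have aH: "a \<in> H" using Hc by metis
  have "?H \<subseteq> H"
    using aH insert.prems(2) subgroup_int_pow_closed Hc by blast
  with whole show ?case using HG by blast
qed

lemma finite_image_factor:
  assumes "finite (f ` A)" "\<And>a b. a \<in> A \<Longrightarrow> b \<in> A \<Longrightarrow> f a = f b \<Longrightarrow> h a = h b"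
  shows "finite (h ` A)"
proof (rule finite_subset)
  show "h ` A \<subseteq> (\<lambda>r. h (inv_into A f r)) ` (f ` A)"
  proof (rule image_subsetI)
    fix a assume a: "a \<in> A"
    then have "h a = h (inv_into A f (f a))"
      using inv_into_into [of "f a" f A] f_inv_into_f [of "f a" f A] by (intro assms(2)) auto
    then show "h a \<in> (\<lambda>r. h (inv_into A f r)) ` (f ` A)" using a by blast
  qed
qed (use assms(1) in simp)

context alg_action
begin

text \<open>Without torsion the power map is a homeomorphism onto the closed subgroup of
  \<open>n\<close>-th powers. On that subgroup the map sending \<open>x [^] n\<close> to
  \<open>\<phi> x\<close> is a character, and any extension of it to \<open>X\<close> is an
  \<open>n\<close>-th root of \<open>\<phi>\<close>.\<close>

lemma dual_divisible_if_torsion_free: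
  assumes tf: "\<forall>x\<in>carrier X. \<forall>n>0. x [^] (n::nat) = \<one> \<longrightarrow> x = \<one>"
    and \<phi>: "\<phi> \<in> carrier D" and n: "n > 0"
  obtains \<psi> where "\<psi> \<in> carrier D" "\<psi> [^]\<^bsub>D\<^esub> (n::nat) = \<phi>"
proof -
  let ?p = "\<lambda>x. x [^] n"
  let ?P = "?p ` carrier X"
  have whole: "invariant_subgroup (carrier X)"
    using subgroup_self closedin_topspace [of T] by (auto simp: invariant_subgroup_def)
  have P: "invariant_subgroup ?P" using invariant_power [OF whole] .
  note P' = invariant_subgroupD [OF P]
  have inj: "inj_on ?p (carrier X)"
  proof (rule inj_onI)
    fix x y assume xy: "x \<in> carrier X" "y \<in> carrier X" "x [^] n = y [^] n"
    then have "(x \<otimes> inv y) [^] n = \<one>" by (simp add: nat_pow_distrib nat_pow_inv)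
    then have "x \<otimes> inv y = \<one>" using tf xy n by simp
    then show "x = y" using xy by (metis inv_equality inv_inv inv_closed)
  qed
  define r where "r = inv_into (carrier X) ?p"
  have r: "r (x [^] n) = x" if "x \<in> carrier X" for x
    unfolding r_def using inv_into_f_f [OF inj that] by simp
  have "homeomorphic_map T (subtopology T ?P) ?p"
  proof (rule continuous_imp_homeomorphic_map)
    show "continuous_map T (subtopology T ?P) ?p"
      using cont_nat_pow by (simp add: continuous_map_in_subtopology)
    show "Hausdorff_space (subtopology T ?P)" using Hausdorff Hausdorff_space_subtopology by blast
    show "?p ` topspace T = topspace (subtopology T ?P)" using P'(3) by auto
  qed (use compact inj in simp_all)
  then obtain s where s: "homeomorphic_maps T (subtopology T ?P) ?p s"
    using homeomorphic_map_maps by blast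
  have rs: "r y = s y" if "y \<in> ?P" for y
    using that s r by (auto simp: homeomorphic_maps_def)
  have "continuous_map (subtopology T ?P) T s" using s by (simp add: homeomorphic_maps_def)
  then have "continuous_map (subtopology T ?P) T r"
    by (rule continuous_map_eq) (use rs in auto)
  then have cont: "continuous_map (subtopology T ?P) euclidean (\<lambda>y. \<phi> (r y))"
    using continuous_map_compose [OF _ dualD(1) [OF \<phi>]] by (force simp: o_def)
  have "\<phi> (r (x \<otimes> y)) = \<phi> (r x) * \<phi> (r y)" if "x \<in> ?P" "y \<in> ?P" for x y
  proof -
    obtain u v where uv: "u \<in> carrier X" "v \<in> carrier X" "x = u [^] n" "y = v [^] n" using \<open>x \<in> ?P\<close> \<open>y \<in> ?P\<close> by blast
    then have "r (x \<otimes> y) = u \<otimes> v" using r [of "u \<otimes> v"] by (simp add: nat_pow_distrib)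
    then show ?thesis using uv r dualD(2) [OF \<phi>] by simp
  qed
  moreover have "norm (\<phi> (r y)) = 1" if "y \<in> ?P" for y
    using that r dualD(3) [OF \<phi>] by auto
  ultimately obtain \<psi> where \<psi>: "unitary_character \<psi>" "\<And>y. y \<in> ?P \<Longrightarrow> \<psi> y = \<phi> (r y)"
    using character_extension [OF P'(1,2) cont] by metis
  have D: "restrict \<psi> (carrier X) \<in> carrier D" using restrict_in_dual [OF \<psi>(1)] .
  have "restrict \<psi> (carrier X) [^]\<^bsub>D\<^esub> n = \<phi>"
  proof (rule dual_eqI [OF _ \<phi>])
    fix x assume x: "x \<in> carrier X"
    have "(restrict \<psi> (carrier X) [^]\<^bsub>D\<^esub> n) x = restrict \<psi> (carrier X) (x [^] n)"
      using dual_nat_pow [OF D x] dual_apply_nat_pow [OF D x] by simp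
    also have "\<dots> = \<phi> x" using \<psi>(2) r x by simp
    finally show "(restrict \<psi> (carrier X) [^]\<^bsub>D\<^esub> n) x = \<phi> x" .
  qed (use D in simp)
  with D that show ?thesis by blast
qed

text \<open>Finitely many automorphisms turn finitely many module generators of the dual into
  finitely many group generators. Without torsion the dual would be divisible too, hence
  trivial.\<close>

lemma finite_action_torsion_point:
  assumes noeth: "noetherian_dual G X T \<alpha>" and fin: "finite (\<alpha> ` carrier G)" and ne: "carrier X \<noteq> {\<one>}"
  obtains z and n :: nat where "z \<in> carrier X" "z \<noteq> \<one>" "n > 0" "z [^] n = \<one>"
proof (rule ccontr)
  assume "\<not> thesis"
  then have tf: "\<forall>x\<in>carrier X. \<forall>n>0. x [^] (n::nat) = \<one> \<longrightarrow> x = \<one>"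
    using that by blast
  obtain S where S: "finite S" "S \<subseteq> carrier D" "\<forall>Q. submodule Q \<longrightarrow> S \<subseteq> Q \<longrightarrow> carrier D \<subseteq> Q"
    using noeth [unfolded noetherian_dual_iff, rule_format, OF submodule_whole] by (elim exE conjE)
  define S' where "S' = (\<Union>\<phi>\<in>S. (\<lambda>g. dact g \<phi>) ` carrier G)"
  have "finite ((\<lambda>g. dact g \<phi>) ` carrier G)" for \<phi>
  proof -
    have "(\<lambda>g. dact g \<phi>) ` carrier G \<subseteq> (\<lambda>f. \<lambda>x\<in>carrier X. \<phi> (f x)) ` \<alpha> ` carrier G"
      unfolding dual_action_def by auto
    then show ?thesis using fin finite_subset finite_imageI by meson
  qed
  then have finS': "finite S'" using S(1) by (simp add: S'_def)
  have S'D: "S' \<subseteq> carrier D" using S(2) by (auto simp: S'_def)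
  have dact_comp: "dact g (dact h \<phi>) = dact (g \<otimes>\<^bsub>G\<^esub> h) \<phi>" if "g \<in> carrier G" "h \<in> carrier G" "\<phi> \<in> carrier D" for g h \<phi>
    using that by (intro dual_eqI) (auto simp: G.inv_mult_group act_comp)
  have SS': "S \<subseteq> S'"
  proof
    fix \<phi> assume "\<phi> \<in> S"
    moreover have "dact \<one>\<^bsub>G\<^esub> \<phi> = \<phi>"
      using \<open>\<phi> \<in> S\<close> S(2) by (intro dual_eqI) auto
    ultimately show "\<phi> \<in> S'" unfolding S'_def by (metis G.one_closed UN_iff imageI)
  qed
  have inv: "dact g \<phi> \<in> generate D S'" if "g \<in> carrier G" "\<phi> \<in> generate D S'" for g \<phi>
    using that(2)
  proof (induction rule: generate.induct)
    case one
    have "dact g \<one>\<^bsub>D\<^esub> = \<one>\<^bsub>D\<^esub>" using that(1) by (intro dual_eqI) auto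
    then show ?case using generate.one by metis
  next
    case (incl \<phi>)
    then obtain h \<psi> where h: "h \<in> carrier G" "\<psi> \<in> S" "\<phi> = dact h \<psi>" unfolding S'_def by blast
    then have "dact g \<phi> = dact (g \<otimes>\<^bsub>G\<^esub> h) \<psi>" using dact_comp that(1) S(2) by auto
    then have "dact g \<phi> \<in> S'" unfolding S'_def using h that(1) by blast
    then show ?case by (rule generate.incl)
  next
    case (inv \<phi>)
    then obtain h \<psi> where h: "h \<in> carrier G" "\<psi> \<in> S" "\<phi> = dact h \<psi>" unfolding S'_def by blast
    then have "dact g \<phi> = dact (g \<otimes>\<^bsub>G\<^esub> h) \<psi>" using dact_comp that(1) S(2) by auto
    then have 1: "dact g \<phi> \<in> S'" unfolding S'_def using h that(1) by blast
    have "dact g (inv\<^bsub>D\<^esub> \<phi>) = inv\<^bsub>D\<^esub> dact g \<phi>"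
      using that(1) inv S'D by (intro dual_eqI) auto
    then show ?case using generate.inv [OF 1] by metis
  next
    case (eng \<phi> \<psi>)
    have "\<phi> \<in> carrier D" "\<psi> \<in> carrier D"
      using eng.hyps D.generate_incl [OF S'D] by auto
    then have "dact g (\<phi> \<otimes>\<^bsub>D\<^esub> \<psi>) = dact g \<phi> \<otimes>\<^bsub>D\<^esub> dact g \<psi>"
      using that(1) by (intro dual_eqI) auto
    then show ?case using generate.eng [OF eng.IH] by metis
  qed
  have "submodule (generate D S')"
    using D.generate_is_subgroup [OF S'D] inv by (simp add: submodule_def)
  moreover have "S \<subseteq> generate D S'" using SS' by (auto intro: generate.incl)
  ultimately have gen: "carrier D = generate D ({\<one>\<^bsub>D\<^esub>} \<union> S')"
    using S(3) D.generate_incl [OF S'D] D.generate_incl [of "{\<one>\<^bsub>D\<^esub>} \<union> S'"] S'D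
      D.mono_generate [of S' "{\<one>\<^bsub>D\<^esub>} \<union> S'"] by blast
  have "{\<one>\<^bsub>D\<^esub>} = carrier D"
  proof (rule D.finitely_generated_divisible [OF finS' S'D D.triv_subgroup gen])
    fix \<phi> and n :: nat assume "\<phi> \<in> carrier D" "n > 0"
    then show "\<exists>\<psi>\<in>carrier D. \<psi> [^]\<^bsub>D\<^esub> n = \<phi>"
      using dual_divisible_if_torsion_free [OF tf] by metis
  qed
  moreover obtain x where x: "x \<in> carrier X" "x \<noteq> \<one>" using ne by blast
  ultimately show False
    using dual_separates_points [OF x] by (metis dual_one singletonD)
qed

theorem periodic_torsion_point:
  assumes noeth: "noetherian_dual G X T \<alpha>" and x: "x \<in> carrier X" "x \<noteq> \<one>" "periodic_point G \<alpha> x"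
  obtains z and n :: nat where "z \<in> carrier X" "z \<noteq> \<one>" "periodic_point G \<alpha> z" "n > 0" "z [^] n = \<one>"
proof -
  define R where "R = orbit G \<alpha> x"
  have R: "finite R" "R \<subseteq> carrier X" "x \<in> R"
    using x by (auto simp: R_def periodic_point_def orbit_eq intro!: image_eqI [of _ _ "\<one>\<^bsub>G\<^esub>"])
  have R_inv: "\<alpha> g p \<in> R" if "g \<in> carrier G" "p \<in> R" for g p
    using that x by (auto simp: R_def orbit_eq simp flip: act_comp)
  \<comment> \<open>Fixing the whole orbit instead of \<open>x\<close> alone makes \<open>L\<close>
    normal, and so the group \<open>Z\<close> of its fixed points invariant under
    \<open>G\<close>.\<close>
  define L where "L = {g \<in> carrier G. \<forall>p\<in>R. \<alpha> g p = p}"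
  define Z where "Z = {z \<in> carrier X. \<forall>g\<in>L. \<alpha> g z = z}"
  have conj: "inv\<^bsub>G\<^esub> h \<otimes>\<^bsub>G\<^esub> g \<otimes>\<^bsub>G\<^esub> h \<in> L" if "g \<in> L" "h \<in> carrier G" for g h
    using that R_inv R(2) by (auto simp: L_def act_comp subset_iff)
  have Z: "invariant_subgroup Z"
    unfolding invariant_subgroup_def
  proof (intro conjI ballI)
    show "subgroup Z X"
      by (rule subgroupI) (auto simp: Z_def L_def act_mult act_inv intro!: exI [of _ \<one>])
    have oneL: "\<one>\<^bsub>G\<^esub> \<in> L" using R(2) by (auto simp: L_def)
    then have eq: "Z = (\<Inter>g\<in>L. {z \<in> carrier X. \<alpha> g z = z})" by (auto simp: Z_def)
    have "closedin T {z \<in> carrier X. \<alpha> g z = z}" if "g \<in> L" for g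
    proof (rule closedin_equalizer)
      show "continuous_map T T (\<alpha> g)" using act_cont that by (simp add: L_def)
      show "continuous_map T T (\<lambda>z. z)" by (rule continuous_map_id [unfolded id_def])
    qed
    then show "closedin T Z"
      unfolding eq using oneL by (intro closedin_INT) auto
    fix h z assume h: "h \<in> carrier G" and z: "z \<in> Z"
    have zX: "z \<in> carrier X" using z by (simp add: Z_def)
    have "\<alpha> g (\<alpha> h z) = \<alpha> h z" if g: "g \<in> L" for g
    proof -
      have gG: "g \<in> carrier G" using g by (simp add: L_def)
      have "\<alpha> (inv\<^bsub>G\<^esub> h \<otimes>\<^bsub>G\<^esub> g \<otimes>\<^bsub>G\<^esub> h) z = z" using conj [OF g h] z by (simp add: Z_def)
      then have "\<alpha> (inv\<^bsub>G\<^esub> h) (\<alpha> g (\<alpha> h z)) = z" using gG h zX by (simp add: act_comp)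
      then have "\<alpha> h (\<alpha> (inv\<^bsub>G\<^esub> h) (\<alpha> g (\<alpha> h z))) = \<alpha> h z" by simp
      then show ?thesis using gG h zX by simp
    qed
    then show "\<alpha> h z \<in> Z" using h zX by (simp add: Z_def)
  qed
  interpret Z: alg_action "sub_group Z" "subtopology T Z" G "sub_action Z"
    by (rule alg_action_sub [OF Z])
  \<comment> \<open>The action of an element on \<open>Z\<close> is determined by the way it
    permutes the finite orbit \<open>R\<close>, so only finitely many maps occur.\<close>
  have eq: "sub_action Z g = sub_action Z h"
    if "g \<in> carrier G" "h \<in> carrier G" "restrict (\<alpha> g) R = restrict (\<alpha> h) R" for g h
  proof -
    have *: "\<alpha> g p = \<alpha> h p" if "p \<in> R" for p
      using fun_cong [OF \<open>restrict (\<alpha> g) R = restrict (\<alpha> h) R\<close>, of p] that by simp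
    have "inv\<^bsub>G\<^esub> h \<otimes>\<^bsub>G\<^esub> g \<in> L"
      using that(1,2) R(2) * by (auto simp: L_def act_comp subset_iff)
    then have "\<alpha> (inv\<^bsub>G\<^esub> h \<otimes>\<^bsub>G\<^esub> g) z = z" if "z \<in> Z" for z using that by (simp add: Z_def)
    then have "\<alpha> h (\<alpha> (inv\<^bsub>G\<^esub> h) (\<alpha> g z)) = \<alpha> h z" if "z \<in> Z" for z
      using that \<open>g \<in> carrier G\<close> \<open>h \<in> carrier G\<close> by (simp add: Z_def act_comp)
    then have "\<alpha> g z = \<alpha> h z" if "z \<in> Z" for z
      using that \<open>g \<in> carrier G\<close> \<open>h \<in> carrier G\<close> by (simp add: Z_def)
    then show ?thesis unfolding sub_action_def by (intro restrict_ext) auto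
  qed
  have "finite ((\<lambda>g. restrict (\<alpha> g) R) ` carrier G)"
  proof (rule finite_subset)
    show "(\<lambda>g. restrict (\<alpha> g) R) ` carrier G \<subseteq> R \<rightarrow>\<^sub>E R" using R_inv by auto
    show "finite (R \<rightarrow>\<^sub>E R)" using R(1) by (intro finite_PiE) auto
  qed
  then have fin: "finite (sub_action Z ` carrier G)"
    by (rule finite_image_factor) (rule eq)
  have "x \<in> Z" using R x(1) by (simp add: Z_def L_def)
  then have ne: "carrier (sub_group Z) \<noteq> {\<one>\<^bsub>sub_group Z\<^esub>}" using x(2) by auto
  obtain z and n :: nat where z: "z \<in> Z" "z \<noteq> \<one>" "n > 0" "z [^]\<^bsub>sub_group Z\<^esub> n = \<one>"
    using Z.finite_action_torsion_point [OF noetherian_sub [OF noeth Z] fin ne] by auto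
  have zX: "z \<in> carrier X" using z(1) by (simp add: Z_def)
  have "orbit G \<alpha> z = orbit G (sub_action Z) z"
    unfolding orbit_eq Z.orbit_eq using z(1) by (intro image_cong) auto
  moreover have "periodic_point G (sub_action Z) z" using Z.finite_action_periodic [OF fin] .
  ultimately have "periodic_point G \<alpha> z" by (simp add: periodic_point_def)
  moreover have "z [^] n = \<one>" using z(4) by (simp add: nat_pow_def)
  ultimately show ?thesis using that zX z by blast
qed

end

section \<open>Quotients modelled on sets of reals\<close>

text \<open>A point is determined by the members of a countable base that contain it, and sets of
  naturals are equipollent with the reals.\<close>

lemma sequences_embed_in_reals: "\<exists>i :: (nat \<Rightarrow> complex) \<Rightarrow> real. inj i"
proof -
  obtain B :: "(nat \<Rightarrow> complex) set set" where B: "countable B" "topological_basis B"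
    using ex_countable_basis by blast
  define j where "j x = {n. x \<in> from_nat_into B n}" for x :: "nat \<Rightarrow> complex"
  have ne: "B \<noteq> {}" using topological_basisE [OF B(2) open_UNIV] by blast
  have "inj j"
  proof (rule injI, rule ccontr)
    fix x y assume eq: "j x = j y" and "x \<noteq> y"
    then obtain U where U: "open U" "x \<in> U" "y \<notin> U" using separation_t1 by blast
    obtain V where V: "V \<in> B" "x \<in> V" "V \<subseteq> U"
      using topological_basisE [OF B(2) U(1,2)] by blast
    obtain n where "from_nat_into B n = V" using from_nat_into_surj [OF B(1) V(1)] by blast
    then have "n \<in> j x" "n \<notin> j y" using U V by (auto simp: j_def)
    with eq show False by simp
  qed
  moreover obtain k :: "nat set \<Rightarrow> real" where "inj k"
    using nat_sets_eqpoll_reals unfolding eqpoll_def bij_betw_def by blast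
  ultimately have "inj (k \<circ> j)" by (intro inj_compose)
  then show ?thesis by blast
qed

text \<open>The quotient is modelled by coordinates instead of cosets. The annihilator of
  \<open>Y\<close> is finitely generated, and the translates of its generators under the countable
  \<open>G\<close> form a countable family. Their values at \<open>x\<close> determine
  \<open>x\<close> modulo \<open>Y\<close>, and this sequence of values is encoded as one
  real.\<close>

lemma (in alg_action) quotient_on_reals:
  assumes noeth: "noetherian_dual G X T \<alpha>" and countable: "countable (carrier G)"
    and Y: "invariant_subgroup Y"
  obtains X' :: "real monoid" and T' \<alpha>' q where "equivariant_hom X T G \<alpha> X' T' \<alpha>' q"
    "q ` carrier X = carrier X'" "\<And>x. x \<in> carrier X \<Longrightarrow> q x = \<one>\<^bsub>X'\<^esub> \<longleftrightarrow> x \<in> Y"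
proof -
  note Y' = invariant_subgroupD [OF Y]
  obtain S where S: "finite S" "S \<subseteq> annihilator Y" "\<forall>Q. submodule Q \<longrightarrow> S \<subseteq> Q \<longrightarrow> annihilator Y \<subseteq> Q"
    using noeth [unfolded noetherian_dual_iff, rule_format, OF submodule_annihilator [OF Y]] by (elim exE conjE)
  have SD: "S \<subseteq> carrier D" using S(2) by (auto simp: annihilator_def)
  \<comment> \<open>The trivial character guarantees that \<open>F\<close> is nonempty, hence the
    range of an enumeration, even when \<open>S\<close> is empty.\<close>
  define F where "F = insert \<one>\<^bsub>D\<^esub> (\<Union>\<phi>\<in>S. (\<lambda>g. dact g \<phi>) ` carrier G)"
  define f where "f = from_nat_into F"
  have F: "countable F" "F \<noteq> {}"
    using S(1) countable by (auto simp: F_def intro: countable_finite)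
  then have range_f: "range f = F" unfolding f_def by (intro range_from_nat_into)
  have FD: "F \<subseteq> carrier D" using SD by (auto simp: F_def)
  have fD: "f n \<in> carrier D" for n using range_f FD by blast
  have F_dact: "dact g \<phi> \<in> F" if g: "g \<in> carrier G" and \<phi>: "\<phi> \<in> F" for g \<phi>
    using \<phi> unfolding F_def
  proof
    assume "\<phi> = \<one>\<^bsub>D\<^esub>"
    then have "dact g \<phi> = \<one>\<^bsub>D\<^esub>" using g by (intro dual_eqI) auto
    then show "dact g \<phi> \<in> insert \<one>\<^bsub>D\<^esub> (\<Union>\<phi>\<in>S. (\<lambda>g. dact g \<phi>) ` carrier G)" by blast
  next
    assume "\<phi> \<in> (\<Union>\<phi>\<in>S. (\<lambda>g. dact g \<phi>) ` carrier G)"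
    then obtain h \<psi> where h: "h \<in> carrier G" "\<psi> \<in> S" "\<phi> = dact h \<psi>" by blast
    then have "dact g \<phi> = dact (g \<otimes>\<^bsub>G\<^esub> h) \<psi>"
      using g SD by (intro dual_eqI) (auto simp: G.inv_mult_group act_comp)
    then show "dact g \<phi> \<in> insert \<one>\<^bsub>D\<^esub> (\<Union>\<phi>\<in>S. (\<lambda>g. dact g \<phi>) ` carrier G)"
      using h g by blast
  qed
  define e where "e x = (\<lambda>n. f n x)" for x
  obtain i :: "(nat \<Rightarrow> complex) \<Rightarrow> real" where i: "inj i" using sequences_embed_in_reals by blast
  define q where "q x = i (e x)" for x
  have q_eq: "q x = q y \<longleftrightarrow> (\<forall>n. f n x = f n y)" for x y
    using i by (auto simp: q_def e_def inj_eq fun_eq_iff)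
  have inv_q: "inv_into UNIV i (q x) = e x" for x
    using i by (simp add: q_def)
  define s where "s = inv_into (carrier X) q"
  have s: "s u \<in> carrier X" "q (s u) = u" if "u \<in> q ` carrier X" for u
    using that by (auto simp: s_def intro: inv_into_into f_inv_into_f)
  have fs: "f n (s (q x)) = f n x" if "x \<in> carrier X" for n x
    using s(2) [of "q x"] that q_eq by blast
  have f_s: "f n (s u) = inv_into UNIV i u n" if "u \<in> q ` carrier X" for n u
    using that fs inv_q by (auto simp: e_def)
  define X' :: "real monoid" where
    "X' = \<lparr>carrier = q ` carrier X, monoid.mult = (\<lambda>u v. q (s u \<otimes> s v)), one = q \<one>\<rparr>"
  \<comment> \<open>Pulled back along the decoding map from the product topology on sequences, so
    that continuity into and out of the quotient is checked coordinate by coordinate.\<close>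
  define T' where "T' = pullback_topology (q ` carrier X) (inv_into UNIV i) euclidean"
  define \<alpha>' where "\<alpha>' g = (\<lambda>u\<in>q ` carrier X. q (\<alpha> g (s u)))" for g
  have carrier' [simp]: "carrier X' = q ` carrier X" and one' [simp]: "\<one>\<^bsub>X'\<^esub> = q \<one>"
    by (simp_all add: X'_def)
  have q_mult: "q x \<otimes>\<^bsub>X'\<^esub> q y = q (x \<otimes> y)" if "x \<in> carrier X" "y \<in> carrier X" for x y
  proof -
    have "s (q x) \<in> carrier X" "s (q y) \<in> carrier X" using that s by auto
    then show ?thesis using that by (simp add: X'_def q_eq dualD(2) [OF fD] fs)
  qed
  have q_act: "\<alpha>' g (q x) = q (\<alpha> g x)" if g: "g \<in> carrier G" and x: "x \<in> carrier X" for g x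
  proof -
    \<comment> \<open>This is why \<open>F\<close> contains all translates: the coordinate
      \<open>n\<close> of the point moved by \<open>g\<close> is another coordinate \<open>m\<close>
      of the point itself.\<close>
    have "f n (\<alpha> g (s (q x))) = f n (\<alpha> g x)" for n
    proof -
      have "dact (inv\<^bsub>G\<^esub> g) (f n) \<in> F" using F_dact g range_f by blast
      then obtain m where m: "f m = dact (inv\<^bsub>G\<^esub> g) (f n)" using range_f by (metis imageE)
      have "f m (s (q x)) = f m x" by (rule fs [OF x])
      then show ?thesis using x g s(1) [of "q x"] by (simp add: m)
    qed
    then have "q (\<alpha> g (s (q x))) = q (\<alpha> g x)" by (simp add: q_eq)
    then show ?thesis using imageI [OF x, of q] by (simp only: \<alpha>'_def restrict_apply if_True)
  qed
  have surj': "\<exists>x\<in>carrier X. u = q x" if "u \<in> carrier X'" for u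
    using that by auto
  have q_in: "q x \<in> carrier X'" if "x \<in> carrier X" for x
    using that by simp
  have comm': "comm_group X'"
  proof (rule comm_groupI)
    fix u v w assume u: "u \<in> carrier X'" and v: "v \<in> carrier X'"
    obtain x where x: "x \<in> carrier X" "u = q x" using surj' [OF u] by (rule bexE)
    obtain y where y: "y \<in> carrier X" "v = q y" using surj' [OF v] by (rule bexE)
    show "u \<otimes>\<^bsub>X'\<^esub> v \<in> carrier X'"
      unfolding x(2) y(2) q_mult [OF x(1) y(1)] by (rule q_in) (rule m_closed [OF x(1) y(1)])
    show "u \<otimes>\<^bsub>X'\<^esub> v = v \<otimes>\<^bsub>X'\<^esub> u"
      unfolding x(2) y(2) q_mult [OF x(1) y(1)] q_mult [OF y(1) x(1)] m_comm [OF x(1) y(1)] ..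
    assume w: "w \<in> carrier X'"
    obtain z where z: "z \<in> carrier X" "w = q z" using surj' [OF w] by (rule bexE)
    show "u \<otimes>\<^bsub>X'\<^esub> v \<otimes>\<^bsub>X'\<^esub> w = u \<otimes>\<^bsub>X'\<^esub> (v \<otimes>\<^bsub>X'\<^esub> w)"
      using x y z by (simp only: q_mult m_assoc m_closed)
  next
    fix u assume "u \<in> carrier X'"
    then obtain x where x: "x \<in> carrier X" "u = q x" using surj' by blast
    show "\<one>\<^bsub>X'\<^esub> \<otimes>\<^bsub>X'\<^esub> u = u" using x by (simp only: one' q_mult one_closed l_one)
    have "q (inv x) \<otimes>\<^bsub>X'\<^esub> u = \<one>\<^bsub>X'\<^esub>" using x by (simp only: one' q_mult inv_closed l_inv)
    then show "\<exists>v\<in>carrier X'. v \<otimes>\<^bsub>X'\<^esub> u = \<one>\<^bsub>X'\<^esub>" using q_in [OF inv_closed [OF x(1)]] by (rule bexI)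
  next
    show "\<one>\<^bsub>X'\<^esub> \<in> carrier X'" unfolding one' by (rule q_in [OF one_closed])
  qed
  then interpret X': comm_group X' .
  have topspace': "topspace T' = q ` carrier X"
    by (auto simp: T'_def topspace_pullback_topology)
  have comp_cont: "continuous_map Z euclidean (\<lambda>z n. h n z)" if "\<And>n. continuous_map Z euclidean (h n)"
    for Z :: "'z topology" and h :: "nat \<Rightarrow> 'z \<Rightarrow> complex"
    using that continuous_map_componentwise_UNIV [of Z "\<lambda>_. euclidean" "\<lambda>z n. h n z"]
    by (simp add: euclidean_product_topology)
  have coord: "continuous_map euclidean euclidean (\<lambda>z::nat \<Rightarrow> complex. z n)" for n
    by simp
  have into_T': "continuous_map Z T' h"
    if "h \<in> topspace Z \<rightarrow> q ` carrier X" "\<And>n. continuous_map Z euclidean (\<lambda>z. inv_into UNIV i (h z) n)"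
    for Z :: "'z topology" and h
  proof -
    have "continuous_map Z euclidean (inv_into UNIV i \<circ> h)"
      using comp_cont [OF that(2)] by (simp add: o_def)
    then show ?thesis
      unfolding T'_def by (rule continuous_map_pullback') (use that(1) in auto)
  qed
  have from_T': "continuous_map T' euclidean (\<lambda>u. inv_into UNIV i u n)" for n
  proof -
    have "continuous_map T' euclidean ((\<lambda>z::nat \<Rightarrow> complex. z n) \<circ> inv_into UNIV i)"
      unfolding T'_def by (rule continuous_map_pullback [OF coord])
    then show ?thesis by (simp add: o_def)
  qed
  have q_cont: "continuous_map T T' q"
  proof (rule into_T')
    show "continuous_map T euclidean (\<lambda>x. inv_into UNIV i (q x) n)" for n
      using dualD(1) [OF fD] by (simp add: inv_q e_def)
  qed auto
  have compact': "compact_space T'"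
  proof -
    have "compactin T (carrier X)" using compact by (simp add: compact_space_def)
    from image_compactin [OF this q_cont] show ?thesis by (simp add: compact_space_def topspace')
  qed
  have metr': "metrizable_space T'"
  proof -
    let ?E = "subtopology (euclidean :: (nat \<Rightarrow> complex) topology) (e ` carrier X)"
    have "homeomorphic_maps T' ?E (inv_into UNIV i) i"
      unfolding homeomorphic_maps_def
    proof (intro conjI)
      show "continuous_map T' ?E (inv_into UNIV i)"
        using comp_cont [OF from_T'] by (auto simp: continuous_map_in_subtopology topspace' inv_q)
      show "continuous_map ?E T' i"
      proof (rule into_T')
        show "i \<in> topspace ?E \<rightarrow> q ` carrier X" by (auto simp: q_def)
        show "continuous_map ?E euclidean (\<lambda>z. inv_into UNIV i (i z) n)" for n
          using continuous_map_from_subtopology [OF coord] i by simp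
      qed
    qed (use i in \<open>auto simp: topspace' inv_q q_def\<close>)
    then have "T' homeomorphic_space ?E" by (auto simp: homeomorphic_space_def)
    moreover have "metrizable_space ?E"
      using metrizable_space_euclidean metrizable_space_subtopology by blast
    ultimately show ?thesis using homeomorphic_metrizable_space by blast
  qed
  have cm': "compact_metrizable_abelian_group X' T'"
    unfolding compact_metrizable_abelian_group_def
  proof (intro conjI comm' compact' metr')
    show "topspace T' = carrier X'" by (simp add: topspace')
    show "continuous_map (prod_topology T' T') T' (\<lambda>(x, y). x \<otimes>\<^bsub>X'\<^esub> y)"
    proof (rule into_T')
      show "(\<lambda>(x, y). x \<otimes>\<^bsub>X'\<^esub> y) \<in> topspace (prod_topology T' T') \<rightarrow> q ` carrier X"
        using X'.m_closed by (auto simp: topspace')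
      fix n
      have "continuous_map (prod_topology T' T') euclidean (\<lambda>z. inv_into UNIV i (fst z) n)"
        "continuous_map (prod_topology T' T') euclidean (\<lambda>z. inv_into UNIV i (snd z) n)"
        using continuous_map_compose [OF continuous_map_fst from_T'] continuous_map_compose [OF continuous_map_snd from_T']
        by (simp_all add: o_def)
      then have "continuous_map (prod_topology T' T') euclidean (\<lambda>z. inv_into UNIV i (fst z) n * inv_into UNIV i (snd z) n)"
        by (simp add: continuous_map_atin tendsto_mult)
      then show "continuous_map (prod_topology T' T') euclidean (\<lambda>z. inv_into UNIV i (case z of (x, y) \<Rightarrow> x \<otimes>\<^bsub>X'\<^esub> y) n)"
      proof (rule continuous_map_eq)
        fix z assume "z \<in> topspace (prod_topology T' T')"
        then obtain x y where "x \<in> carrier X" "y \<in> carrier X" "z = (q x, q y)" by (auto simp: topspace')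
        then show "inv_into UNIV i (fst z) n * inv_into UNIV i (snd z) n
            = inv_into UNIV i (case z of (x, y) \<Rightarrow> x \<otimes>\<^bsub>X'\<^esub> y) n"
          by (simp add: q_mult inv_q e_def dualD(2) [OF fD])
      qed
    qed
    have inv': "inv\<^bsub>X'\<^esub> (q x) = q (inv x)" if "x \<in> carrier X" for x
      using that by (intro X'.inv_equality) (simp_all add: q_mult)
    show "continuous_map T' T' (\<lambda>x. inv\<^bsub>X'\<^esub> x)"
    proof (rule into_T')
      show "(\<lambda>x. inv\<^bsub>X'\<^esub> x) \<in> topspace T' \<rightarrow> q ` carrier X"
        using X'.inv_closed by (auto simp: topspace')
      fix n
      have "continuous_map T' euclidean (\<lambda>u. cnj (inv_into UNIV i u n))"
        using from_T' [of n] by (simp add: continuous_map_atin tendsto_cnj)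
      then show "continuous_map T' euclidean (\<lambda>u. inv_into UNIV i (inv\<^bsub>X'\<^esub> u) n)"
        by (rule continuous_map_eq) (auto simp: topspace' inv' inv_q e_def dualD(5) [OF fD])
    qed
  qed
  have act': "algebraic_action G X' T' \<alpha>'"
  proof (rule algebraic_actionI [OF cm' G.is_group])
    fix g assume g: "g \<in> carrier G"
    show "continuous_map T' T' (\<alpha>' g)"
    proof (rule into_T')
      show "\<alpha>' g \<in> topspace T' \<rightarrow> q ` carrier X" using g by (auto simp: topspace' q_act)
      fix n
      have "dact (inv\<^bsub>G\<^esub> g) (f n) \<in> F" using F_dact g range_f by blast
      then obtain m where m: "f m = dact (inv\<^bsub>G\<^esub> g) (f n)" using range_f by (metis imageE)
      show "continuous_map T' euclidean (\<lambda>u. inv_into UNIV i (\<alpha>' g u) n)"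
        by (rule continuous_map_eq [OF from_T' [of m]]) (use g in \<open>auto simp: topspace' inv_q e_def m q_act\<close>)
    qed
  next
    fix g show "\<alpha>' g \<in> extensional (carrier X')" by (simp add: \<alpha>'_def)
  qed (auto simp: q_act q_mult act_mult act_comp)
  interpret B: alg_action X' T' G \<alpha>'
    using cm' act' by (simp add: alg_action_def alg_action_axioms_def compact_abelian_group_def)
  have eq: "equivariant_hom X T G \<alpha> X' T' \<alpha>' q"
    using alg_action_axioms B.alg_action_axioms q_cont
    by (auto simp: equivariant_hom_def equivariant_hom_axioms_def hom_def q_mult q_act)
  have ker: "q x = \<one>\<^bsub>X'\<^esub> \<longleftrightarrow> x \<in> Y" if x: "x \<in> carrier X" for x
  proof
    assume xY: "x \<in> Y"
    have "\<phi> x = 1" if "\<phi> \<in> F" for \<phi>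
      using that S(2) Y'(4) [OF _ xY] x by (auto simp: F_def annihilator_def)
    then have "f n x = f n \<one>" for n
      using range_f dualD(4) [OF fD] by auto
    then show "q x = \<one>\<^bsub>X'\<^esub>" by (simp add: q_eq)
  next
    assume "q x = \<one>\<^bsub>X'\<^esub>"
    then have 1: "\<phi> x = 1" if "\<phi> \<in> F" for \<phi>
    proof -
      obtain n where "\<phi> = f n" using \<open>\<phi> \<in> F\<close> range_f by (metis imageE)
      then show ?thesis using \<open>q x = \<one>\<^bsub>X'\<^esub>\<close> dualD(4) [OF fD] by (simp add: q_eq)
    qed
    \<comment> \<open>The characters trivial on the whole orbit of \<open>x\<close> form a
      submodule. It contains the generators \<open>S\<close>, hence the annihilator of
      \<open>Y\<close>, and separation then puts \<open>x\<close> into \<open>Y\<close>.\<close>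
    let ?Q = "{\<phi> \<in> carrier D. \<forall>g\<in>carrier G. \<phi> (\<alpha> g x) = 1}"
    have "submodule ?Q"
      using x by (intro submoduleI) (auto simp flip: act_comp)
    moreover have "S \<subseteq> ?Q"
    proof
      fix \<phi> assume \<phi>: "\<phi> \<in> S"
      have "\<phi> (\<alpha> g x) = 1" if "g \<in> carrier G" for g
      proof -
        have "dact (inv\<^bsub>G\<^esub> g) \<phi> \<in> F" using \<phi> that by (auto simp: F_def)
        from 1 [OF this] show ?thesis using x that by simp
      qed
      then show "\<phi> \<in> ?Q" using \<phi> SD by auto
    qed
    ultimately have Q: "annihilator Y \<subseteq> ?Q" using S(3) by blast
    show "x \<in> Y"
    proof (rule ccontr)
      assume "x \<notin> Y"
      then obtain \<phi> where \<phi>: "\<phi> \<in> carrier D" "\<And>y. y \<in> Y \<Longrightarrow> \<phi> y = 1" "\<phi> x \<noteq> 1"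
        using dual_separates [OF Y'(1,2) x] by metis
      then have "\<phi> (\<alpha> \<one>\<^bsub>G\<^esub> x) = 1" using Q by (auto simp: annihilator_def)
      then show False using \<phi>(3) x by simp
    qed
  qed
  show ?thesis
    by (rule that [OF eq _ ker]) auto
qed

lemma (in alg_action) noetherian_actionI: "noetherian_dual G X T \<alpha> \<Longrightarrow> noetherian_action G X T \<alpha>"
  by (simp add: noetherian_action_def algebraic)

lemma noetherian_actionD:
  assumes "noetherian_action G X T \<alpha>"
  shows "alg_action X T G \<alpha>" "noetherian_dual G X T \<alpha>"
  using assms
  by (auto simp: noetherian_action_def alg_action_def alg_action_axioms_def compact_abelian_group_def
      algebraic_action_def)

lemma (in alg_action) invariant_trivial: "invariant_subgroup {\<one>}"
  using triv_subgroup closed_one by (simp add: invariant_subgroup_def)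

lemma (in alg_action) isomorphic_to_real_action:
  assumes noeth: "noetherian_dual G X T \<alpha>" and countable: "countable (carrier G)"
  obtains X' :: "real monoid" and T' \<alpha>' q where "equivariant_hom X T G \<alpha> X' T' \<alpha>' q"
    "bij_betw q (carrier X) (carrier X')" "noetherian_action G X' T' \<alpha>'"
proof -
  obtain X' :: "real monoid" and T' \<alpha>' q where q: "equivariant_hom X T G \<alpha> X' T' \<alpha>' q"
    "q ` carrier X = carrier X'" "\<And>x. x \<in> carrier X \<Longrightarrow> q x = \<one>\<^bsub>X'\<^esub> \<longleftrightarrow> x \<in> {\<one>}"
    using quotient_on_reals [OF noeth countable invariant_trivial] by metis
  interpret q: equivariant_hom X T G \<alpha> X' T' \<alpha>' q by fact
  have "inj_on q (carrier X)"
    using q(3) q.q.inj_on_one_iff by auto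
  then have "bij_betw q (carrier X) (carrier X')" using q(2) by (simp add: bij_betw_def)
  moreover have "noetherian_action G X' T' \<alpha>'"
    using q.B.noetherian_actionI q.noetherian_image [OF noeth q(2)] by blast
  ultimately show ?thesis using that q(1) by blast
qed

section \<open>Transport of periodic points to actions on other types\<close>

context equivariant_hom
begin

lemma q_orbit: "x \<in> carrier X \<Longrightarrow> orbit G \<alpha>' (q x) = q ` orbit G \<alpha> x"
  unfolding A.orbit_eq B.orbit_eq by (force simp: q_equiv)

lemma orbit_subset: "x \<in> carrier X \<Longrightarrow> orbit G \<alpha> x \<subseteq> carrier X"
  by (auto simp: A.orbit_eq)

lemma periodic_iff:
  assumes "inj_on q (carrier X)" "x \<in> carrier X"
  shows "periodic_point G \<alpha>' (q x) \<longleftrightarrow> periodic_point G \<alpha> x"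
  unfolding periodic_point_def q_orbit [OF assms(2)]
  using finite_image_iff inj_on_subset [OF assms(1) orbit_subset [OF assms(2)]] by blast

end

text \<open>The equivariant bijection onto an action on reals is continuous from a compact to a
  Hausdorff space, hence a homeomorphism; it preserves periodicity and closures.\<close>

theorem dense_periodic_points_transfer:
  fixes G :: "('g, 'm) monoid_scheme"
  assumes dense: "dense_periodic_points TYPE(real) G" and countable: "countable (carrier G)"
  shows "dense_periodic_points TYPE('x) G"
  unfolding dense_periodic_points_def
proof (intro allI impI)
  fix X :: "'x monoid" and T \<alpha> assume "noetherian_action G X T \<alpha>"
  note n = noetherian_actionD [OF this]
  interpret alg_action X T G \<alpha> by (rule n(1))
  obtain X' :: "real monoid" and T' \<alpha>' q where q: "equivariant_hom X T G \<alpha> X' T' \<alpha>' q"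
    "bij_betw q (carrier X) (carrier X')" "noetherian_action G X' T' \<alpha>'"
    using isomorphic_to_real_action [OF n(2) countable] by metis
  interpret q: equivariant_hom X T G \<alpha> X' T' \<alpha>' q by fact
  let ?P = "{x \<in> carrier X. periodic_point G \<alpha> x}"
  let ?P' = "{x \<in> carrier X'. periodic_point G \<alpha>' x}"
  have inj: "inj_on q (carrier X)" and surj: "q ` carrier X = carrier X'"
    using q(2) by (auto simp: bij_betw_def)
  have "homeomorphic_map T T' q"
    using continuous_imp_homeomorphic_map [OF q.q_cont compact q.B.Hausdorff] inj surj by simp
  then have "T' closure_of (q ` ?P) = q ` (T closure_of ?P)"
    by (intro homeomorphic_map_closure_of) auto
  moreover have "q ` ?P = ?P'"
  proof
    show "q ` ?P \<subseteq> ?P'" using q.periodic_iff [OF inj] by auto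
    show "?P' \<subseteq> q ` ?P"
    proof
      fix u assume u: "u \<in> ?P'"
      then obtain x where x: "x \<in> carrier X" "u = q x" using surj by blast
      then have "x \<in> ?P" using u q.periodic_iff [OF inj x(1)] by simp
      with x(2) show "u \<in> q ` ?P" by (rule image_eqI)
    qed
  qed
  moreover have "T' closure_of ?P' = topspace T'"
    using dense q(3) unfolding dense_periodic_points_def by blast
  ultimately have "q ` (T closure_of ?P) = q ` carrier X" using surj by simp
  then show "T closure_of ?P = topspace T"
    using inj_on_image_eq_iff [OF inj] closure_of_subset_topspace [of T ?P] by simp
qed

section \<open>Subgroups of finite index\<close>

context group
begin

lemma finite_index_iff:
  "finite_index_subgroup L G \<longleftrightarrow> subgroup L G \<and> finite ((\<lambda>g. L #> g) ` carrier G)"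
proof -
  have "rcosets L = (\<lambda>g. L #> g) ` carrier G" by (auto simp: RCOSETS_def)
  then show ?thesis by (simp add: finite_index_subgroup_def)
qed

lemma rcoset_eq_iff:
  assumes L: "subgroup L G" and g: "g \<in> carrier G" and h: "h \<in> carrier G"
  shows "L #> g = L #> h \<longleftrightarrow> g \<otimes> inv h \<in> L"
proof
  assume "L #> g = L #> h"
  then have "g \<in> L #> h" using rcos_self [OF g L] by simp
  then obtain l where l: "l \<in> L" "g = l \<otimes> h" by (auto simp: r_coset_def)
  then have "g \<otimes> inv h = l" using h subgroup.mem_carrier [OF L] by (simp add: m_assoc)
  with l show "g \<otimes> inv h \<in> L" by simp
next
  assume "g \<otimes> inv h \<in> L"
  then have "L #> (g \<otimes> inv h) = L" using L by (intro coset_join2) (use g h in auto)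
  then show "L #> g = L #> h" using coset_mult_inv1 g h subgroup.subset [OF L] by blast
qed

lemma finite_index_carrier: "finite_index_subgroup (carrier G) G"
proof -
  have "(\<lambda>g. carrier G #> g) ` carrier G \<subseteq> {carrier G}"
    using coset_join2 [OF _ subgroup_self] by auto
  then show ?thesis
    using subgroup_self finite_subset unfolding finite_index_iff by blast
qed

lemma finite_index_Int:
  assumes "finite_index_subgroup L G" "finite_index_subgroup M G"
  shows "finite_index_subgroup (L \<inter> M) G"
proof -
  have sub: "subgroup L G" "subgroup M G" using assms by (auto simp: finite_index_iff)
  have LM: "subgroup (L \<inter> M) G" using subgroups_Inter_pair sub by blast
  have "(\<lambda>g. (L #> g, M #> g)) ` carrier G \<subseteq> ((\<lambda>g. L #> g) ` carrier G) \<times> ((\<lambda>g. M #> g) ` carrier G)"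
    by auto
  then have "finite ((\<lambda>g. (L #> g, M #> g)) ` carrier G)"
    using assms by (meson finite_SigmaI finite_index_iff finite_subset)
  then have "finite ((\<lambda>g. (L \<inter> M) #> g) ` carrier G)"
    by (rule finite_image_factor) (simp add: rcoset_eq_iff sub LM)
  with LM show ?thesis by (simp add: finite_index_iff)
qed

end

context alg_action
begin

lemma finite_index_stabilizer:
  assumes z: "z \<in> carrier X" and per: "periodic_point G \<alpha> z"
  shows "finite_index_subgroup {g \<in> carrier G. \<alpha> g z = z} G"
proof -
  let ?L = "{g \<in> carrier G. \<alpha> g z = z}"
  have L: "subgroup ?L G"
  proof (rule G.subgroupI)
    fix g assume "g \<in> ?L"
    then show "inv\<^bsub>G\<^esub> g \<in> ?L" using act_inv_act [of g z] z by auto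
  qed (use z in \<open>auto simp: act_comp intro!: exI [of _ "\<one>\<^bsub>G\<^esub>"]\<close>)
  \<comment> \<open>Inverses appear because the cosets are right cosets: elements of one coset of
    the stabiliser are those whose inverses send \<open>z\<close> to the same point.\<close>
  have "(\<lambda>g. \<alpha> (inv\<^bsub>G\<^esub> g) z) ` carrier G \<subseteq> orbit G \<alpha> z" by (auto simp: orbit_eq)
  then have "finite ((\<lambda>g. \<alpha> (inv\<^bsub>G\<^esub> g) z) ` carrier G)"
    using per unfolding periodic_point_def by (rule finite_subset)
  then have "finite ((\<lambda>g. ?L #>\<^bsub>G\<^esub> g) ` carrier G)"
  proof (rule finite_image_factor)
    fix g h assume gh: "g \<in> carrier G" "h \<in> carrier G" "\<alpha> (inv\<^bsub>G\<^esub> g) z = \<alpha> (inv\<^bsub>G\<^esub> h) z"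
    then have "\<alpha> g (\<alpha> (inv\<^bsub>G\<^esub> h) z) = z"
      using act_act_inv [of g z] z by simp
    then have "\<alpha> (g \<otimes>\<^bsub>G\<^esub> inv\<^bsub>G\<^esub> h) z = z"
      using gh z by (simp add: act_comp)
    then show "?L #>\<^bsub>G\<^esub> g = ?L #>\<^bsub>G\<^esub> h"
      using gh z by (simp add: G.rcoset_eq_iff [OF L])
  qed
  with L show ?thesis by (simp add: G.finite_index_iff)
qed

lemma periodic_if_fixed:
  assumes L: "finite_index_subgroup L G" and x: "x \<in> carrier X" and fix_x: "\<And>g. g \<in> L \<Longrightarrow> \<alpha> g x = x"
  shows "periodic_point G \<alpha> x"
proof -
  have sub: "subgroup L G" and fin: "finite ((\<lambda>g. L #>\<^bsub>G\<^esub> g) ` carrier G)"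
    using L by (auto simp: G.finite_index_iff)
  have fin': "finite ((\<lambda>g. \<alpha> (inv\<^bsub>G\<^esub> g) x) ` carrier G)"
  proof (rule finite_image_factor [OF fin])
    fix g h assume g: "g \<in> carrier G" and h: "h \<in> carrier G" and "L #>\<^bsub>G\<^esub> g = L #>\<^bsub>G\<^esub> h"
    then have "\<alpha> (g \<otimes>\<^bsub>G\<^esub> inv\<^bsub>G\<^esub> h) x = x"
      using fix_x by (simp add: G.rcoset_eq_iff [OF sub])
    then have "\<alpha> (inv\<^bsub>G\<^esub> g) (\<alpha> (g \<otimes>\<^bsub>G\<^esub> inv\<^bsub>G\<^esub> h) x) = \<alpha> (inv\<^bsub>G\<^esub> g) x" by simp
    then show "\<alpha> (inv\<^bsub>G\<^esub> g) x = \<alpha> (inv\<^bsub>G\<^esub> h) x"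
      using g h x by (simp add: act_comp)
  qed
  have "orbit G \<alpha> x \<subseteq> (\<lambda>g. \<alpha> (inv\<^bsub>G\<^esub> g) x) ` carrier G"
    unfolding orbit_eq
  proof (rule image_subsetI)
    fix g assume "g \<in> carrier G"
    then show "\<alpha> g x \<in> (\<lambda>g. \<alpha> (inv\<^bsub>G\<^esub> g) x) ` carrier G"
      by (intro image_eqI [of _ _ "inv\<^bsub>G\<^esub> g"]) auto
  qed
  then show ?thesis
    unfolding periodic_point_def using fin' by (rule finite_subset)
qed

section \<open>Virtual cohomology\<close>

abbreviation "V \<equiv> virtual_cocycles G X \<alpha>"
abbreviation "E \<equiv> virtual_equiv G X \<alpha>"
abbreviation "Q \<equiv> virtual_cocycle_classes G X \<alpha>"

lemma virtual_cocycleD: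
  assumes "(L, c) \<in> V"
  shows "finite_index_subgroup L G" "subgroup L G" "\<And>g. g \<in> L \<Longrightarrow> g \<in> carrier G"
    "\<And>g. g \<in> L \<Longrightarrow> c g \<in> carrier X" "c \<in> extensional L"
    "\<And>g h. g \<in> L \<Longrightarrow> h \<in> L \<Longrightarrow> c (g \<otimes>\<^bsub>G\<^esub> h) = c g \<otimes> \<alpha> g (c h)"
  using assms subgroup.mem_carrier
  by (auto simp: virtual_cocycles_def finite_index_subgroup_def PiE_iff)

lemma virtual_cocycleI:
  assumes "finite_index_subgroup L G" "\<And>g. g \<in> L \<Longrightarrow> c g \<in> carrier X"
    "\<And>g h. g \<in> L \<Longrightarrow> h \<in> L \<Longrightarrow> c (g \<otimes>\<^bsub>G\<^esub> h) = c g \<otimes> \<alpha> g (c h)"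
  shows "(L, restrict c L) \<in> V"
proof -
  have "g \<otimes>\<^bsub>G\<^esub> h \<in> L" if "g \<in> L" "h \<in> L" for g h
    using assms(1) that subgroup.m_closed unfolding finite_index_subgroup_def by metis
  with assms show ?thesis by (auto simp: virtual_cocycles_def)
qed

lemma virtual_equivI:
  assumes "(L1, c1) \<in> V" "(L2, c2) \<in> V" "finite_index_subgroup L G" "L \<subseteq> L1" "L \<subseteq> L2"
    "\<And>g. g \<in> L \<Longrightarrow> c1 g = c2 g"
  shows "((L1, c1), (L2, c2)) \<in> E"
  using assms unfolding virtual_equiv_def by blast

lemma virtual_equivE:
  assumes "((L1, c1), (L2, c2)) \<in> E"
  obtains L where "(L1, c1) \<in> V" "(L2, c2) \<in> V" "finite_index_subgroup L G" "L \<subseteq> L1" "L \<subseteq> L2"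
    "\<forall>g\<in>L. c1 g = c2 g"
  using assms unfolding virtual_equiv_def by blast

lemma equiv_E: "equiv V E"
proof (rule equivI)
  show "E \<subseteq> V \<times> V" unfolding virtual_equiv_def by auto
  show "refl_on V E"
  proof (rule refl_onI)
    fix a assume a: "a \<in> V"
    obtain L c where [simp]: "a = (L, c)" by (cases a)
    show "(a, a) \<in> E"
      using a virtual_cocycleD(1) [of L c] by (auto intro: virtual_equivI [of L c L c L])
  qed
  show "sym E" unfolding virtual_equiv_def by (rule symI) force
  show "trans E"
  proof (rule transI)
    fix a b d assume ab: "(a, b) \<in> E" and bd: "(b, d) \<in> E"
    obtain L1 c1 L2 c2 L3 c3 where [simp]: "a = (L1, c1)" "b = (L2, c2)" "d = (L3, c3)"
      by (cases a, cases b, cases d)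
    obtain L where L: "(L1, c1) \<in> V" "finite_index_subgroup L G" "L \<subseteq> L1" "L \<subseteq> L2" "\<forall>g\<in>L. c1 g = c2 g"
      using ab by (auto elim: virtual_equivE)
    obtain M where M: "(L3, c3) \<in> V" "finite_index_subgroup M G" "M \<subseteq> L2" "M \<subseteq> L3" "\<forall>g\<in>M. c2 g = c3 g"
      using bd by (auto elim: virtual_equivE)
    show "(a, d) \<in> E"
      using L M G.finite_index_Int [OF L(2) M(2)] by (auto intro: virtual_equivI [of L1 c1 L3 c3 "L \<inter> M"])
  qed
qed

lemma cocycle_mult_closed:
  assumes "a \<in> V" "b \<in> V"
  shows "cocycle_mult X a b \<in> V"
proof -
  obtain L c M d where [simp]: "a = (L, c)" "b = (M, d)" by (cases a, cases b)
  note a = virtual_cocycleD [OF assms(1) [simplified]] and b = virtual_cocycleD [OF assms(2) [simplified]]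
  have "(L \<inter> M, restrict (\<lambda>g. c g \<otimes> d g) (L \<inter> M)) \<in> V"
    using a b G.finite_index_Int [OF a(1) b(1)]
    by (intro virtual_cocycleI) (auto simp: act_mult m_ac)
  then show ?thesis by (simp add: cocycle_mult_def)
qed

lemma congruent2_cocycle_mult:
  "congruent2 E E (\<lambda>a b. E `` {cocycle_mult X a b})"
proof (rule congruent2I')
  fix a a' b b' assume aa: "(a, a') \<in> E" and bb: "(b, b') \<in> E"
  obtain L1 c1 L2 c2 M1 d1 M2 d2 where [simp]: "a = (L1, c1)" "a' = (L2, c2)" "b = (M1, d1)" "b' = (M2, d2)"
    by (cases a, cases a', cases b, cases b')
  obtain L where L: "(L1, c1) \<in> V" "(L2, c2) \<in> V" "finite_index_subgroup L G" "L \<subseteq> L1" "L \<subseteq> L2" "\<forall>g\<in>L. c1 g = c2 g"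
    using aa by (auto elim: virtual_equivE)
  obtain M where M: "(M1, d1) \<in> V" "(M2, d2) \<in> V" "finite_index_subgroup M G" "M \<subseteq> M1" "M \<subseteq> M2" "\<forall>g\<in>M. d1 g = d2 g"
    using bb by (auto elim: virtual_equivE)
  have "(L1 \<inter> M1, restrict (\<lambda>g. c1 g \<otimes> d1 g) (L1 \<inter> M1)) \<in> V" "(L2 \<inter> M2, restrict (\<lambda>g. c2 g \<otimes> d2 g) (L2 \<inter> M2)) \<in> V"
    using cocycle_mult_closed [OF L(1) M(1)] cocycle_mult_closed [OF L(2) M(2)] by (simp_all add: cocycle_mult_def)
  then have "(cocycle_mult X a b, cocycle_mult X a' b') \<in> E"
    unfolding cocycle_mult_def using L M G.finite_index_Int [OF L(3) M(3)]
    by (auto intro!: virtual_equivI [of _ _ _ _ "L \<inter> M"])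
  then show "E `` {cocycle_mult X a b} = E `` {cocycle_mult X a' b'}"
    using equiv_E by (simp add: equiv_class_eq)
qed

lemma Q_carrier: "carrier Q = V // E"
  and Q_one: "\<one>\<^bsub>Q\<^esub> = E `` {(carrier G, \<lambda>g\<in>carrier G. \<one>)}"
  by (simp_all add: virtual_cocycle_classes_def)

lemma Q_mult: "a \<in> V \<Longrightarrow> b \<in> V \<Longrightarrow> E `` {a} \<otimes>\<^bsub>Q\<^esub> E `` {b} = E `` {cocycle_mult X a b}"
  using UN_equiv_class2 [OF equiv_E equiv_E congruent2_cocycle_mult]
  by (simp add: virtual_cocycle_classes_def)

lemma one_cocycle: "(carrier G, \<lambda>g\<in>carrier G. \<one>) \<in> V"
  by (rule virtual_cocycleI [OF G.finite_index_carrier]) auto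

lemma class_one_mult:
  assumes "a \<in> V"
  shows "E `` {cocycle_mult X (carrier G, \<lambda>g\<in>carrier G. \<one>) a} = E `` {a}"
proof -
  obtain L c where [simp]: "a = (L, c)" by (cases a)
  note a = virtual_cocycleD [OF assms [simplified]]
  have "cocycle_mult X (carrier G, \<lambda>g\<in>carrier G. \<one>) a \<in> V"
    using cocycle_mult_closed one_cocycle assms by blast
  then have "(cocycle_mult X (carrier G, \<lambda>g\<in>carrier G. \<one>) a, a) \<in> E"
    using a assms by (auto simp: cocycle_mult_def intro!: virtual_equivI [of _ _ _ _ L])
  then show ?thesis using equiv_E by (simp add: equiv_class_eq)
qed

lemma Q_comm_group: "comm_group Q"
proof (rule comm_groupI)
  fix A B C assume "A \<in> carrier Q" "B \<in> carrier Q"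
  then obtain a b where ab: "a \<in> V" "b \<in> V" "A = E `` {a}" "B = E `` {b}"
    unfolding Q_carrier by (auto elim!: quotientE)
  obtain L c M d where [simp]: "a = (L, c)" "b = (M, d)" by (cases a, cases b)
  note a = virtual_cocycleD [OF ab(1) [simplified]] and b = virtual_cocycleD [OF ab(2) [simplified]]
  show "A \<otimes>\<^bsub>Q\<^esub> B \<in> carrier Q"
    using ab cocycle_mult_closed by (simp add: Q_mult Q_carrier quotientI)
  have "cocycle_mult X a b = cocycle_mult X b a"
    using a b by (auto simp: cocycle_mult_def Int_commute intro!: restrict_ext m_comm)
  then show "A \<otimes>\<^bsub>Q\<^esub> B = B \<otimes>\<^bsub>Q\<^esub> A"
    using ab by (simp only: Q_mult)
  assume "C \<in> carrier Q"
  then obtain e where e: "e \<in> V" "C = E `` {e}"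
    unfolding Q_carrier by (auto elim!: quotientE)
  obtain N f where [simp]: "e = (N, f)" by (cases e)
  note e' = virtual_cocycleD [OF e(1) [simplified]]
  have "cocycle_mult X (cocycle_mult X a b) e = cocycle_mult X a (cocycle_mult X b e)"
    using a b e' by (auto simp: cocycle_mult_def Int_assoc m_assoc intro!: restrict_ext)
  then show "A \<otimes>\<^bsub>Q\<^esub> B \<otimes>\<^bsub>Q\<^esub> C = A \<otimes>\<^bsub>Q\<^esub> (B \<otimes>\<^bsub>Q\<^esub> C)"
    using ab e cocycle_mult_closed by (simp only: Q_mult)
next
  show "\<one>\<^bsub>Q\<^esub> \<in> carrier Q"
    unfolding Q_one Q_carrier using one_cocycle by (rule quotientI)
next
  fix A assume "A \<in> carrier Q"
  then obtain a where a: "a \<in> V" "A = E `` {a}"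
    unfolding Q_carrier by (auto elim!: quotientE)
  show "\<one>\<^bsub>Q\<^esub> \<otimes>\<^bsub>Q\<^esub> A = A"
    unfolding Q_one using a one_cocycle by (simp add: Q_mult class_one_mult)
  obtain L c where [simp]: "a = (L, c)" by (cases a)
  note a' = virtual_cocycleD [OF a(1) [simplified]]
  let ?b = "(L, restrict (\<lambda>g. inv (c g)) L)"
  have b: "?b \<in> V"
    using a' by (intro virtual_cocycleI) (auto simp: inv_mult act_inv)
  have "cocycle_mult X ?b a \<in> V" using cocycle_mult_closed b a(1) by blast
  then have "(cocycle_mult X ?b a, (carrier G, \<lambda>g\<in>carrier G. \<one>)) \<in> E"
    using a' one_cocycle by (auto simp: cocycle_mult_def intro!: virtual_equivI [of _ _ _ _ L])
  then have "E `` {?b} \<otimes>\<^bsub>Q\<^esub> A = \<one>\<^bsub>Q\<^esub>"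
    using equiv_E a b by (simp add: Q_mult Q_one equiv_class_eq)
  moreover have "E `` {?b} \<in> carrier Q" unfolding Q_carrier using b by (rule quotientI)
  ultimately show "\<exists>B\<in>carrier Q. B \<otimes>\<^bsub>Q\<^esub> A = \<one>\<^bsub>Q\<^esub>" by blast
qed

definition virtually_coboundary :: "'g set \<Rightarrow> ('g \<Rightarrow> 'x) \<Rightarrow> bool" where
  "virtually_coboundary L c \<longleftrightarrow> (\<exists>x\<in>carrier X. \<exists>M. finite_index_subgroup M G \<and> M \<subseteq> L \<and>
     (\<forall>g\<in>M. c g = \<alpha> g x \<otimes> inv x))"

lemma coboundary_cocycle: "x \<in> carrier X \<Longrightarrow> coboundary G X \<alpha> x \<in> V"
proof -
  assume x: "x \<in> carrier X"
  have "\<alpha> (g \<otimes>\<^bsub>G\<^esub> h) x \<otimes> inv x = (\<alpha> g x \<otimes> inv x) \<otimes> \<alpha> g (\<alpha> h x \<otimes> inv x)"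
    if "g \<in> carrier G" "h \<in> carrier G" for g h
  proof -
    have "(\<alpha> g x \<otimes> inv x) \<otimes> (\<alpha> g (\<alpha> h x) \<otimes> inv (\<alpha> g x)) = \<alpha> g x \<otimes> (inv (\<alpha> g x) \<otimes> (\<alpha> g (\<alpha> h x) \<otimes> inv x))"
      using x that by (simp add: m_ac)
    then show ?thesis
      using x that by (simp add: act_comp act_mult act_inv mult_inv_cancel)
  qed
  then show ?thesis
    unfolding coboundary_def using x by (intro virtual_cocycleI G.finite_index_carrier) auto
qed

lemma virtual_coboundary_iff:
  "(L, c) \<in> virtual_coboundaries G X \<alpha> \<longleftrightarrow> (L, c) \<in> V \<and> virtually_coboundary L c"
proof
  assume "(L, c) \<in> virtual_coboundaries G X \<alpha>"
  then obtain x where x: "(L, c) \<in> V" "x \<in> carrier X" "((L, c), coboundary G X \<alpha> x) \<in> E"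
    by (auto simp: virtual_coboundaries_def)
  then obtain M where M: "finite_index_subgroup M G" "M \<subseteq> L" "M \<subseteq> carrier G"
     "\<forall>g\<in>M. c g = (\<lambda>g\<in>carrier G. \<alpha> g x \<otimes> inv x) g"
    unfolding coboundary_def by (auto elim: virtual_equivE)
  then have "\<forall>g\<in>M. c g = \<alpha> g x \<otimes> inv x" by auto
  with x M show "(L, c) \<in> V \<and> virtually_coboundary L c"
    unfolding virtually_coboundary_def by blast
next
  assume a: "(L, c) \<in> V \<and> virtually_coboundary L c"
  then obtain x M where M: "x \<in> carrier X" "finite_index_subgroup M G" "M \<subseteq> L" "\<forall>g\<in>M. c g = \<alpha> g x \<otimes> inv x"
    unfolding virtually_coboundary_def by blast
  have "M \<subseteq> carrier G" using M(2) subgroup.subset by (auto simp: finite_index_subgroup_def)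
  then have "((L, c), coboundary G X \<alpha> x) \<in> E"
    using a M coboundary_cocycle [OF M(1)] unfolding coboundary_def
    by (intro virtual_equivI [of _ _ _ _ M]) (auto simp: subset_iff)
  then show "(L, c) \<in> virtual_coboundaries G X \<alpha>"
    using a M(1) by (auto simp: virtual_coboundaries_def)
qed

lemma virtual_coboundaries_saturated:
  assumes "(a, b) \<in> E" "b \<in> virtual_coboundaries G X \<alpha>"
  shows "a \<in> virtual_coboundaries G X \<alpha>"
proof -
  obtain x where x: "x \<in> carrier X" "(b, coboundary G X \<alpha> x) \<in> E"
    using assms(2) by (auto simp: virtual_coboundaries_def)
  have "(a, coboundary G X \<alpha> x) \<in> E"
    using equiv_E assms(1) x(2) unfolding equiv_def by (meson transD)
  moreover have "a \<in> V" using assms(1) unfolding virtual_equiv_def by auto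
  ultimately show ?thesis using x(1) by (auto simp: virtual_coboundaries_def)
qed

text \<open>Replaces the quotient of classes by single cocycles. A class lies in its own coset of
  the coboundary classes, as its product with the unit class. If that coset is the subgroup, the
  class is that of a coboundary, and saturation passes this on to the given representative.\<close>

theorem trivial_virtual_H1_iff:
  "trivial_group (virtual_H1 G X \<alpha>) \<longleftrightarrow> (\<forall>L c. (L, c) \<in> V \<longrightarrow> virtually_coboundary L c)"
proof
  interpret Q: comm_group Q by (rule Q_comm_group)
  let ?H = "virtual_coboundaries G X \<alpha> // E"
  {
    assume "trivial_group (virtual_H1 G X \<alpha>)"
    then have "rcosets\<^bsub>Q\<^esub> ?H = {?H}"
      by (simp add: trivial_group_def virtual_H1_def FactGroup_def)
    have "(L, c) \<in> virtual_coboundaries G X \<alpha>" if Lc: "(L, c) \<in> V" for L c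
    proof -
      have A: "E `` {(L, c)} \<in> carrier Q" unfolding Q_carrier using Lc by (rule quotientI)
      then have "?H #>\<^bsub>Q\<^esub> E `` {(L, c)} = ?H"
        using \<open>rcosets\<^bsub>Q\<^esub> ?H = {?H}\<close> by (auto simp: RCOSETS_def)
      moreover have "(carrier G, \<lambda>g\<in>carrier G. \<one>) \<in> virtual_coboundaries G X \<alpha>"
        unfolding virtual_coboundary_iff virtually_coboundary_def using one_cocycle G.finite_index_carrier
        by (auto intro!: bexI [of _ \<one>] exI [of _ "carrier G"])
      then have "\<one>\<^bsub>Q\<^esub> \<in> ?H" unfolding Q_one by (rule quotientI)
      then have "\<one>\<^bsub>Q\<^esub> \<otimes>\<^bsub>Q\<^esub> E `` {(L, c)} \<in> ?H #>\<^bsub>Q\<^esub> E `` {(L, c)}"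
        by (auto simp: r_coset_def)
      ultimately have "E `` {(L, c)} \<in> ?H" using A by simp
      then obtain b where b: "b \<in> virtual_coboundaries G X \<alpha>" "E `` {(L, c)} = E `` {b}"
        by (auto elim!: quotientE)
      moreover have "b \<in> V" using b(1) by (auto simp: virtual_coboundaries_def)
      ultimately have "((L, c), b) \<in> E"
        using eq_equiv_class [OF b(2) equiv_E] by blast
      then show ?thesis using virtual_coboundaries_saturated b(1) by blast
    qed
    then show "\<forall>L c. (L, c) \<in> V \<longrightarrow> virtually_coboundary L c"
      by (simp add: virtual_coboundary_iff)
  }
  assume *: "\<forall>L c. (L, c) \<in> V \<longrightarrow> virtually_coboundary L c"
  then have "V \<subseteq> virtual_coboundaries G X \<alpha>"
    by (auto simp only: virtual_coboundary_iff)
  then have "virtual_coboundaries G X \<alpha> = V" by (auto simp: virtual_coboundaries_def)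
  then have H: "?H = carrier Q" by (simp add: Q_carrier)
  have "group (Q Mod carrier Q)"
    using Q.subgroup_imp_normal [OF Q.subgroup_self] by (rule normal.factorgroup_is_group)
  moreover have "rcosets\<^bsub>Q\<^esub> carrier Q = {carrier Q}"
    using Q.coset_join2 [OF _ Q.subgroup_self] Q.one_closed by (auto simp: RCOSETS_def)
  ultimately show "trivial_group (virtual_H1 G X \<alpha>)"
    by (simp add: trivial_group_def virtual_H1_def H FactGroup_def)
qed

end

section \<open>Density of periodic points\<close>

context alg_action
begin

definition periodic_torsion :: "'x set" where
  "periodic_torsion = {x \<in> carrier X. periodic_point G \<alpha> x \<and> (\<exists>n>0. x [^] (n::nat) = \<one>)}"

lemma orbit_act:
  assumes "h \<in> carrier G" "x \<in> carrier X"
  shows "orbit G \<alpha> (\<alpha> h x) \<subseteq> orbit G \<alpha> x"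
  unfolding orbit_eq
proof (rule image_subsetI)
  fix g assume "g \<in> carrier G"
  then show "\<alpha> g (\<alpha> h x) \<in> (\<lambda>g. \<alpha> g x) ` carrier G"
    using assms by (intro image_eqI [of _ _ "g \<otimes>\<^bsub>G\<^esub> h"]) (auto simp: act_comp)
qed

lemma periodic_mult_inv:
  assumes x: "x \<in> carrier X" "periodic_point G \<alpha> x" and y: "y \<in> carrier X" "periodic_point G \<alpha> y"
  shows "periodic_point G \<alpha> (x \<otimes> inv y)"
proof (rule periodic_if_fixed)
  show "finite_index_subgroup ({g \<in> carrier G. \<alpha> g x = x} \<inter> {g \<in> carrier G. \<alpha> g y = y}) G"
    by (intro G.finite_index_Int finite_index_stabilizer assms)
qed (use x y in \<open>auto simp: act_mult act_inv\<close>)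

lemma subgroup_periodic_torsion: "subgroup periodic_torsion X"
proof -
  have one: "periodic_point G \<alpha> \<one>"
    using periodic_if_fixed [OF G.finite_index_carrier one_closed] by simp
  have diff: "x \<otimes> inv y \<in> periodic_torsion" if xy: "x \<in> periodic_torsion" "y \<in> periodic_torsion" for x y
  proof -
    obtain m n :: nat where mn: "m > 0" "n > 0" "x [^] m = \<one>" "y [^] n = \<one>"
      and c: "x \<in> carrier X" "y \<in> carrier X"
      using xy by (auto simp: periodic_torsion_def)
    have "x [^] (m * n) = (x [^] m) [^] n" "y [^] (m * n) = (y [^] n) [^] m"
      using c nat_pow_pow [of x m n] nat_pow_pow [of y n m] by (simp_all add: mult.commute)
    then have "x [^] (m * n) = \<one>" "y [^] (m * n) = \<one>"
      unfolding mn(3,4) by simp_all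
    then have "(x \<otimes> inv y) [^] (m * n) = \<one>"
      using c by (simp add: nat_pow_distrib nat_pow_inv)
    moreover have "m * n > 0" using mn by simp
    ultimately show ?thesis
      using xy periodic_mult_inv c unfolding periodic_torsion_def by blast
  qed
  have one': "\<one> \<in> periodic_torsion" using one by (auto simp: periodic_torsion_def)
  have sub: "periodic_torsion \<subseteq> carrier X" by (auto simp: periodic_torsion_def)
  have inv: "inv y \<in> periodic_torsion" if "y \<in> periodic_torsion" for y
    using diff [OF one' that] that sub by auto
  show ?thesis
  proof (rule subgroupI)
    fix x y assume xy: "x \<in> periodic_torsion" "y \<in> periodic_torsion"
    then have "x \<otimes> inv (inv y) \<in> periodic_torsion" using diff inv by blast
    then show "x \<otimes> y \<in> periodic_torsion" using xy sub by auto
  qed (use sub one' inv in auto)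
qed

lemma invariant_closure:
  assumes P: "subgroup P X" and inv: "\<And>g x. g \<in> carrier G \<Longrightarrow> x \<in> P \<Longrightarrow> \<alpha> g x \<in> P"
  shows "invariant_subgroup (T closure_of P)"
proof -
  let ?C = "T closure_of P"
  have PX: "P \<subseteq> carrier X" using subgroup.subset [OF P] .
  have CX: "?C \<subseteq> carrier X" using closure_of_subset_topspace [of T P] by simp
  have PC: "P \<subseteq> ?C" using closure_of_subset [of P T] PX by simp
  have into: "f y \<in> ?C" if "continuous_map T T f" "\<And>x. x \<in> P \<Longrightarrow> f x \<in> ?C" "y \<in> ?C" for f y
  proof -
    have "f ` ?C \<subseteq> T closure_of (f ` P)"
      using continuous_map_image_closure_subset [OF that(1)] .
    also have "\<dots> \<subseteq> T closure_of ?C"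
      using that(2) by (intro closure_of_mono) auto
    finally show ?thesis using that(3) by (auto simp: closure_of_closure_of)
  qed
  have id: "continuous_map T T (\<lambda>x. x)" by (rule continuous_map_id [unfolded id_def])
  have left: "x \<otimes> y \<in> ?C" if x: "x \<in> P" and y: "y \<in> ?C" for x y
  proof (rule into [OF _ _ y])
    show "continuous_map T T (\<lambda>y. x \<otimes> y)"
      using x PX by (intro continuous_map_mult2 continuous_map_const_in id) auto
    show "x \<otimes> z \<in> ?C" if "z \<in> P" for z
      using subgroup.m_closed [OF P x that] PC by blast
  qed
  have mult: "x \<otimes> y \<in> ?C" if x: "x \<in> ?C" and y: "y \<in> ?C" for x y
  proof (rule into [OF _ _ x])
    show "continuous_map T T (\<lambda>x. x \<otimes> y)"
      using y CX by (intro continuous_map_mult2 continuous_map_const_in id) auto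
  qed (use left y in blast)
  have "inv x \<in> ?C" if "x \<in> ?C" for x
    using subgroup.m_inv_closed [OF P] PC by (intro into [OF cont_inv _ that]) blast
  moreover have "\<one> \<in> ?C" using subgroup.one_closed [OF P] PC by blast
  ultimately have "subgroup ?C X"
    using mult CX by (intro subgroupI) auto
  moreover have "\<alpha> g x \<in> ?C" if "g \<in> carrier G" "x \<in> ?C" for g x
    using inv PC that by (intro into [OF act_cont _ that(2)]) blast+
  ultimately show ?thesis by (simp add: invariant_subgroup_def)
qed

text \<open>The subgroups of \<open>fact k\<close>-th powers descend and become constant at some
  \<open>K\<close>. Factorials make one exponent work for all \<open>n\<close> at once:
  \<open>fact K * n\<close> divides \<open>fact (K + n)\<close>, so every \<open>fact K\<close>-th
  power is a \<open>fact K * n\<close>-th power.\<close>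

lemma divisible_power:
  assumes noeth: "noetherian_dual G X T \<alpha>" and Y: "invariant_subgroup Y"
  obtains m :: nat where "m > 0" "\<And>n y. n > 0 \<Longrightarrow> y \<in> Y \<Longrightarrow> \<exists>w\<in>Y. y [^] m = w [^] (m * n)"
proof -
  note Y' = invariant_subgroupD [OF Y]
  have pow_closed: "y [^] k \<in> Y" if "y \<in> Y" for y and k :: nat
    using that subgroup.one_closed [OF Y'(1)] subgroup.m_closed [OF Y'(1)] by (induction k) auto
  define Z where "Z k = (\<lambda>y. y [^] (fact k :: nat)) ` Y" for k
  have inv: "invariant_subgroup (Z k)" for k unfolding Z_def using invariant_power [OF Y] .
  have dec: "Z (Suc k) \<subseteq> Z k" for k
    unfolding Z_def
  proof (rule image_subsetI)
    fix y assume y: "y \<in> Y"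
    have "y [^] (fact (Suc k) :: nat) = (y [^] Suc k) [^] (fact k :: nat)"
      using nat_pow_pow [OF Y'(3) [OF y], of "Suc k" "fact k"] by (simp only: fact_Suc of_nat_id)
    then show "y [^] (fact (Suc k) :: nat) \<in> (\<lambda>y. y [^] (fact k :: nat)) ` Y"
      using pow_closed [OF y] by (rule image_eqI)
  qed
  obtain K where K: "\<And>k. K \<le> k \<Longrightarrow> Z k = Z K"
    using descending_chain [where Y = Z, OF noeth inv dec] by blast
  have "\<exists>w\<in>Y. y [^] (fact K :: nat) = w [^] (fact K * n)" if n: "n > 0" and y: "y \<in> Y" for n :: nat and y
  proof -
    have "y [^] (fact K :: nat) \<in> Z (K + n)" using K [of "K + n"] y by (auto simp: Z_def)
    then obtain w where w: "w \<in> Y" "y [^] (fact K :: nat) = w [^] (fact (K + n) :: nat)"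
      unfolding Z_def by blast
    have "fact K * n dvd fact K * (fact n :: nat)"
      by (rule mult_dvd_mono [OF dvd_refl dvd_fact]) (use n in auto)
    also have "\<dots> dvd fact (K + n)" by (rule fact_fact_dvd_fact)
    finally obtain r where "fact (K + n) = fact K * n * r" by (auto simp: dvd_def)
    then have "w [^] (fact (K + n) :: nat) = (w [^] r) [^] (fact K * n)"
      using nat_pow_pow [OF Y'(3) [OF w(1)], of r "fact K * n"] by (simp add: mult.commute)
    then show ?thesis using w pow_closed [OF w(1), of r] by auto
  qed
  then show ?thesis using that [of "fact K"] by simp
qed

end

theorem dense_periodic_pointsI:
  fixes G :: "('g, 'm) monoid_scheme"
  assumes countable: "countable (carrier G)"
    and nonzero: "nonzero_periodic_points TYPE(real) G" and trivial: "trivial_virtual_H1 TYPE(real) G"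
  shows "dense_periodic_points TYPE('x) G"
  unfolding dense_periodic_points_def
proof (intro allI impI)
  fix X :: "'x monoid" and T \<alpha> assume "noetherian_action G X T \<alpha>"
  note n = noetherian_actionD [OF this]
  note noeth = n(2)
  interpret alg_action X T G \<alpha> by (rule n(1))
  define P where "P = periodic_torsion"
  define Y where "Y = T closure_of P"
  have Pp: "x \<in> P \<longleftrightarrow> x \<in> carrier X \<and> periodic_point G \<alpha> x \<and> (\<exists>n>0. x [^]\<^bsub>X\<^esub> (n::nat) = \<one>\<^bsub>X\<^esub>)" for x
    by (simp add: P_def periodic_torsion_def)
  have P: "subgroup P X" unfolding P_def by (rule subgroup_periodic_torsion)
  have P_inv: "\<alpha> g x \<in> P" if g: "g \<in> carrier G" and xP: "x \<in> P" for g x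
  proof -
    have x: "x \<in> carrier X" "periodic_point G \<alpha> x" using xP Pp by auto
    have "periodic_point G \<alpha> (\<alpha> g x)"
      using finite_subset [OF orbit_act [OF g x(1)]] x(2) by (simp add: periodic_point_def)
    moreover obtain k :: nat where "k > 0" "x [^]\<^bsub>X\<^esub> k = \<one>\<^bsub>X\<^esub>" using xP Pp by blast
    then have "\<alpha> g x [^]\<^bsub>X\<^esub> k = \<one>\<^bsub>X\<^esub>" using g x by (simp flip: act_nat_pow)
    ultimately show ?thesis using Pp g x \<open>k > 0\<close> by blast
  qed
  have Y: "invariant_subgroup Y" unfolding Y_def using invariant_closure [OF P P_inv] .
  note Y' = invariant_subgroupD [OF Y]
  have PY: "P \<subseteq> Y" unfolding Y_def using Pp by (intro closure_of_subset) auto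
  have "Y = carrier X"
  proof (rule ccontr)
    assume "Y \<noteq> carrier X"
    then obtain x0 where x0: "x0 \<in> carrier X" "x0 \<notin> Y" using Y'(3) by blast
    \<comment> \<open>Condition (1) is available for carriers that are sets of reals, so the
      quotient by \<open>Y\<close> is modelled there.\<close>
    obtain X' :: "real monoid" and T' \<alpha>' q where q: "equivariant_hom X T G \<alpha> X' T' \<alpha>' q"
      "q ` carrier X = carrier X'" "\<And>x. x \<in> carrier X \<Longrightarrow> q x = \<one>\<^bsub>X'\<^esub> \<longleftrightarrow> x \<in> Y"
      using quotient_on_reals [OF noeth countable Y] by metis
    interpret q: equivariant_hom X T G \<alpha> X' T' \<alpha>' q by fact
    have noeth': "noetherian_dual G X' T' \<alpha>'" using q.noetherian_image [OF noeth q(2)] .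
    have "carrier X' \<noteq> {\<one>\<^bsub>X'\<^esub>}" using q(3) [OF x0(1)] x0 q.q_closed by force
    then obtain x' where x': "x' \<in> carrier X'" "x' \<noteq> \<one>\<^bsub>X'\<^esub>" "periodic_point G \<alpha>' x'"
      using nonzero q.B.noetherian_actionI [OF noeth'] unfolding nonzero_periodic_points_def by meson
    obtain z and n :: nat where z: "z \<in> carrier X'" "z \<noteq> \<one>\<^bsub>X'\<^esub>" "periodic_point G \<alpha>' z"
        "n > 0" "z [^]\<^bsub>X'\<^esub> n = \<one>\<^bsub>X'\<^esub>"
      using q.B.periodic_torsion_point [OF noeth' x'] by metis
    obtain x where x: "x \<in> carrier X" "z = q x" using z(1) q(2) by blast
    have "q (x [^]\<^bsub>X\<^esub> n) = \<one>\<^bsub>X'\<^esub>" using z(5) x by (simp add: q.q.hom_nat_pow)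
    then have xn: "x [^]\<^bsub>X\<^esub> n \<in> Y" using q(3) x by simp
    obtain m :: nat where m: "m > 0" "\<And>n y. n > 0 \<Longrightarrow> y \<in> Y \<Longrightarrow> \<exists>w\<in>Y. y [^]\<^bsub>X\<^esub> m = w [^]\<^bsub>X\<^esub> (m * n)"
      using divisible_power [OF noeth Y] by metis
    obtain w where w: "w \<in> Y" "(x [^]\<^bsub>X\<^esub> n) [^]\<^bsub>X\<^esub> m = w [^]\<^bsub>X\<^esub> (m * n)"
      using m(2) [OF z(4) xn] by blast
    have wX: "w \<in> carrier X" using Y'(3) w(1) .
    define N where "N = m * n"
    have N: "N > 0" using m z by (simp add: N_def)
    have xN: "x [^]\<^bsub>X\<^esub> N = w [^]\<^bsub>X\<^esub> N"
      using w(2) nat_pow_pow [OF x(1), of n m] by (simp add: N_def mult.commute)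
    \<comment> \<open>Since \<open>w\<close> lies in \<open>Y\<close>, the point \<open>y\<close>
      has the same image in the quotient as \<open>x\<close>, but unlike \<open>x\<close> it is
      known to be torsion.\<close>
    define y where "y = x \<otimes>\<^bsub>X\<^esub> inv\<^bsub>X\<^esub> w"
    have yX: "y \<in> carrier X" using x wX by (simp add: y_def)
    have yN: "y [^]\<^bsub>X\<^esub> N = \<one>\<^bsub>X\<^esub>"
      using x wX xN by (simp add: y_def nat_pow_distrib nat_pow_inv)
    have "q w = \<one>\<^bsub>X'\<^esub>" using q(3) [OF wX] w(1) by simp
    then have qy: "q y = z" using x wX z(1) by (simp add: y_def)
    then have yY: "y \<notin> Y" using q(3) [OF yX] z(2) by simp
    \<comment> \<open>The cocycle of \<open>y\<close> takes its values here. The bounded exponent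
      makes \<open>W\<close> zero-dimensional, and \<open>U\<close> is its copy on a set of reals,
      to which condition (2) applies.\<close>
    define W where "W = {v \<in> Y. v [^]\<^bsub>X\<^esub> N = \<one>\<^bsub>X\<^esub>}"
    have W: "invariant_subgroup W" unfolding W_def using invariant_torsion [OF Y] .
    note W' = invariant_subgroupD [OF W]
    interpret W: alg_action "sub_group W" "subtopology T W" G "sub_action W"
      by (rule alg_action_sub [OF W])
    obtain U :: "real monoid" and T'' \<beta> r where r: "equivariant_hom (sub_group W) (subtopology T W) G (sub_action W) U T'' \<beta> r"
      "bij_betw r (carrier (sub_group W)) (carrier U)" "noetherian_action G U T'' \<beta>"
      using W.isomorphic_to_real_action [OF noetherian_sub [OF noeth W] countable] by metis
    interpret r: equivariant_hom "sub_group W" "subtopology T W" G "sub_action W" U T'' \<beta> r by fact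
    have r_inj: "inj_on r W" and r_surj: "r ` W = carrier U" using r(2) by (auto simp: bij_betw_def)
    have r_mult: "r (v \<otimes>\<^bsub>X\<^esub> w) = r v \<otimes>\<^bsub>U\<^esub> r w" if "v \<in> W" "w \<in> W" for v w
      using r.q_mult [of v w] that by simp
    have r_closed: "r v \<in> carrier U" if "v \<in> W" for v using r.q_closed [of v] that by simp
    have r_act: "r (\<alpha> g v) = \<beta> g (r v)" if "g \<in> carrier G" "v \<in> W" for g v
      using r.q_equiv [of g v] that by simp
    have r_inv: "r (inv\<^bsub>X\<^esub> v) = inv\<^bsub>U\<^esub> r v" if "v \<in> W" for v
      using r.q.hom_inv [of v] that W'(1) by simp
    have "zero_dimensional U T''"
    proof (rule r.B.zero_dimensional_if_bounded_torsion [OF N])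
      fix u assume "u \<in> carrier U"
      then obtain v where v: "v \<in> W" "u = r v" using r_surj by blast
      have "v [^]\<^bsub>sub_group W\<^esub> N = \<one>\<^bsub>X\<^esub>" using v(1) by (simp add: W_def nat_pow_def)
      then have "r v [^]\<^bsub>U\<^esub> N = r \<one>\<^bsub>X\<^esub>" using r.q.hom_nat_pow [of v N] v(1) by simp
      then show "u [^]\<^bsub>U\<^esub> N = \<one>\<^bsub>U\<^esub>" using v(2) r.q.hom_one by simp
    qed
    then have H1: "\<And>L c. (L, c) \<in> virtual_cocycles G U \<beta> \<Longrightarrow> r.B.virtually_coboundary L c"
      using trivial r(3) r.B.trivial_virtual_H1_iff unfolding trivial_virtual_H1_def by meson
    \<comment> \<open>Stabilising the image \<open>z\<close>, which has a finite orbit although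
      \<open>y\<close> may not, is what keeps \<open>c g\<close> inside \<open>Y\<close>.\<close>
    define L where "L = {g \<in> carrier G. \<alpha>' g z = z}"
    have L: "finite_index_subgroup L G" unfolding L_def using q.B.finite_index_stabilizer z by blast
    define c where "c g = \<alpha> g y \<otimes>\<^bsub>X\<^esub> inv\<^bsub>X\<^esub> y" for g
    have LG: "g \<in> carrier G" if "g \<in> L" for g using that by (simp add: L_def)
    have cW: "c g \<in> W" if g: "g \<in> L" for g
    proof -
      have "q (c g) = \<alpha>' g z \<otimes>\<^bsub>X'\<^esub> inv\<^bsub>X'\<^esub> z"
        using LG [OF g] yX by (simp add: c_def qy q.q_equiv)
      also have "\<dots> = \<one>\<^bsub>X'\<^esub>" using g z(1) by (simp add: L_def)
      finally have "c g \<in> Y" using q(3) [of "c g"] LG [OF g] yX by (simp add: c_def)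
      moreover have "c g [^]\<^bsub>X\<^esub> N = \<one>\<^bsub>X\<^esub>"
        using LG [OF g] yX yN by (simp add: c_def nat_pow_distrib nat_pow_inv flip: act_nat_pow)
      ultimately show ?thesis by (simp add: W_def)
    qed
    have "(L, restrict (\<lambda>g. r (c g)) L) \<in> virtual_cocycles G U \<beta>"
    proof (rule r.B.virtual_cocycleI [OF L])
      show "r (c g) \<in> carrier U" if "g \<in> L" for g using r_closed cW that by blast
      fix g h assume g: "g \<in> L" and h: "h \<in> L"
      have gG: "g \<in> carrier G" "h \<in> carrier G" using LG g h by auto
      have "c (g \<otimes>\<^bsub>G\<^esub> h) = c g \<otimes>\<^bsub>X\<^esub> \<alpha> g (c h)"
      proof -
        have "c g \<otimes>\<^bsub>X\<^esub> \<alpha> g (c h) = \<alpha> g y \<otimes>\<^bsub>X\<^esub> (inv\<^bsub>X\<^esub> \<alpha> g y \<otimes>\<^bsub>X\<^esub> (\<alpha> g (\<alpha> h y) \<otimes>\<^bsub>X\<^esub> inv\<^bsub>X\<^esub> y))"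
          using gG yX by (simp add: c_def act_mult act_inv m_ac)
        then show ?thesis using gG yX by (simp add: c_def act_comp mult_inv_cancel)
      qed
      then show "r (c (g \<otimes>\<^bsub>G\<^esub> h)) = r (c g) \<otimes>\<^bsub>U\<^esub> \<beta> g (r (c h))"
        using gG cW [OF g] cW [OF h] W'(4) by (simp add: r_mult r_act)
    qed
    then obtain u M where M: "u \<in> carrier U" "finite_index_subgroup M G" "M \<subseteq> L"
        "\<forall>g\<in>M. restrict (\<lambda>g. r (c g)) L g = \<beta> g u \<otimes>\<^bsub>U\<^esub> inv\<^bsub>U\<^esub> u"
      using H1 unfolding r.B.virtually_coboundary_def by meson
    obtain v where v: "v \<in> W" "u = r v" using M(1) r_surj by blast
    have vX: "v \<in> carrier X" using W'(3) v(1) .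
    have cv: "c g = \<alpha> g v \<otimes>\<^bsub>X\<^esub> inv\<^bsub>X\<^esub> v" if g: "g \<in> M" for g
    proof -
      have gL: "g \<in> L" and gG: "g \<in> carrier G" using g M(3) LG by auto
      have "inv\<^bsub>X\<^esub> v \<in> W" "\<alpha> g v \<in> W" using v(1) W'(4) gG subgroup.m_inv_closed [OF W'(1)] by auto
      moreover then have "\<alpha> g v \<otimes>\<^bsub>X\<^esub> inv\<^bsub>X\<^esub> v \<in> W" using subgroup.m_closed [OF W'(1)] by blast
      moreover have "r (c g) = \<beta> g u \<otimes>\<^bsub>U\<^esub> inv\<^bsub>U\<^esub> u" using M(4) g gL by auto
      ultimately show ?thesis
        using inj_onD [OF r_inj, of "c g" "\<alpha> g v \<otimes>\<^bsub>X\<^esub> inv\<^bsub>X\<^esub> v"] cW [OF gL] v gG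
        by (simp add: r_mult r_act r_inv)
    qed
    define t where "t = y \<otimes>\<^bsub>X\<^esub> inv\<^bsub>X\<^esub> v"
    have tX: "t \<in> carrier X" using yX vX by (simp add: t_def)
    have "\<alpha> g t = t" if g: "g \<in> M" for g
    proof -
      have gG: "g \<in> carrier G" using g M(3) LG by auto
      have "\<alpha> g t = \<alpha> g y \<otimes>\<^bsub>X\<^esub> inv\<^bsub>X\<^esub> \<alpha> g v" using gG yX vX by (simp add: t_def act_mult act_inv)
      also have "\<alpha> g y = c g \<otimes>\<^bsub>X\<^esub> y" using gG yX by (simp add: c_def m_assoc)
      also have "\<dots> = \<alpha> g v \<otimes>\<^bsub>X\<^esub> inv\<^bsub>X\<^esub> v \<otimes>\<^bsub>X\<^esub> y" using cv [OF g] by simp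
      also have "\<dots> \<otimes>\<^bsub>X\<^esub> inv\<^bsub>X\<^esub> \<alpha> g v = \<alpha> g v \<otimes>\<^bsub>X\<^esub> (inv\<^bsub>X\<^esub> \<alpha> g v \<otimes>\<^bsub>X\<^esub> t)"
        using gG yX vX by (simp add: t_def m_ac)
      also have "\<dots> = t" using gG vX tX by (intro mult_inv_cancel) auto
      finally show ?thesis .
    qed
    then have "periodic_point G \<alpha> t" using periodic_if_fixed [OF M(2) tX] by blast
    moreover have "t [^]\<^bsub>X\<^esub> N = \<one>\<^bsub>X\<^esub>"
      using yX vX yN v(1) by (simp add: t_def nat_pow_distrib nat_pow_inv W_def)
    ultimately have "t \<in> Y" using Pp tX N PY by blast
    moreover have "v \<in> Y" using v(1) by (simp add: W_def)
    ultimately have "t \<otimes>\<^bsub>X\<^esub> v \<in> Y" using subgroup.m_closed [OF Y'(1)] by blast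
    moreover have "t \<otimes>\<^bsub>X\<^esub> v = y" using yX vX by (simp add: t_def m_assoc)
    ultimately show False using yY by simp
  qed
  then have "T closure_of P = carrier X" by (simp add: Y_def)
  moreover have "T closure_of P \<subseteq> T closure_of {x \<in> carrier X. periodic_point G \<alpha> x}"
    using Pp by (intro closure_of_mono) auto
  ultimately show "T closure_of {x \<in> carrier X. periodic_point G \<alpha> x} = topspace T"
    using closure_of_subset_topspace [of T] by (metis subset_antisym topspace_eq)
qed

section \<open>The extension of an action defined by a virtual cocycle\<close>

context alg_action
begin

lemma act_int_pow:
  assumes "g \<in> carrier G" "x \<in> carrier X"
  shows "\<alpha> g (x [^] (i::int)) = \<alpha> g x [^] i"
  by (cases i rule: int_cases2) (simp_all only: int_pow_int int_pow_neg_int act_nat_pow act_inv assms nat_pow_closed act_closed)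

lemma act_finprod:
  assumes "g \<in> carrier G"
  shows "f \<in> A \<rightarrow> carrier X \<Longrightarrow> \<alpha> g (finprod X f A) = finprod X (\<lambda>p. \<alpha> g (f p)) A"
proof (induction A rule: infinite_finite_induct)
  case (insert a A)
  have fA: "f \<in> A \<rightarrow> carrier X" and fa: "f a \<in> carrier X" using insert.prems by auto
  have "finprod X f (insert a A) = f a \<otimes> finprod X f A"
    using insert.hyps fA fa by (rule finprod_insert)
  moreover have "finprod X (\<lambda>p. \<alpha> g (f p)) (insert a A) = \<alpha> g (f a) \<otimes> finprod X (\<lambda>p. \<alpha> g (f p)) A"
    using insert.hyps fA fa assms by (intro finprod_insert) auto
  ultimately show ?case
    using insert.IH [OF fA] fA fa assms by (simp add: act_mult)
qed (use assms in simp_all)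

lemma int_pow_mod:
  assumes "x \<in> carrier X" "x [^] (n::nat) = \<one>"
  shows "x [^] (i mod int n) = x [^] (i::int)"
proof -
  have "x [^] i = x [^] (int n * (i div int n) + i mod int n)" by simp
  also have "\<dots> = x [^] (int n * (i div int n)) \<otimes> x [^] (i mod int n)"
    using assms(1) by (rule int_pow_mult)
  also have "x [^] (int n * (i div int n)) = \<one>"
    using assms int_pow_pow [OF assms(1), of "int n" "i div int n"] by (simp add: int_pow_int)
  finally show ?thesis using assms(1) by simp
qed

end

text \<open>The exponent \<open>n\<close> lets powers in \<open>X\<close> depend on residues modulo
  \<open>n\<close> only. The bound \<open>1 < n\<close> makes \<open>1\<close> one of the standard
  residues, so that indicators of cosets belong to \<open>B\<close>.\<close>

locale cocycle_extension = alg_action X T G \<alpha>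
  for X :: "('x, 'n) monoid_scheme" (structure) and T :: "'x topology"
    and G :: "('g, 'm) monoid_scheme" and \<alpha> :: "'g \<Rightarrow> 'x \<Rightarrow> 'x" +
  fixes n :: nat and L :: "'g set" and c :: "'g \<Rightarrow> 'x"
  assumes n: "1 < n" and exponent: "x \<in> carrier X \<Longrightarrow> x [^] n = \<one>"
    and cocycle: "(L, c) \<in> virtual_cocycles G X \<alpha>"
begin

lemmas c = virtual_cocycleD [OF cocycle]

lemma L_subset: "L \<subseteq> carrier G" using c(3) by blast

definition I :: "'g set set" where
  "I = rcosets\<^bsub>G\<^esub> L"

text \<open>Choosing the unit as representative of \<open>L\<close> makes \<open>shapiro g L\<close>
  equal to \<open>c g\<close> for \<open>g\<close> in \<open>L\<close>, and not merely cohomologous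
  to it.\<close>

definition rep :: "'g set \<Rightarrow> 'g" where
  "rep p = (if p = L then \<one>\<^bsub>G\<^esub> else SOME x. x \<in> p)"

text \<open>The library provides right cosets; \<open>g\<close> acts on them by right multiplication with its inverse.\<close>

definition move :: "'g \<Rightarrow> 'g set \<Rightarrow> 'g set" where
  "move g p = p #>\<^bsub>G\<^esub> inv\<^bsub>G\<^esub> g"

text \<open>The element of \<open>L\<close> by which the representative of \<open>move g p\<close>
  differs from \<open>rep p\<close> times the inverse of \<open>g\<close>.\<close>

definition lam :: "'g \<Rightarrow> 'g set \<Rightarrow> 'g" where
  "lam g p = rep (move g p) \<otimes>\<^bsub>G\<^esub> g \<otimes>\<^bsub>G\<^esub> inv\<^bsub>G\<^esub> rep p"

text \<open>The image of \<open>c\<close> under Shapiro's isomorphism, a cocycle of \<open>G\<close> with values in the maps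
  from cosets to \<open>X\<close>.\<close>

definition shapiro :: "'g \<Rightarrow> 'g set \<Rightarrow> 'x" where
  "shapiro g p = \<alpha> (inv\<^bsub>G\<^esub> rep (move g p)) (c (lam g p))"

text \<open>The pairing of the Shapiro cocycle with an integer vector indexed by the cosets; it is
  the off-diagonal entry of the extended action.\<close>

definition twist :: "'g \<Rightarrow> ('g set \<Rightarrow> int) \<Rightarrow> 'x" where
  "twist g k = finprod X (\<lambda>p. shapiro g p [^] k p) I"

definition B :: "('g set \<Rightarrow> int) monoid" where
  "B = product_group I (\<lambda>_. integer_mod_group n)"

definition shift :: "'g \<Rightarrow> ('g set \<Rightarrow> int) \<Rightarrow> 'g set \<Rightarrow> int" where
  "shift g k = (\<lambda>p\<in>I. k (move (inv\<^bsub>G\<^esub> g) p))"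

definition ext_group :: "('x \<times> ('g set \<Rightarrow> int)) monoid" where
  "ext_group = X \<times>\<times> B"

definition ext_topology :: "('x \<times> ('g set \<Rightarrow> int)) topology" where
  "ext_topology = prod_topology T (discrete_topology (carrier B))"

text \<open>A triangular action: \<open>X\<close> sits inside as an invariant subgroup,
  \<open>G\<close> permutes the coordinates of the quotient \<open>B\<close>, and
  \<open>twist\<close> glues the two.\<close>

definition ext_action :: "'g \<Rightarrow> 'x \<times> ('g set \<Rightarrow> int) \<Rightarrow> 'x \<times> ('g set \<Rightarrow> int)" where
  "ext_action g = (\<lambda>z\<in>carrier X \<times> carrier B. (\<alpha> g (fst z) \<otimes> twist g (snd z), shift g (snd z)))"

section \<open>Cosets, their representatives, and the Shapiro cocycle\<close>

lemma finite_I: "finite I"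
  using c(1) by (simp add: I_def finite_index_subgroup_def)

lemma I_iff: "p \<in> I \<longleftrightarrow> (\<exists>a\<in>carrier G. p = L #>\<^bsub>G\<^esub> a)"
  by (auto simp: I_def RCOSETS_def)

lemma L_in_I: "L \<in> I"
  using G.coset_join2 [OF G.one_closed c(2)] subgroup.one_closed [OF c(2)] unfolding I_iff by (metis G.one_closed)

lemma rep:
  assumes "p \<in> I"
  shows "rep p \<in> carrier G" "L #>\<^bsub>G\<^esub> rep p = p"
proof -
  obtain a where a: "a \<in> carrier G" "p = L #>\<^bsub>G\<^esub> a" using assms I_iff by blast
  have "rep p \<in> p"
  proof (cases "p = L")
    case True
    then show ?thesis using subgroup.one_closed [OF c(2)] by (simp add: rep_def)
  next
    case False
    have "(SOME x. x \<in> p) \<in> p"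
      using G.rcos_self [OF a(1) c(2)] a(2) by (intro someI) blast
    then show ?thesis using False by (simp add: rep_def)
  qed
  then have r: "rep p \<in> L #>\<^bsub>G\<^esub> a" using a(2) by simp
  show "rep p \<in> carrier G" using r G.r_coset_subset_G [OF L_subset a(1)] by blast
  show "L #>\<^bsub>G\<^esub> rep p = p" using G.repr_independence [OF r a(1) c(2)] a(2) by simp
qed

lemma move_coset: "a \<in> carrier G \<Longrightarrow> g \<in> carrier G \<Longrightarrow> move g (L #>\<^bsub>G\<^esub> a) = L #>\<^bsub>G\<^esub> (a \<otimes>\<^bsub>G\<^esub> inv\<^bsub>G\<^esub> g)"
  unfolding move_def by (rule G.coset_mult_assoc [OF L_subset]) auto

lemma move_closed: "p \<in> I \<Longrightarrow> g \<in> carrier G \<Longrightarrow> move g p \<in> I"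
  unfolding I_iff using move_coset by (metis G.inv_closed G.m_closed)

lemma move_mult:
  assumes "p \<in> I" "g \<in> carrier G" "h \<in> carrier G"
  shows "move (g \<otimes>\<^bsub>G\<^esub> h) p = move g (move h p)"
proof -
  obtain a where a: "a \<in> carrier G" "p = L #>\<^bsub>G\<^esub> a" using assms(1) I_iff by blast
  then show ?thesis using assms by (simp add: move_coset G.inv_mult_group G.m_assoc)
qed

lemma move_one: "p \<in> I \<Longrightarrow> move \<one>\<^bsub>G\<^esub> p = p"
proof -
  assume "p \<in> I"
  then obtain a where a: "a \<in> carrier G" "p = L #>\<^bsub>G\<^esub> a" using I_iff by blast
  then show ?thesis by (simp add: move_coset)
qed

lemma move_inv: "p \<in> I \<Longrightarrow> g \<in> carrier G \<Longrightarrow> move (inv\<^bsub>G\<^esub> g) (move g p) = p"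
  "p \<in> I \<Longrightarrow> g \<in> carrier G \<Longrightarrow> move g (move (inv\<^bsub>G\<^esub> g) p) = p"
  by (simp_all add: move_one flip: move_mult)

lemma lam_in:
  assumes p: "p \<in> I" and g: "g \<in> carrier G"
  shows "lam g p \<in> L"
proof -
  have r: "rep p \<in> carrier G" "rep (move g p) \<in> carrier G"
    using rep p move_closed g by auto
  have "L #>\<^bsub>G\<^esub> (rep p \<otimes>\<^bsub>G\<^esub> inv\<^bsub>G\<^esub> g) = move g p"
    using move_coset [OF r(1) g] rep(2) [OF p] by simp
  also have "\<dots> = L #>\<^bsub>G\<^esub> rep (move g p)"
    using rep(2) [OF move_closed [OF p g]] by simp
  finally have "rep (move g p) \<otimes>\<^bsub>G\<^esub> inv\<^bsub>G\<^esub> (rep p \<otimes>\<^bsub>G\<^esub> inv\<^bsub>G\<^esub> g) \<in> L"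
    using G.rcoset_eq_iff [OF c(2)] r g by (metis G.inv_closed G.m_closed)
  then show ?thesis using r g by (simp add: lam_def G.inv_mult_group G.m_assoc)
qed

lemma lam_closed: "p \<in> I \<Longrightarrow> g \<in> carrier G \<Longrightarrow> lam g p \<in> carrier G"
  using lam_in c(3) by blast

lemma shapiro_closed [simp, intro]: "p \<in> I \<Longrightarrow> g \<in> carrier G \<Longrightarrow> shapiro g p \<in> carrier X"
  unfolding shapiro_def using rep(1) [OF move_closed] c(4) [OF lam_in] by blast

text \<open>The intermediate representative cancels, so \<open>lam\<close> at a product is the
  product of its values along the two moves. The cocycle identity of \<open>c\<close> then gives
  that of \<open>shapiro\<close>.\<close>

lemma shapiro_mult:
  assumes p: "p \<in> I" and g: "g \<in> carrier G" and h: "h \<in> carrier G"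
  shows "shapiro (g \<otimes>\<^bsub>G\<^esub> h) p = shapiro g (move h p) \<otimes> \<alpha> g (shapiro h p)"
proof -
  define q where "q = move h p"
  have q: "q \<in> I" using move_closed p h by (simp add: q_def)
  define s where "s = rep (move g q)"
  have r: "rep p \<in> carrier G" "rep q \<in> carrier G" "s \<in> carrier G"
    using rep(1) p q move_closed [OF q g] by (auto simp: s_def)
  have gh: "move (g \<otimes>\<^bsub>G\<^esub> h) p = move g q" using move_mult p g h by (simp add: q_def)
  have lam: "lam g q = s \<otimes>\<^bsub>G\<^esub> g \<otimes>\<^bsub>G\<^esub> inv\<^bsub>G\<^esub> rep q" "lam h p = rep q \<otimes>\<^bsub>G\<^esub> h \<otimes>\<^bsub>G\<^esub> inv\<^bsub>G\<^esub> rep p"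
    "lam (g \<otimes>\<^bsub>G\<^esub> h) p = s \<otimes>\<^bsub>G\<^esub> (g \<otimes>\<^bsub>G\<^esub> h) \<otimes>\<^bsub>G\<^esub> inv\<^bsub>G\<^esub> rep p"
    by (simp_all add: lam_def gh s_def q_def)
  have cancel: "inv\<^bsub>G\<^esub> a \<otimes>\<^bsub>G\<^esub> (a \<otimes>\<^bsub>G\<^esub> b) = b" if "a \<in> carrier G" "b \<in> carrier G" for a b
    using that by (simp flip: G.m_assoc)
  have "lam (g \<otimes>\<^bsub>G\<^esub> h) p = lam g q \<otimes>\<^bsub>G\<^esub> lam h p"
    unfolding lam using r g h by (simp add: G.m_assoc cancel)
  then have "c (lam (g \<otimes>\<^bsub>G\<^esub> h) p) = c (lam g q) \<otimes> \<alpha> (lam g q) (c (lam h p))"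
    using c(6) [OF lam_in lam_in] p q g h by simp
  then have "shapiro (g \<otimes>\<^bsub>G\<^esub> h) p = \<alpha> (inv\<^bsub>G\<^esub> s) (c (lam g q) \<otimes> \<alpha> (lam g q) (c (lam h p)))"
    by (simp add: shapiro_def gh s_def)
  also have "\<dots> = \<alpha> (inv\<^bsub>G\<^esub> s) (c (lam g q)) \<otimes> \<alpha> (inv\<^bsub>G\<^esub> s \<otimes>\<^bsub>G\<^esub> lam g q) (c (lam h p))"
    using r p q g h lam_closed c(4) [OF lam_in] by (simp add: act_mult act_comp)
  also have "inv\<^bsub>G\<^esub> s \<otimes>\<^bsub>G\<^esub> lam g q = g \<otimes>\<^bsub>G\<^esub> inv\<^bsub>G\<^esub> rep q"
    unfolding lam using r g by (simp add: G.m_assoc cancel)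
  also have "\<alpha> (g \<otimes>\<^bsub>G\<^esub> inv\<^bsub>G\<^esub> rep q) (c (lam h p)) = \<alpha> g (shapiro h p)"
    using r g p h c(4) [OF lam_in] by (simp add: act_comp shapiro_def q_def)
  finally show ?thesis by (simp add: shapiro_def s_def q_def)
qed

lemma shapiro_one:
  assumes "p \<in> I"
  shows "shapiro \<one>\<^bsub>G\<^esub> p = \<one>"
proof -
  have "shapiro \<one>\<^bsub>G\<^esub> p \<otimes> shapiro \<one>\<^bsub>G\<^esub> p = shapiro \<one>\<^bsub>G\<^esub> p"
    using shapiro_mult [OF assms G.one_closed G.one_closed] assms by (simp add: move_one)
  then show ?thesis using assms by simp
qed

lemma shapiro_base:
  assumes g: "g \<in> L"
  shows "shapiro g L = c g"
proof -
  have gG: "g \<in> carrier G" using g c(3) by blast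
  have "move g L = L"
    unfolding move_def using gG subgroup.m_inv_closed [OF c(2) g] by (intro G.coset_join2 c(2)) auto
  then show ?thesis
    using gG c(4) [OF g] by (simp add: shapiro_def lam_def rep_def)
qed

section \<open>The finite group of residue vectors and the twist\<close>

lemma B_carrier: "carrier B = I \<rightarrow>\<^sub>E {0..<int n}"
  using n by (simp add: B_def carrier_integer_mod_group)

lemma B_mult: "k \<otimes>\<^bsub>B\<^esub> l = (\<lambda>p\<in>I. (k p + l p) mod int n)"
  by (simp add: B_def)

lemma B_one: "\<one>\<^bsub>B\<^esub> = (\<lambda>p\<in>I. 0)"
  by (simp add: B_def)

sublocale B: comm_group B
proof -
  have "group B" unfolding B_def by simp
  then show "comm_group B"
    by (rule group.group_comm_groupI) (auto simp: B_mult add.commute)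
qed

lemma finite_B: "finite (carrier B)"
  unfolding B_carrier using finite_I by (intro finite_PiE) auto

lemma twist_closed [simp, intro]: "g \<in> carrier G \<Longrightarrow> twist g k \<in> carrier X"
  unfolding twist_def by (intro finprod_closed) auto

lemma shift_closed [simp, intro]: "g \<in> carrier G \<Longrightarrow> k \<in> carrier B \<Longrightarrow> shift g k \<in> carrier B"
  unfolding B_carrier shift_def using move_closed [OF _ G.inv_closed] by (auto simp: PiE_iff)

text \<open>Addition in \<open>B\<close> is reduced modulo \<open>n\<close>; powers in
  \<open>X\<close> do not see the reduction, because \<open>n\<close> is an exponent of
  \<open>X\<close>.\<close>

lemma twist_mult:
  assumes g: "g \<in> carrier G"
  shows "twist g (k \<otimes>\<^bsub>B\<^esub> l) = twist g k \<otimes> twist g l"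
proof -
  have "twist g (k \<otimes>\<^bsub>B\<^esub> l) = finprod X (\<lambda>p. shapiro g p [^] k p \<otimes> shapiro g p [^] l p) I"
    unfolding twist_def
  proof (rule finprod_cong')
    fix p assume p: "p \<in> I"
    then show "shapiro g p [^] (k \<otimes>\<^bsub>B\<^esub> l) p = shapiro g p [^] k p \<otimes> shapiro g p [^] l p"
      using int_pow_mod [OF shapiro_closed [OF p g] exponent [OF shapiro_closed [OF p g]], of "k p + l p"] g
      by (simp add: B_mult int_pow_mult)
  qed (use g in auto)
  also have "\<dots> = twist g k \<otimes> twist g l"
    unfolding twist_def using g by (intro finprod_multf) auto
  finally show ?thesis .
qed

lemma twist_one_left: "twist \<one>\<^bsub>G\<^esub> k = \<one>"
  unfolding twist_def by (rule finprod_one_eqI) (simp add: shapiro_one)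

lemma twist_one_right: "twist g \<one>\<^bsub>B\<^esub> = \<one>"
  unfolding twist_def by (rule finprod_one_eqI) (simp add: B_one)

text \<open>The cocycle identity of \<open>shapiro\<close>, multiplied over all cosets; reindexing
  one factor along the bijection \<open>move h\<close> turns \<open>k\<close> into
  \<open>shift h k\<close>. This is precisely what makes \<open>ext_action\<close> compatible with
  products in \<open>G\<close>.\<close>

lemma twist_comp:
  assumes g: "g \<in> carrier G" and h: "h \<in> carrier G"
  shows "twist (g \<otimes>\<^bsub>G\<^esub> h) k = \<alpha> g (twist h k) \<otimes> twist g (shift h k)"
proof -
  have bij: "move h ` I = I"
  proof
    show "move h ` I \<subseteq> I" using move_closed h by blast
    show "I \<subseteq> move h ` I"
    proof
      fix p assume "p \<in> I"
      then show "p \<in> move h ` I"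
        using move_inv(2) [OF _ h] move_closed [OF _ G.inv_closed [OF h]] by (metis imageI)
    qed
  qed
  have inj: "inj_on (move h) I" using move_inv(1) h by (metis inj_onI)
  have "twist g (shift h k) = finprod X (\<lambda>p. shapiro g p [^] shift h k p) (move h ` I)"
    by (simp add: twist_def bij)
  also have "\<dots> = finprod X (\<lambda>p. shapiro g (move h p) [^] shift h k (move h p)) I"
    using inj bij g by (intro finprod_reindex) auto
  also have "\<dots> = finprod X (\<lambda>p. shapiro g (move h p) [^] k p) I"
    using g h move_closed move_inv by (intro finprod_cong') (auto simp: shift_def)
  finally have shift: "twist g (shift h k) = finprod X (\<lambda>p. shapiro g (move h p) [^] k p) I" .
  have act: "\<alpha> g (twist h k) = finprod X (\<lambda>p. \<alpha> g (shapiro h p) [^] k p) I"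
  proof -
    have "\<alpha> g (twist h k) = finprod X (\<lambda>p. \<alpha> g (shapiro h p [^] k p)) I"
      unfolding twist_def using h by (intro act_finprod [OF g]) auto
    also have "\<dots> = finprod X (\<lambda>p. \<alpha> g (shapiro h p) [^] k p) I"
      using g h by (intro finprod_cong') (auto simp: act_int_pow)
    finally show ?thesis .
  qed
  have "twist (g \<otimes>\<^bsub>G\<^esub> h) k = finprod X (\<lambda>p. \<alpha> g (shapiro h p) [^] k p \<otimes> shapiro g (move h p) [^] k p) I"
    unfolding twist_def
  proof (rule finprod_cong')
    fix p assume p: "p \<in> I"
    show "shapiro (g \<otimes>\<^bsub>G\<^esub> h) p [^] k p = \<alpha> g (shapiro h p) [^] k p \<otimes> shapiro g (move h p) [^] k p"
      using p g h move_closed by (simp add: shapiro_mult m_comm int_pow_mult_distrib)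
  qed (use g h move_closed in auto)
  also have "\<dots> = \<alpha> g (twist h k) \<otimes> twist g (shift h k)"
    unfolding act shift using g h move_closed by (intro finprod_multf) auto
  finally show ?thesis .
qed

lemma shift_mult: "g \<in> carrier G \<Longrightarrow> shift g (k \<otimes>\<^bsub>B\<^esub> l) = shift g k \<otimes>\<^bsub>B\<^esub> shift g l"
  using move_closed [OF _ G.inv_closed] by (auto simp: shift_def B_mult)

lemma shift_comp:
  assumes "g \<in> carrier G" "h \<in> carrier G"
  shows "shift (g \<otimes>\<^bsub>G\<^esub> h) k = shift g (shift h k)"
proof
  fix p show "shift (g \<otimes>\<^bsub>G\<^esub> h) k p = shift g (shift h k) p"
    using assms move_closed [OF _ G.inv_closed, of p g] move_mult [of p "inv\<^bsub>G\<^esub> h" "inv\<^bsub>G\<^esub> g"]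
    by (simp add: shift_def G.inv_mult_group)
qed

lemma shift_one: "k \<in> carrier B \<Longrightarrow> shift \<one>\<^bsub>G\<^esub> k = k"
  unfolding B_carrier shift_def by (rule extensionalityI [of _ I]) (auto simp: move_one PiE_iff)

section \<open>The extended group as a Noetherian action\<close>

lemma ext_carrier [simp]: "carrier ext_group = carrier X \<times> carrier B"
  and ext_mult: "(x, k) \<otimes>\<^bsub>ext_group\<^esub> (y, l) = (x \<otimes> y, k \<otimes>\<^bsub>B\<^esub> l)"
  and ext_one: "\<one>\<^bsub>ext_group\<^esub> = (\<one>, \<one>\<^bsub>B\<^esub>)"
  by (simp_all add: ext_group_def)

lemma ext_comm_group: "comm_group ext_group"
proof -
  have "group ext_group" unfolding ext_group_def by (rule DirProd_group) (rule is_group, rule B.is_group)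
  then show ?thesis
    by (rule group.group_comm_groupI) (auto simp: ext_mult m_comm B.m_comm)
qed

lemma ext_compact_metrizable: "compact_metrizable_abelian_group ext_group ext_topology"
  unfolding compact_metrizable_abelian_group_def
proof (intro conjI ext_comm_group)
  let ?D = "discrete_topology (carrier B)"
  show "topspace ext_topology = carrier ext_group" by (simp add: ext_topology_def)
  show "compact_space ext_topology"
    using compact finite_B by (simp add: ext_topology_def compact_space_prod_topology compact_space_discrete_topology)
  show "metrizable_space ext_topology"
    using metrizable by (simp add: ext_topology_def metrizable_space_prod_topology)
  let ?Z = "prod_topology ext_topology ext_topology"
  have f: "continuous_map ?Z ext_topology fst" "continuous_map ?Z ext_topology snd"
    by (rule continuous_map_fst continuous_map_snd)+
  have T1: "continuous_map ext_topology T fst" and D1: "continuous_map ext_topology ?D snd"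
    unfolding ext_topology_def by (rule continuous_map_fst continuous_map_snd)+
  have x: "continuous_map ?Z T (\<lambda>z. fst (fst z))" "continuous_map ?Z T (\<lambda>z. fst (snd z))"
    using continuous_map_compose [OF f(1) T1] continuous_map_compose [OF f(2) T1] by (simp_all add: o_def)
  have k: "continuous_map ?Z ?D (\<lambda>z. snd (fst z))" "continuous_map ?Z ?D (\<lambda>z. snd (snd z))"
    using continuous_map_compose [OF f(1) D1] continuous_map_compose [OF f(2) D1] by (simp_all add: o_def)
  have "continuous_map (prod_topology ?D ?D) ?D (\<lambda>z. fst z \<otimes>\<^bsub>B\<^esub> snd z)"
    by (auto simp flip: prod_topology_discrete_topology)
  moreover have "continuous_map ?Z (prod_topology ?D ?D) (\<lambda>z. (snd (fst z), snd (snd z)))"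
    using k by (simp add: continuous_map_pairwise o_def)
  ultimately have "continuous_map ?Z ?D ((\<lambda>z. fst z \<otimes>\<^bsub>B\<^esub> snd z) \<circ> (\<lambda>z. (snd (fst z), snd (snd z))))"
    by (rule continuous_map_compose [rotated])
  then have "continuous_map ?Z ?D (\<lambda>z. snd (fst z) \<otimes>\<^bsub>B\<^esub> snd (snd z))"
    by (simp add: o_def)
  moreover have "continuous_map ?Z T (\<lambda>z. fst (fst z) \<otimes> fst (snd z))"
    using x by (rule continuous_map_mult2)
  ultimately have "continuous_map ?Z ext_topology (\<lambda>z. (fst (fst z) \<otimes> fst (snd z), snd (fst z) \<otimes>\<^bsub>B\<^esub> snd (snd z)))"
    unfolding ext_topology_def by (simp add: continuous_map_pairwise o_def)
  then show "continuous_map ?Z ext_topology (\<lambda>(x, y). x \<otimes>\<^bsub>ext_group\<^esub> y)"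
    by (rule continuous_map_eq) (auto simp: ext_mult)
  have invB: "continuous_map ?D ?D (\<lambda>k. inv\<^bsub>B\<^esub> k)" by auto
  have "continuous_map ext_topology ?D (\<lambda>z. inv\<^bsub>B\<^esub> (snd z))"
    using continuous_map_compose [OF D1 invB] by (simp add: o_def)
  moreover have "continuous_map ext_topology T (\<lambda>z. inv (fst z))"
    using T1 by (rule continuous_map_inv2)
  ultimately have "continuous_map ext_topology (prod_topology T ?D) (\<lambda>z. (inv (fst z), inv\<^bsub>B\<^esub> (snd z)))"
    by (simp add: continuous_map_pairwise o_def)
  then have "continuous_map ext_topology ext_topology (\<lambda>z. (inv (fst z), inv\<^bsub>B\<^esub> (snd z)))"
    by (simp only: ext_topology_def)
  then show "continuous_map ext_topology ext_topology (\<lambda>z. inv\<^bsub>ext_group\<^esub> z)"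
    by (rule continuous_map_eq)
       (auto simp: ext_topology_def ext_group_def inv_DirProd [OF is_group B.is_group])
qed

lemma ext_action_apply: "x \<in> carrier X \<Longrightarrow> k \<in> carrier B \<Longrightarrow> ext_action g (x, k) = (\<alpha> g x \<otimes> twist g k, shift g k)"
  by (simp add: ext_action_def)

lemma ext_algebraic_action: "algebraic_action G ext_group ext_topology ext_action"
proof (rule algebraic_actionI [OF ext_compact_metrizable G.is_group])
  fix g assume g: "g \<in> carrier G"
  show "ext_action g \<in> extensional (carrier ext_group)" by (simp add: ext_action_def)
  let ?D = "discrete_topology (carrier B)"
  have T1: "continuous_map ext_topology T fst" and D1: "continuous_map ext_topology ?D snd"
    unfolding ext_topology_def by (rule continuous_map_fst continuous_map_snd)+
  have "continuous_map ext_topology T (\<lambda>z. \<alpha> g (fst z))"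
    using continuous_map_compose [OF T1 act_cont [OF g]] by (simp add: o_def)
  moreover have tw: "continuous_map ?D T (twist g)" and sh: "continuous_map ?D ?D (shift g)"
    using g by auto
  have "continuous_map ext_topology T (\<lambda>z. twist g (snd z))" "continuous_map ext_topology ?D (\<lambda>z. shift g (snd z))"
    using continuous_map_compose [OF D1 tw] continuous_map_compose [OF D1 sh] by (simp_all add: o_def)
  ultimately have "continuous_map ext_topology (prod_topology T ?D) (\<lambda>z. (\<alpha> g (fst z) \<otimes> twist g (snd z), shift g (snd z)))"
    by (simp add: continuous_map_pairwise o_def continuous_map_mult2)
  then have "continuous_map ext_topology ext_topology (\<lambda>z. (\<alpha> g (fst z) \<otimes> twist g (snd z), shift g (snd z)))"
    by (simp only: ext_topology_def)
  then show "continuous_map ext_topology ext_topology (ext_action g)"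
    by (rule continuous_map_eq) (auto simp: ext_topology_def ext_action_def)
  fix z assume z: "z \<in> carrier ext_group"
  then obtain x k where [simp]: "z = (x, k)" and xk: "x \<in> carrier X" "k \<in> carrier B" by auto
  show "ext_action g z \<in> carrier ext_group" using g xk by (simp add: ext_action_apply)
  show "ext_action (g \<otimes>\<^bsub>G\<^esub> h) z = ext_action g (ext_action h z)" if h: "h \<in> carrier G" for h
    using g h xk by (simp add: ext_action_apply act_comp act_mult twist_comp shift_comp m_assoc)
  fix w assume "w \<in> carrier ext_group"
  then obtain y l where [simp]: "w = (y, l)" and yl: "y \<in> carrier X" "l \<in> carrier B" by auto
  have "\<alpha> g x \<otimes> \<alpha> g y \<otimes> (twist g k \<otimes> twist g l) = \<alpha> g x \<otimes> twist g k \<otimes> (\<alpha> g y \<otimes> twist g l)"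
    using g xk yl by (simp add: m_ac)
  then show "ext_action g (z \<otimes>\<^bsub>ext_group\<^esub> w) = ext_action g z \<otimes>\<^bsub>ext_group\<^esub> ext_action g w"
    using g xk yl by (simp add: ext_action_apply ext_mult act_mult twist_mult shift_mult)
next
  fix z assume "z \<in> carrier ext_group"
  then show "ext_action \<one>\<^bsub>G\<^esub> z = z" by (auto simp: ext_action_apply twist_one_left shift_one)
qed

sublocale ext: alg_action ext_group ext_topology G ext_action
  using ext_compact_metrizable ext_algebraic_action by unfold_locales

lemma ext_equivariant_hom: "equivariant_hom X T G \<alpha> ext_group ext_topology ext_action (\<lambda>x. (x, \<one>\<^bsub>B\<^esub>))"
proof -
  have "continuous_map T ext_topology (\<lambda>x. (x, \<one>\<^bsub>B\<^esub>))"
    unfolding ext_topology_def by (simp add: continuous_map_pairwise o_def continuous_map_id [unfolded id_def])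
  moreover have "shift g \<one>\<^bsub>B\<^esub> = \<one>\<^bsub>B\<^esub>" if "g \<in> carrier G" for g
    using that move_closed [OF _ G.inv_closed] by (auto simp: shift_def B_one)
  ultimately show ?thesis
    using alg_action_axioms ext.alg_action_axioms
    by (auto simp: equivariant_hom_def equivariant_hom_axioms_def hom_def ext_mult ext_action_apply twist_one_right)
qed

lemma ext_pow: "(\<one>, k) [^]\<^bsub>ext_group\<^esub> (m::nat) = (\<one>, k [^]\<^bsub>B\<^esub> m)"
  by (induction m) (simp_all add: ext_one ext_mult)

lemma B_pow: "k \<in> carrier B \<Longrightarrow> k [^]\<^bsub>B\<^esub> n = \<one>\<^bsub>B\<^esub>"
proof -
  have step: "(int m * a mod int n + a) mod int n = int (Suc m) * a mod int n" for m a
    by (simp add: mod_add_left_eq distrib_right add.commute [of a])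
  have "k [^]\<^bsub>B\<^esub> m = (\<lambda>p\<in>I. (int m * k p) mod int n)" for m :: nat
  proof (induction m)
    case (Suc m)
    have "k [^]\<^bsub>B\<^esub> Suc m = (\<lambda>p\<in>I. ((\<lambda>p\<in>I. (int m * k p) mod int n) p + k p) mod int n)"
      by (simp only: B.nat_pow_Suc B_mult Suc.IH)
    also have "\<dots> = (\<lambda>p\<in>I. (int (Suc m) * k p) mod int n)"
      by (rule restrict_ext) (simp only: restrict_apply' step)
    finally show ?case .
  qed (simp add: B_one)
  then show ?thesis by (simp add: B_one)
qed

text \<open>A character of the extension that is trivial on \<open>X\<close> factors through the
  finite group \<open>B\<close> and takes \<open>n\<close>-th roots of unity as values. So
  restriction to \<open>X\<close> has a finite kernel on the duals.\<close>

lemma ext_noetherian: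
  assumes "noetherian_dual G X T \<alpha>"
  shows "noetherian_dual G ext_group ext_topology ext_action"
proof -
  interpret i: equivariant_hom X T G \<alpha> ext_group ext_topology ext_action "\<lambda>x. (x, \<one>\<^bsub>B\<^esub>)"
    by (rule ext_equivariant_hom)
  let ?K = "{\<phi> \<in> carrier ext.D. i.pull \<phi> = \<one>\<^bsub>D\<^esub>}"
  let ?R = "carrier B \<rightarrow>\<^sub>E {z::complex. z ^ n = 1}"
  define F :: "(('g set \<Rightarrow> int) \<Rightarrow> complex) \<Rightarrow> 'x \<times> ('g set \<Rightarrow> int) \<Rightarrow> complex"
    where "F f = (\<lambda>z\<in>carrier ext_group. f (snd z))" for f
  have "?K \<subseteq> F ` ?R"
  proof
    fix \<phi> assume "\<phi> \<in> ?K"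
    then have \<phi>: "\<phi> \<in> carrier ext.D" and pull: "i.pull \<phi> = \<one>\<^bsub>D\<^esub>" by auto
    have triv: "\<phi> (x, \<one>\<^bsub>B\<^esub>) = 1" if "x \<in> carrier X" for x
      using fun_cong [OF pull, of x] that by (simp add: i.pull_def dual_one_eq)
    have split: "\<phi> (x, k) = \<phi> (\<one>, k)" if xk: "x \<in> carrier X" "k \<in> carrier B" for x k
      using ext.dualD(2) [OF \<phi>, of "(x, \<one>\<^bsub>B\<^esub>)" "(\<one>, k)"] xk triv by (simp add: ext_mult)
    have "\<phi> (\<one>, k) ^ n = 1" if k: "k \<in> carrier B" for k
    proof -
      have "(\<one>, k) [^]\<^bsub>ext_group\<^esub> n = (\<one>, \<one>\<^bsub>B\<^esub>)"
        using k by (simp add: ext_pow B_pow)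
      then show ?thesis
        using ext.dual_apply_nat_pow [OF \<phi>, of "(\<one>, k)" n] ext.dualD(4) [OF \<phi>] k by simp
    qed
    then have "(\<lambda>k\<in>carrier B. \<phi> (\<one>, k)) \<in> ?R" by auto
    moreover have "\<phi> = F (\<lambda>k\<in>carrier B. \<phi> (\<one>, k))"
    proof
      fix z show "\<phi> z = F (\<lambda>k\<in>carrier B. \<phi> (\<one>, k)) z"
      proof (cases "z \<in> carrier ext_group")
        case True
        then show ?thesis using split [of "fst z" "snd z"] by (simp add: F_def mem_Times_iff)
      next
        case False
        then show ?thesis using extensional_arb [OF ext.dualD(6) [OF \<phi>] False] by (simp only: F_def restrict_apply if_False)
      qed
    qed
    ultimately show "\<phi> \<in> F ` ?R" by blast
  qed
  moreover have "finite ?R"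
    using finite_B finite_roots_unity [of n] n by (intro finite_PiE) auto
  ultimately have "finite ?K" using finite_subset by blast
  then show ?thesis by (rule i.noetherian_if_dual_finite_kernel [OF assms])
qed

lemma virtually_coboundary_if_dense:
  assumes dense: "ext_topology closure_of {z \<in> carrier ext_group. periodic_point G ext_action z} = topspace ext_topology"
  shows "virtually_coboundary L c"
proof -
  define e where "e = (\<lambda>p\<in>I. if p = L then 1 else 0 :: int)"
  have e: "e \<in> carrier B" unfolding B_carrier e_def using n by auto
  have "openin ext_topology (carrier X \<times> {e})"
    unfolding ext_topology_def openin_prod_Times_iff using e openin_topspace [of T] by simp
  moreover have "carrier X \<times> {e} \<noteq> {}" using one_closed by blast
  ultimately have "{z \<in> carrier ext_group. periodic_point G ext_action z} \<inter> (carrier X \<times> {e}) \<noteq> {}"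
    using dense unfolding dense_intersects_open by blast
  then obtain x where x: "x \<in> carrier X" "periodic_point G ext_action (x, e)" by auto
  let ?S = "{g \<in> carrier G. ext_action g (x, e) = (x, e)}"
  have S: "finite_index_subgroup (?S \<inter> L) G"
    using x e c(1) by (intro G.finite_index_Int ext.finite_index_stabilizer) auto
  \<comment> \<open>Pairing with the indicator \<open>e\<close> leaves the factor at
    \<open>L\<close>, which is \<open>c g\<close>. Being fixed says that \<open>g\<close> moves
    \<open>x\<close> by the inverse of \<open>c g\<close>, which is why the witness is
    \<open>inv x\<close> and not \<open>x\<close>.\<close>
  have "c g = \<alpha> g (inv x) \<otimes> inv (inv x)" if g: "g \<in> ?S \<inter> L" for g
  proof -
    have gG: "g \<in> carrier G" using g by blast
    have "twist g e = finprod X (\<lambda>p. if p = L then shapiro g p else \<one>) I"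
      unfolding twist_def using gG by (intro finprod_cong') (auto simp: e_def)
    also have "\<dots> = shapiro g L"
      using finprod_singleton_swap [OF L_in_I finite_I, of "shapiro g"] gG by auto
    finally have "twist g e = c g" using shapiro_base g by simp
    then have eq: "\<alpha> g x \<otimes> c g = x" using g x(1) e by (simp add: ext_action_apply)
    have cg: "c g \<in> carrier X" using c(4) g by blast
    have "c g = inv (\<alpha> g x) \<otimes> (\<alpha> g x \<otimes> c g)"
      using cg gG x(1) by (simp flip: m_assoc)
    then show ?thesis using eq gG x(1) by (simp add: act_inv)
  qed
  then show ?thesis
    unfolding virtually_coboundary_def using S x(1) by (intro bexI [of _ "inv x"] exI [of _ "?S \<inter> L"]) auto
qed

end

section \<open>The converse implication and the equivalence\<close>

theorem trivial_virtual_H1I: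
  fixes G :: "('g, 'm) monoid_scheme"
  assumes countable: "countable (carrier G)" and dense: "dense_periodic_points TYPE(real) G"
  shows "trivial_virtual_H1 TYPE('x) G"
  unfolding trivial_virtual_H1_def
proof (intro allI impI, elim conjE)
  fix X :: "'x monoid" and T \<alpha> assume "noetherian_action G X T \<alpha>" and zd: "zero_dimensional X T"
  note noeth = noetherian_actionD [OF \<open>noetherian_action G X T \<alpha>\<close>]
  interpret alg_action X T G \<alpha> by (rule noeth(1))
  obtain m :: nat where m: "m > 0" "\<And>x. x \<in> carrier X \<Longrightarrow> x [^]\<^bsub>X\<^esub> m = \<one>\<^bsub>X\<^esub>"
    using zero_dimensional_bounded_torsion [OF noeth(2) zd] by metis
  have "virtually_coboundary L c" if Lc: "(L, c) \<in> virtual_cocycles G X \<alpha>" for L c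
  proof -
    \<comment> \<open>The exponent is doubled because \<open>m\<close> may be \<open>1\<close>,
      while the extension requires an exponent greater than \<open>1\<close>.\<close>
    interpret cocycle_extension X T G \<alpha> "m + m" L c
    proof (intro cocycle_extension.intro alg_action_axioms cocycle_extension_axioms.intro Lc)
      fix x assume "x \<in> carrier X"
      then show "x [^]\<^bsub>X\<^esub> (m + m) = \<one>\<^bsub>X\<^esub>" using m(2) by (simp flip: nat_pow_mult)
    qed (use m in simp)
    \<comment> \<open>The carrier of the extension is a set of pairs, so density for it is first
      transferred from the instance at \<open>real\<close>.\<close>
    have "dense_periodic_points TYPE('x \<times> ('g set \<Rightarrow> int)) G"
      using dense_periodic_points_transfer [OF dense countable] .
    then have "ext_topology closure_of {z \<in> carrier ext_group. periodic_point G ext_action z} = topspace ext_topology"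
      using ext.noetherian_actionI [OF ext_noetherian [OF noeth(2)]] unfolding dense_periodic_points_def by blast
    then show ?thesis by (rule virtually_coboundary_if_dense)
  qed
  then show "trivial_group (virtual_H1 G X \<alpha>)" by (simp add: trivial_virtual_H1_iff)
qed

theorem nonzero_periodic_pointsI:
  fixes G :: "('g, 'm) monoid_scheme"
  assumes countable: "countable (carrier G)" and dense: "dense_periodic_points TYPE(real) G"
  shows "nonzero_periodic_points TYPE('x) G"
  unfolding nonzero_periodic_points_def
proof (intro allI impI, elim conjE, rule ccontr)
  fix X :: "'x monoid" and T \<alpha> assume noeth: "noetherian_action G X T \<alpha>" and ne: "carrier X \<noteq> {\<one>\<^bsub>X\<^esub>}"
    and none: "\<not> (\<exists>x\<in>carrier X. x \<noteq> \<one>\<^bsub>X\<^esub> \<and> periodic_point G \<alpha> x)"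
  interpret alg_action X T G \<alpha> by (rule noetherian_actionD(1) [OF noeth])
  have sub: "{x \<in> carrier X. periodic_point G \<alpha> x} \<subseteq> {\<one>\<^bsub>X\<^esub>}" using none by blast
  have "dense_periodic_points TYPE('x) G" using dense countable by (rule dense_periodic_points_transfer)
  then have "T closure_of {x \<in> carrier X. periodic_point G \<alpha> x} = topspace T"
    using noeth unfolding dense_periodic_points_def by blast
  moreover have "T closure_of {x \<in> carrier X. periodic_point G \<alpha> x} \<subseteq> {\<one>\<^bsub>X\<^esub>}"
    using sub closed_one by (rule closure_of_minimal)
  ultimately have "carrier X \<subseteq> {\<one>\<^bsub>X\<^esub>}" by simp
  with ne one_closed show False by blast
qed

theorem theorem2p5:
  fixes G :: "('g, 'm) monoid_scheme"
  assumes "group G" and "countable (carrier G)"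
  shows "(nonzero_periodic_points TYPE(real) G \<and> trivial_virtual_H1 TYPE(real) G \<longrightarrow>
            dense_periodic_points TYPE('x) G) \<and>
         (dense_periodic_points TYPE(real) G \<longrightarrow>
            nonzero_periodic_points TYPE('x) G \<and> trivial_virtual_H1 TYPE('x) G)"
proof (intro conjI impI; (elim conjE)?)
  show "dense_periodic_points TYPE('x) G"
    if "nonzero_periodic_points TYPE(real) G" "trivial_virtual_H1 TYPE(real) G"
    using assms(2) that by (rule dense_periodic_pointsI)
  show "nonzero_periodic_points TYPE('x) G" "trivial_virtual_H1 TYPE('x) G"
    if "dense_periodic_points TYPE(real) G"
    using nonzero_periodic_pointsI [OF assms(2) that] trivial_virtual_H1I [OF assms(2) that] .
qed

end
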